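(* For all integers $d\ge 1$, $k\ge 1$ and $1\le i\le k$, $$\mathcal{B}_{d,k,i}(a)=Q_{d,k,i}(a),$$ and for $(d,k)\in\{(2,2),(2,3),(2,4),(3,3),(3,4),(3,5)\}$ and $1\le i\le k$, $$\mathcal{B}_{d,k,i}(a)=Q_{d,k,i}(a)=F_{d,k,i}(a).$$
   Context: Throughout $|q|<1$, $(x;q)_m=\prod_{j=0}^{m-1}(1-xq^j)$, $(x;q)_\infty=\prod_{j\ge 0}(1-xq^j)$; identities are between power series in $a$ and $q$. By convention $1/(q;q)_m=0$ for $m<0$, and terms containing such a factor are $0$. A common factor $1-a$ of numerator and denominator is cancelled. Let $b_{d,k,i}(m,n)$ be the number of partitions of $n$ with exactly $m$ parts in which $d$ appears as a part at most $i-1$ times, for every $j\ge1$ the total number of appearances of $dj$ and $dj+d$ together is at most $k-1$, and nonmultiples of $d$ may appear without restriction. Put $\mathcal{B}_{d,k,i}(a)=\sum_{m,n\ge 0}b_{d,k,i}(m,n)a^mq^n$. $$Q_{d,k,i}(a)=\frac{1}{(aq;q)_\infty}\sum_{n\ge 0}\frac{(-1)^na^{kn}q^{(dk+\frac d2)n^2+(k-i+\frac12)dn}(1-a^iq^{(2n+1)di})(aq^d;q^d)_n}{(q^d;q^d)_n}.$$ The functions $F_{d,k,i}(a)$ are (all sums over $n\ge 0$, and over $r\ge 0$ where $r$ occurs): $F_{2,2,1}(a)=\sum_n\frac{a^nq^{\frac32n^2+\frac32n}}{(aq;q^2)_{n+1}(q;q)_n}$, $F_{2,2,2}(a)=\sum_n\frac{a^nq^{\frac32n^2-\frac12n}}{(aq;q^2)_n(q;q)_n}$.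 $F_{2,3,1}(a)=\sum_n\frac{a^nq^{n^2+2n}}{(aq;q^2)_{n+1}(q;q)_n}$, $F_{2,3,2}(a)=\sum_n\frac{a^nq^{n^2+n}}{(aq;q^2)_{n+1}(q;q)_n}$, $F_{2,3,3}(a)=\sum_n\frac{a^nq^{n^2}}{(aq;q^2)_n(q;q)_n}$. $F_{2,4,1}(a)=\sum_{n,r}\frac{a^{n+r}q^{n^2+2n+2r^2+2r}}{(aq;q^2)_{n+1}(q;q)_{n-2r}(q^2;q^2)_r}$, $F_{2,4,2}(a)=\sum_{n,r}\frac{a^{n+r}q^{n^2+2n+2r^2+2r}(1+aq^{2r+2})}{(aq;q^2)_{n+1}(q;q)_{n-2r}(q^2;q^2)_r}$, $F_{2,4,3}(a)=\sum_{n,r}\frac{a^{n+r}q^{n^2+2r^2+2r}}{(aq;q^2)_n(q;q)_{n-2r}(q^2;q^2)_r}$, $F_{2,4,4}(a)=\sum_{n,r}\frac{a^{n+r}q^{n^2+2r^2}}{(aq;q^2)_n(q;q)_{n-2r}(q^2;q^2)_r}$. $F_{3,3,1}(a)=\sum_{n,r}\frac{(-1)^ra^nq^{n^2+3n+3r(r-1)/2}(aq^3;q^3)_{n-r}}{(aq;q)_{2n+2}(q;q)_{n-3r}(q^3;q^3)_r}$, $F_{3,3,2}(a)=\sum_{n,r}\frac{(-1)^ra^{n-1}q^{n^2+3r(r-3)/2}(a;q^3)_{n-r}(1+aq^{3r}-q^{3r})}{(a;q)_{2n}(q;q)_{n-3r}(q^3;q^3)_r}$, $F_{3,3,3}(a)=\sum_{n,r}\frac{(-1)^ra^nq^{n^2+3r(r-1)/2}(a;q^3)_{n-r}}{(a;q)_{2n}(q;q)_{n-3r}(q^3;q^3)_r}$.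 $F_{3,4,1}(a)=\sum_n\frac{a^nq^{n(n+3)}(aq^3;q^3)_n}{(aq;q)_{2n+2}(q;q)_n}$, $F_{3,4,2}(a)=\sum_n\frac{a^nq^{n(n+2)}(aq^3;q^3)_n}{(aq;q)_{2n+2}(q;q)_n}$, $F_{3,4,3}(a)=\sum_n\frac{a^nq^{n(n+1)}(aq^3;q^3)_n}{(aq;q)_{2n+1}(q;q)_n}$, $F_{3,4,4}(a)=\sum_n\frac{a^nq^{n^2}(a;q^3)_n}{(a;q)_{2n}(q;q)_n}$. $F_{3,5,1}(a)=\sum_{n,r}\frac{a^{n+r}q^{n^2+3r^2+3n+3r}(aq^3;q^3)_{n-r}}{(aq;q)_{2n+2}(q;q)_{n-3r}(q^3;q^3)_r}$, $F_{3,5,2}(a)=\sum_{n,r}\frac{a^{n+r}q^{n^2+3r^2+3n+3r}(aq^3;q^3)_{n-r}(1+aq^{3r+3})}{(aq;q)_{2n+2}(q;q)_{n-3r}(q^3;q^3)_r}$, $F_{3,5,3}(a)=\sum_{n,r}\frac{a^{n+r-1}q^{n^2+3r^2-3}(a;q^3)_{n-r}(q^{3r}+aq^{6r+3}-1)}{(a;q)_{2n}(q;q)_{n-3r}(q^3;q^3)_r}$, $F_{3,5,4}(a)=\sum_{n,r}\frac{a^{n+r}q^{n^2+3r^2+3r}(a;q^3)_{n-r}}{(a;q)_{2n}(q;q)_{n-3r}(q^3;q^3)_r}$, $F_{3,5,5}(a)=\sum_{n,r}\frac{a^{n+r}q^{n^2+3r^2}(a;q^3)_{n-r}}{(a;q)_{2n}(q;q)_{n-3r}(q^3;q^3)_r}$.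 *)

theory Defs
  imports
    "HOL-Analysis.Analysis"
    "HOL-Library.Multiset"
    "HOL-Computational_Algebra.Formal_Laurent_Series"
begin

text \<open>
  Identities between power series in \<open>a\<close> and \<open>q\<close> are stated in the field of iterated Laurent
  series \<open>\<rat>((a))((q))\<close>, which contains the ring \<open>\<rat>[[a]][[q]]\<close> of power series. The outer
  variable is \<open>q\<close>. Since this is a field, quotients such as \<open>1/(aq;q)\<^sub>m\<close> have their usual
  meaning, a common factor \<open>1 - a\<close> cancels, and summands with individual negative powers of
  \<open>a\<close> or \<open>q\<close> can be written down literally. Limits (infinite sums and products) refer to the
  library metric on Laurent series in the outer variable, i.e. to \<open>q\<close>-adic convergence.
\<close>

type_synonym series = "rat fls fls"

definition av :: series where "av = fls_const fls_X"
definition qv :: series where "qv = fls_X"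

definition qpoch :: "series \<Rightarrow> series \<Rightarrow> nat \<Rightarrow> series" where
  "qpoch x p m = (\<Prod>j<m. 1 - x * p ^ j)"

definition qpoch_inf :: "series \<Rightarrow> series \<Rightarrow> series" where
  "qpoch_inf x p = (\<Prod>j. 1 - x * p ^ j)"

text \<open>\<open>1/(p;p)\<^sub>m\<close>, with the convention that it is \<open>0\<close> for \<open>m < 0\<close>.\<close>

definition recip_qpoch :: "series \<Rightarrow> int \<Rightarrow> series" where
  "recip_qpoch p m = (if m < 0 then 0 else 1 / qpoch p p (nat m))"

text \<open>A partition is encoded as the multiset of its (positive) parts.\<close>

definition partitions_B :: "nat \<Rightarrow> nat \<Rightarrow> nat \<Rightarrow> nat \<Rightarrow> nat \<Rightarrow> nat multiset set" where
  "partitions_B d k i m n =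
     {M. 0 \<notin># M \<and> sum_mset M = n \<and> size M = m \<and>
         count M d \<le> i - 1 \<and>
         (\<forall>j\<ge>1. count M (d * j) + count M (d * j + d) \<le> k - 1)}"

lemma finite_partitions_B: "finite (partitions_B d k i m n)"
proof (rule finite_subset)
  show "partitions_B d k i m n \<subseteq> multisets_of_size {..n} m"
    by (auto simp: partitions_B_def multisets_of_size_def dest!: multi_member_split)
  show "finite (multisets_of_size {..n} m)"
    by (rule finite_multisets_of_size) simp
qed

definition b_count :: "nat \<Rightarrow> nat \<Rightarrow> nat \<Rightarrow> nat \<Rightarrow> nat \<Rightarrow> nat" where
  "b_count d k i m n = card (partitions_B d k i m n)"

text \<open>The series with coefficient \<open>b_count d k i m n\<close> at \<open>a\<^sup>m q\<^sup>n\<close>.\<close>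

definition B_series :: "nat \<Rightarrow> nat \<Rightarrow> nat \<Rightarrow> series" where
  "B_series d k i =
     fps_to_fls (Abs_fps (\<lambda>n. fps_to_fls (Abs_fps (\<lambda>m. of_nat (b_count d k i m n)))))"

text \<open>
  The exponent of \<open>q\<close> is
  \<open>(dk + d/2) n\<^sup>2 + (k - i + 1/2) d n = ((2dk + d) n\<^sup>2 + (2(k - i) + 1) d n) / 2\<close>,
  where the division is exact.
\<close>

lemma even_Q_exponent: "even ((2 * d * k + d) * n\<^sup>2 + (2 * (k - i) + 1) * d * (n::nat))"
  by auto

definition Q_series :: "nat \<Rightarrow> nat \<Rightarrow> nat \<Rightarrow> series" where
  "Q_series d k i =
     1 / qpoch_inf (av * qv) qv *
     (\<Sum>\<^sub>\<infinity>n\<in>UNIV.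
        (-1) ^ n * av ^ (k * n) *
        qv ^ (((2 * d * k + d) * n\<^sup>2 + (2 * (k - i) + 1) * d * n) div 2) *
        (1 - av ^ i * qv ^ ((2 * n + 1) * d * i)) * qpoch (av * qv ^ d) (qv ^ d) n /
        qpoch (qv ^ d) (qv ^ d) n)"

text \<open>
  In the double sums the truncated subtraction \<open>n - r\<close> is harmless: for \<open>r > n\<close> the term
  vanishes because of its factor \<open>recip_qpoch\<close>.
\<close>

definition F221 :: series where
  "F221 =
     (\<Sum>\<^sub>\<infinity>n\<in>UNIV.
        av ^ n * qv ^ ((3 * n\<^sup>2 + 3 * n) div 2) /
        (qpoch (av * qv) (qv\<^sup>2) (n + 1) * qpoch qv qv n))"

definition F222 :: series where
  "F222 =
     (\<Sum>\<^sub>\<infinity>n\<in>UNIV.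
        av ^ n * qv ^ ((3 * n\<^sup>2 - n) div 2) /
        (qpoch (av * qv) (qv\<^sup>2) n * qpoch qv qv n))"

definition F231 :: series where
  "F231 =
     (\<Sum>\<^sub>\<infinity>n\<in>UNIV.
        av ^ n * qv ^ (n\<^sup>2 + 2 * n) /
        (qpoch (av * qv) (qv\<^sup>2) (n + 1) * qpoch qv qv n))"

definition F232 :: series where
  "F232 =
     (\<Sum>\<^sub>\<infinity>n\<in>UNIV.
        av ^ n * qv ^ (n\<^sup>2 + n) /
        (qpoch (av * qv) (qv\<^sup>2) (n + 1) * qpoch qv qv n))"

definition F233 :: series where
  "F233 =
     (\<Sum>\<^sub>\<infinity>n\<in>UNIV.
        av ^ n * qv ^ (n\<^sup>2) /
        (qpoch (av * qv) (qv\<^sup>2) n * qpoch qv qv n))"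

definition F241 :: series where
  "F241 =
     (\<Sum>\<^sub>\<infinity>(n, r)\<in>UNIV.
        av ^ (n + r) * qv ^ (n\<^sup>2 + 2 * n + 2 * r\<^sup>2 + 2 * r) /
        qpoch (av * qv) (qv\<^sup>2) (n + 1) *
        recip_qpoch qv (int n - 2 * int r) * recip_qpoch (qv ^ 2) (int r))"

definition F242 :: series where
  "F242 =
     (\<Sum>\<^sub>\<infinity>(n, r)\<in>UNIV.
        av ^ (n + r) * qv ^ (n\<^sup>2 + 2 * n + 2 * r\<^sup>2 + 2 * r) * (1 + av * qv ^ (2 * r + 2)) /
        qpoch (av * qv) (qv\<^sup>2) (n + 1) *
        recip_qpoch qv (int n - 2 * int r) * recip_qpoch (qv ^ 2) (int r))"

definition F243 :: series where
  "F243 =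
     (\<Sum>\<^sub>\<infinity>(n, r)\<in>UNIV.
        av ^ (n + r) * qv ^ (n\<^sup>2 + 2 * r\<^sup>2 + 2 * r) /
        qpoch (av * qv) (qv\<^sup>2) n *
        recip_qpoch qv (int n - 2 * int r) * recip_qpoch (qv ^ 2) (int r))"

definition F244 :: series where
  "F244 =
     (\<Sum>\<^sub>\<infinity>(n, r)\<in>UNIV.
        av ^ (n + r) * qv ^ (n\<^sup>2 + 2 * r\<^sup>2) /
        qpoch (av * qv) (qv\<^sup>2) n *
        recip_qpoch qv (int n - 2 * int r) * recip_qpoch (qv ^ 2) (int r))"

definition F331 :: series where
  "F331 =
     (\<Sum>\<^sub>\<infinity>(n, r)\<in>UNIV.
        (-1) ^ r * av ^ n * qv ^ (n\<^sup>2 + 3 * n + 3 * r * (r - 1) div 2) *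
        qpoch (av * qv ^ 3) (qv ^ 3) (n - r) /
        qpoch (av * qv) qv (2 * n + 2) *
        recip_qpoch qv (int n - 3 * int r) * recip_qpoch (qv ^ 3) (int r))"

definition F332 :: series where
  "F332 =
     (\<Sum>\<^sub>\<infinity>(n, r)\<in>UNIV.
        (-1) ^ r * av powi (int n - 1) * qv powi ((int n)\<^sup>2 + 3 * int r * (int r - 3) div 2) *
        qpoch av (qv ^ 3) (n - r) * (1 + av * qv ^ (3 * r) - qv ^ (3 * r)) /
        qpoch av qv (2 * n) *
        recip_qpoch qv (int n - 3 * int r) * recip_qpoch (qv ^ 3) (int r))"

definition F333 :: series where
  "F333 =
     (\<Sum>\<^sub>\<infinity>(n, r)\<in>UNIV.
        (-1) ^ r * av ^ n * qv ^ (n\<^sup>2 + 3 * r * (r - 1) div 2) *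
        qpoch av (qv ^ 3) (n - r) /
        qpoch av qv (2 * n) *
        recip_qpoch qv (int n - 3 * int r) * recip_qpoch (qv ^ 3) (int r))"

definition F341 :: series where
  "F341 =
     (\<Sum>\<^sub>\<infinity>n\<in>UNIV.
        av ^ n * qv ^ (n * (n + 3)) *
        qpoch (av * qv ^ 3) (qv ^ 3) n /
        (qpoch (av * qv) qv (2 * n + 2) * qpoch qv qv n))"

definition F342 :: series where
  "F342 =
     (\<Sum>\<^sub>\<infinity>n\<in>UNIV.
        av ^ n * qv ^ (n * (n + 2)) *
        qpoch (av * qv ^ 3) (qv ^ 3) n /
        (qpoch (av * qv) qv (2 * n + 2) * qpoch qv qv n))"

definition F343 :: series where
  "F343 =
     (\<Sum>\<^sub>\<infinity>n\<in>UNIV.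
        av ^ n * qv ^ (n * (n + 1)) *
        qpoch (av * qv ^ 3) (qv ^ 3) n /
        (qpoch (av * qv) qv (2 * n + 1) * qpoch qv qv n))"

definition F344 :: series where
  "F344 =
     (\<Sum>\<^sub>\<infinity>n\<in>UNIV.
        av ^ n * qv ^ (n\<^sup>2) *
        qpoch av (qv ^ 3) n /
        (qpoch av qv (2 * n) * qpoch qv qv n))"

definition F351 :: series where
  "F351 =
     (\<Sum>\<^sub>\<infinity>(n, r)\<in>UNIV.
        av ^ (n + r) * qv ^ (n\<^sup>2 + 3 * r\<^sup>2 + 3 * n + 3 * r) *
        qpoch (av * qv ^ 3) (qv ^ 3) (n - r) /
        qpoch (av * qv) qv (2 * n + 2) *
        recip_qpoch qv (int n - 3 * int r) * recip_qpoch (qv ^ 3) (int r))"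

definition F352 :: series where
  "F352 =
     (\<Sum>\<^sub>\<infinity>(n, r)\<in>UNIV.
        av ^ (n + r) * qv ^ (n\<^sup>2 + 3 * r\<^sup>2 + 3 * n + 3 * r) *
        qpoch (av * qv ^ 3) (qv ^ 3) (n - r) * (1 + av * qv ^ (3 * r + 3)) /
        qpoch (av * qv) qv (2 * n + 2) *
        recip_qpoch qv (int n - 3 * int r) * recip_qpoch (qv ^ 3) (int r))"

definition F353 :: series where
  "F353 =
     (\<Sum>\<^sub>\<infinity>(n, r)\<in>UNIV.
        av powi (int n + int r - 1) * qv powi ((int n)\<^sup>2 + 3 * (int r)\<^sup>2 - 3) *
        qpoch av (qv ^ 3) (n - r) * (qv ^ (3 * r) + av * qv ^ (6 * r + 3) - 1) /
        qpoch av qv (2 * n) *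
        recip_qpoch qv (int n - 3 * int r) * recip_qpoch (qv ^ 3) (int r))"

definition F354 :: series where
  "F354 =
     (\<Sum>\<^sub>\<infinity>(n, r)\<in>UNIV.
        av ^ (n + r) * qv ^ (n\<^sup>2 + 3 * r\<^sup>2 + 3 * r) *
        qpoch av (qv ^ 3) (n - r) /
        qpoch av qv (2 * n) *
        recip_qpoch qv (int n - 3 * int r) * recip_qpoch (qv ^ 3) (int r))"

definition F355 :: series where
  "F355 =
     (\<Sum>\<^sub>\<infinity>(n, r)\<in>UNIV.
        av ^ (n + r) * qv ^ (n\<^sup>2 + 3 * r\<^sup>2) *
        qpoch av (qv ^ 3) (n - r) /
        qpoch av qv (2 * n) *
        recip_qpoch qv (int n - 3 * int r) * recip_qpoch (qv ^ 3) (int r))"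

text \<open>The value is irrelevant at triples for which no function is listed.\<close>

definition F_series :: "nat \<Rightarrow> nat \<Rightarrow> nat \<Rightarrow> series" where
  "F_series d k i =
    (if (d, k, i) = (2, 2, 1) then F221
     else if (d, k, i) = (2, 2, 2) then F222
     else if (d, k, i) = (2, 3, 1) then F231
     else if (d, k, i) = (2, 3, 2) then F232
     else if (d, k, i) = (2, 3, 3) then F233
     else if (d, k, i) = (2, 4, 1) then F241
     else if (d, k, i) = (2, 4, 2) then F242
     else if (d, k, i) = (2, 4, 3) then F243
     else if (d, k, i) = (2, 4, 4) then F244
     else if (d, k, i) = (3, 3, 1) then F331
     else if (d, k, i) = (3, 3, 2) then F332
     else if (d, k, i) = (3, 3, 3) then F333
     else if (d, k, i) = (3, 4, 1) then F341
     else if (d, k, i) = (3, 4, 2) then F342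
     else if (d, k, i) = (3, 4, 3) then F343
     else if (d, k, i) = (3, 4, 4) then F344
     else if (d, k, i) = (3, 5, 1) then F351
     else if (d, k, i) = (3, 5, 2) then F352
     else if (d, k, i) = (3, 5, 3) then F353
     else if (d, k, i) = (3, 5, 4) then F354
     else if (d, k, i) = (3, 5, 5) then F355
     else undefined)"

end

theory Submission
  imports Defs
begin

text \<open>
  All three families are solutions of one and the same system of \<open>q\<close>-difference equations, and
  that system has only one solution.

  Put \<open>p = q\<^sup>d\<close> and let \<open>x\<close> run through the arguments \<open>a q\<^sup>m\<close>. The system asks for functions
  \<open>J\<^sub>0, \<dots>, J\<^sub>k\<close> with \<open>J\<^sub>0 = 0\<close> and
  \<open>J\<^sub>i(x) - J\<^sub>i\<^sub>-\<^sub>1(x) = (x p)\<^bsup>i-1\<^esup> / (x q; q)\<^bsub>d-1\<^esub> \<cdot> J\<^bsub>k+1-i\<^esub>(x p)\<close> for \<open>1 \<le> i \<le> k\<close>, where \<open>J\<^sub>i(x) - 1\<close>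
  has at least the \<open>q\<close>-order of \<open>x\<close>. The difference of two solutions at \<open>x\<close> is controlled by the
  differences at \<open>x p\<close>, \<open>x p\<^sup>2\<close>, ..., whose orders tend to infinity, so it vanishes
  (\<open>gordon_system_unique\<close>).

  \<^item> For partitions the system says: a partition in which \<open>d\<close> occurs exactly \<open>i - 1\<close> times
    consists of arbitrary parts below \<open>d\<close>, of \<open>i - 1\<close> copies of \<open>d\<close>, and of parts above \<open>d\<close>;
    subtracting \<open>d\<close> from the last ones leaves a partition with at most \<open>k - i\<close> copies of \<open>d\<close>
    (\<open>B_gordon_system\<close>).
  \<^item> For the product-sum, the difference of two neighbouring summands splits into two pieces; one
    of them has to be moved by one summation step to give the summand on the right
    (\<open>Q_gordon_system\<close>). Together with the partition side this is the identity for all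
    \<open>d\<close>, \<open>k\<close>, \<open>i\<close>.
  \<^item> The single sums \<open>(d,k) = (2,2), (2,3), (3,4)\<close> belong to families indexed by a linear exponent
    and by the length of a Pochhammer symbol. Such a family satisfies two contiguous relations, and
    the equations of the system are linear combinations of them (\<open>F22_gordon_system\<close>,
    \<open>F23_gordon_system\<close>, \<open>F34_gordon_system\<close>).
  \<^item> The double sums come from the single sums by a change of \<open>k\<close>. If \<open>J\<close> solves the system for
    \<open>k\<close>, then suitable weighted sums \<open>\<Sum>\<^sub>r w\<^sub>r J\<^sub>i(x p\<^bsup>2r\<^esup>)\<close> solve it for \<open>k + 1\<close>, and the same sums
    with weights \<open>(-1)\<^sup>r p\<^bsup>r(r-1)/2\<^esup> w\<^sub>r\<close> lead from \<open>k + 1\<close> to \<open>k\<close> (\<open>raise_gordon_system\<close>,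
    \<open>lower_gordon_system\<close>). Summing a double sum by columns of constant \<open>r\<close> exhibits it as such a
    weighted sum: \<open>(2,4)\<close> arises from \<open>(2,3)\<close>, \<open>(3,5)\<close> from \<open>(3,4)\<close>, and \<open>(3,3)\<close> from \<open>(3,4)\<close>
    downwards. The remaining indices \<open>i\<close> then follow from the system itself.
\<close>

section \<open>The order filtration and summation in a ring of Laurent series\<close>

text \<open>
  Stated through coefficients instead of the subdegree, so that the zero series has every order and
  sums need no case distinction.
\<close>

definition ord_ge :: "int \<Rightarrow> 'a::zero fls \<Rightarrow> bool" where
  "ord_ge N f \<longleftrightarrow> (\<forall>n<N. fls_nth f n = 0)"

lemma ord_ge_mono: "ord_ge N f \<Longrightarrow> M \<le> N \<Longrightarrow> ord_ge M f"
  by (auto simp: ord_ge_def)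

lemma ord_ge_0 [simp]: "ord_ge N 0"
  by (simp add: ord_ge_def)

lemma ord_ge_add: "ord_ge N f \<Longrightarrow> ord_ge N g \<Longrightarrow> ord_ge N (f + g)" for f :: "'a::monoid_add fls"
  by (simp add: ord_ge_def)

lemma ord_ge_uminus: "ord_ge N f \<Longrightarrow> ord_ge N (- f)" for f :: "'a::group_add fls"
  by (simp add: ord_ge_def)

lemma ord_ge_diff: "ord_ge N f \<Longrightarrow> ord_ge N g \<Longrightarrow> ord_ge N (f - g)" for f :: "'a::group_add fls"
  by (simp add: ord_ge_def)

lemma ord_ge_sum: "(\<And>x. x \<in> A \<Longrightarrow> ord_ge N (f x)) \<Longrightarrow> ord_ge N (\<Sum>x\<in>A. f x)"
  for f :: "_ \<Rightarrow> 'a::comm_monoid_add fls"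
  by (simp add: ord_ge_def fls_nth_sum)

lemma ord_ge_subdegree: "f \<noteq> 0 \<Longrightarrow> ord_ge N f \<longleftrightarrow> N \<le> fls_subdegree f"
  by (auto simp: ord_ge_def intro!: fls_subdegree_geI)

lemma ord_ge_self: "ord_ge (fls_subdegree f) f"
  by (simp add: ord_ge_def)

lemma ord_ge_mult:
  fixes f g :: "'a::{comm_monoid_add,mult_zero} fls"
  assumes "ord_ge M f" "ord_ge N g"
  shows "ord_ge (M + N) (f * g)"
proof (cases "f = 0 \<or> g = 0")
  case False
  then show ?thesis
    using assms by (auto simp: ord_ge_subdegree ord_ge_def[of "M + N"] fls_times_nth_eq0)
qed auto

lemma ord_ge_mult_right:
  "ord_ge N f \<Longrightarrow> ord_ge 0 g \<Longrightarrow> ord_ge N (f * g)"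
  for f :: "'a::{comm_monoid_add,mult_zero} fls"
  using ord_ge_mult[of N f 0 g] by simp

lemma ord_ge_mult_left:
  "ord_ge 0 f \<Longrightarrow> ord_ge N g \<Longrightarrow> ord_ge N (f * g)"
  for f :: "'a::{comm_monoid_add,mult_zero} fls"
  using ord_ge_mult[of 0 f N g] by simp

lemma ord_ge_1: "ord_ge 0 (1 :: 'a::zero_neq_one fls)"
  by (simp add: ord_ge_def)

lemma ord_ge_prod: "(\<And>x. x \<in> A \<Longrightarrow> ord_ge 0 (f x)) \<Longrightarrow> ord_ge 0 (\<Prod>x\<in>A. f x)"
  for f :: "_ \<Rightarrow> 'a::comm_ring_1 fls"
  by (induction A rule: infinite_finite_induct) (auto intro: ord_ge_1 ord_ge_mult_left)

lemma ord_ge_power: "ord_ge N f \<Longrightarrow> ord_ge (int n * N) (f ^ n)" for f :: "'a::comm_ring_1 fls"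
proof (induction n)
  case (Suc n)
  from ord_ge_mult[OF Suc.prems Suc.IH[OF Suc.prems]] show ?case by (simp add: algebra_simps)
qed (simp add: ord_ge_1)

lemma ord_ge_power_0: "ord_ge 0 f \<Longrightarrow> ord_ge 0 (f ^ n)" for f :: "'a::comm_ring_1 fls"
  using ord_ge_power[of 0 f n] by simp

lemma ord_ge_all_imp_0: "(\<And>N. ord_ge (int N) f) \<Longrightarrow> f = 0"
proof (rule ccontr)
  assume *: "\<And>N. ord_ge (int N) f" and "f \<noteq> 0"
  from *[of "nat (fls_subdegree f + 1)"] \<open>f \<noteq> 0\<close> show False
    by (simp add: ord_ge_subdegree split: if_splits)
qed

text \<open>
  Balls around a series are cosets of the order filtration; this turns every topological statement
  about Laurent series into one about coefficients.
\<close>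

lemma dist_fls_less_iff:
  fixes f g :: "'a::group_add fls"
  shows "dist f g < (1/2) ^ N \<longleftrightarrow> ord_ge (int N + 1) (f - g)"
proof (cases "f = g")
  case False
  show ?thesis
  proof (cases "fls_subdegree (f - g) \<ge> 0")
    case True
    then have "dist f g = (1/2) ^ nat (fls_subdegree (f - g))"
      using False by (simp add: dist_fls_def power_one_over divide_simps)
    then have "dist f g < (1/2) ^ N \<longleftrightarrow> N < nat (fls_subdegree (f - g))"
      by simp
    then show ?thesis using False True by (auto simp: ord_ge_subdegree)
  next
    case neg: False
    have "(1/2 :: real) ^ N \<le> 1" by (simp add: power_le_one)
    also have "1 \<le> (2 :: real) ^ nat (- fls_subdegree (f - g))" by simp
    also have "\<dots> = dist f g" using neg False by (simp add: dist_fls_def)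
    finally show ?thesis using neg False by (simp add: ord_ge_subdegree)
  qed
qed simp

lemma tendsto_fls_iff:
  fixes f :: "_ \<Rightarrow> 'a::group_add fls"
  shows "(f \<longlongrightarrow> l) F \<longleftrightarrow> (\<forall>N::nat. \<forall>\<^sub>F x in F. ord_ge (int N) (f x - l))"
proof (intro iffI allI)
  fix N :: nat
  assume "(f \<longlongrightarrow> l) F"
  then have "\<forall>\<^sub>F x in F. dist (f x) l < (1/2) ^ N" by (rule tendstoD) simp
  then show "\<forall>\<^sub>F x in F. ord_ge (int N) (f x - l)"
    by (rule eventually_mono) (auto simp: dist_fls_less_iff elim: ord_ge_mono)
next
  assume *: "\<forall>N::nat. \<forall>\<^sub>F x in F. ord_ge (int N) (f x - l)"
  show "(f \<longlongrightarrow> l) F"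
  proof (rule tendstoI)
    fix e :: real assume "e > 0"
    then obtain N where N: "(1/2 :: real) ^ N < e"
      using real_arch_pow_inv[of e "1/2"] by auto
    have "\<forall>\<^sub>F x in F. ord_ge (int (N + 1)) (f x - l)" using * by blast
    then show "\<forall>\<^sub>F x in F. dist (f x) l < e"
    proof (rule eventually_mono)
      fix x assume "ord_ge (int (N + 1)) (f x - l)"
      then have "dist (f x) l < (1/2) ^ N" by (simp add: dist_fls_less_iff add.commute)
      with N show "dist (f x) l < e" by simp
    qed
  qed
qed

lemma eventually_nhds_ord_ge: "\<forall>\<^sub>F x in nhds l. ord_ge (int N) (x - l)"
  for l :: "'a::group_add fls"
  using filterlim_ident[of "nhds l"] by (auto simp: tendsto_fls_iff)

instance fls :: (ab_group_add) topological_ab_group_add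
proof
  fix a b :: "'a fls"
  show "LIM x (nhds a \<times>\<^sub>F nhds b). fst x + snd x :> nhds (a + b)"
    unfolding tendsto_fls_iff eventually_prod_filter
  proof (rule allI, intro exI conjI)
    fix N
    show "\<forall>\<^sub>F x in nhds a. ord_ge (int N) (x - a)" "\<forall>\<^sub>F x in nhds b. ord_ge (int N) (x - b)"
      by (rule eventually_nhds_ord_ge)+
    have "ord_ge (int N) (x + y - (a + b))" if "ord_ge (int N) (x - a)" "ord_ge (int N) (y - b)" for x y
      using ord_ge_add[OF that] by (simp add: algebra_simps)
    then show "\<forall>x y. ord_ge (int N) (x - a) \<longrightarrow> ord_ge (int N) (y - b) \<longrightarrow>
            ord_ge (int N) (fst (x, y) + snd (x, y) - (a + b))" by simp
  qed
  show "(uminus \<longlongrightarrow> - a) (nhds a)"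
    unfolding tendsto_fls_iff
  proof
    fix N
    show "\<forall>\<^sub>F x in nhds a. ord_ge (int N) (- x - - a)"
      using eventually_nhds_ord_ge[of N a]
      by (rule eventually_mono) (use ord_ge_uminus in force)
  qed
qed

instance fls :: (ring) topological_semigroup_mult
proof
  fix a b :: "'a fls"
  show "LIM x (nhds a \<times>\<^sub>F nhds b). fst x * snd x :> nhds (a * b)"
    unfolding tendsto_fls_iff eventually_prod_filter
  proof (rule allI, intro exI conjI)
    fix N :: nat
    define M where "M = N + nat (- fls_subdegree a) + nat (- fls_subdegree b)"
    show "\<forall>\<^sub>F x in nhds a. ord_ge (int M) (x - a)" "\<forall>\<^sub>F x in nhds b. ord_ge (int M) (x - b)"
      by (rule eventually_nhds_ord_ge)+
    have "ord_ge (int N) (x * y - a * b)" if x: "ord_ge (int M) (x - a)" and y: "ord_ge (int M) (y - b)"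
      for x y
    proof -
      have "x * y - a * b = (x - a) * (y - b) + a * (y - b) + (x - a) * b"
        by (simp add: algebra_simps)
      moreover have "ord_ge (int N) ((x - a) * (y - b))"
        by (rule ord_ge_mono[OF ord_ge_mult[OF x y]]) (simp add: M_def)
      moreover have "ord_ge (int N) (a * (y - b))"
        by (rule ord_ge_mono[OF ord_ge_mult[OF ord_ge_self y]]) (simp add: M_def)
      moreover have "ord_ge (int N) ((x - a) * b)"
        by (rule ord_ge_mono[OF ord_ge_mult[OF x ord_ge_self]]) (simp add: M_def)
      ultimately show ?thesis by (metis ord_ge_add)
    qed
    then show "\<forall>x y. ord_ge (int M) (x - a) \<longrightarrow> ord_ge (int M) (y - b) \<longrightarrow>
            ord_ge (int N) (fst (x, y) * snd (x, y) - a * b)" by simp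
  qed
qed

text \<open>
  A set of series of order at least \<open>N\<close> is closed, hence contains the limits of its finite sums.
\<close>

lemma ord_ge_infsum:
  fixes f :: "'b \<Rightarrow> 'a::ab_group_add fls"
  assumes "\<And>x. x \<in> A \<Longrightarrow> ord_ge N (f x)"
  shows "ord_ge N (infsum f A)"
proof (cases "f summable_on A")
  case True
  then have "(f has_sum infsum f A) A" by simp
  then have lim: "(sum f \<longlongrightarrow> infsum f A) (finite_subsets_at_top A)" by (simp add: has_sum_def)
  have "\<forall>\<^sub>F F in finite_subsets_at_top A. finite F \<and> F \<subseteq> A"
    by (auto simp: eventually_finite_subsets_at_top)
  moreover have "\<forall>\<^sub>F F in finite_subsets_at_top A. ord_ge (int (nat N)) (sum f F - infsum f A)"
    using lim unfolding tendsto_fls_iff by blast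
  ultimately have "\<forall>\<^sub>F F in finite_subsets_at_top A. ord_ge N (infsum f A)"
  proof eventually_elim
    case (elim F)
    have "ord_ge N (sum f F)" using elim assms by (intro ord_ge_sum) auto
    moreover have "ord_ge N (sum f F - infsum f A)" using elim(2) by (rule ord_ge_mono) simp
    ultimately have "ord_ge N (sum f F - (sum f F - infsum f A))" by (rule ord_ge_diff)
    then show ?case by simp
  qed
  then show ?thesis by simp
qed (simp add: infsum_not_exists)

text \<open>
  Only finitely many summands reach a given coefficient, so beyond a finite set of indices all
  partial sums agree there.
\<close>

lemma has_sum_flsI:
  fixes f :: "'b \<Rightarrow> 'a::ab_group_add fls"
  assumes fin: "\<And>N::nat. finite {x\<in>A. \<not> ord_ge (int N) (f x)}"
    and nth: "\<And>n. fls_nth S n = (\<Sum>x | x \<in> A \<and> \<not> ord_ge (n + 1) (f x). fls_nth (f x) n)"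
  shows "(f has_sum S) A"
  unfolding has_sum_def tendsto_fls_iff
proof
  fix N :: nat
  have "ord_ge (int N) (sum f F - S)" if F: "finite F" "{x\<in>A. \<not> ord_ge (int N) (f x)} \<subseteq> F" "F \<subseteq> A" for F
    unfolding ord_ge_def
  proof (intro allI impI)
    fix n assume n: "n < int N"
    have "{x\<in>A. \<not> ord_ge (n + 1) (f x)} \<subseteq> {x\<in>A. \<not> ord_ge (int N) (f x)}"
      using n ord_ge_mono[of "int N" _ "n + 1"] by auto
    then have "fls_nth S n = (\<Sum>x\<in>F. fls_nth (f x) n)"
      unfolding nth using F(1,2,3)
      by (intro sum.mono_neutral_left) (auto simp: ord_ge_def)
    then show "fls_nth (sum f F - S) n = 0" by (simp add: fls_nth_sum)
  qed
  then show "\<forall>\<^sub>F F in finite_subsets_at_top A. ord_ge (int N) (sum f F - S)"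
    unfolding eventually_finite_subsets_at_top using fin[of N] by (intro exI[of _ "{x\<in>A. \<not> ord_ge (int N) (f x)}"]) auto
qed

text \<open>
  Orders bounded below by \<open>0\<close> let the coefficientwise sums be collected in a power series, which is
  then the limit.
\<close>

lemma summable_on_flsI:
  fixes f :: "'b \<Rightarrow> 'a::ab_group_add fls"
  assumes "\<And>x. x \<in> A \<Longrightarrow> ord_ge 0 (f x)"
    and "\<And>N::nat. finite {x\<in>A. \<not> ord_ge (int N) (f x)}"
  shows "f summable_on A"
proof -
  define S where "S = fps_to_fls (Abs_fps (\<lambda>n.
    \<Sum>x | x \<in> A \<and> \<not> ord_ge (int n + 1) (f x). fls_nth (f x) (int n)))"
  have "(f has_sum S) A"
  proof (rule has_sum_flsI)
    fix n
    show "fls_nth S n = (\<Sum>x | x \<in> A \<and> \<not> ord_ge (n + 1) (f x). fls_nth (f x) n)"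
      using assms(1) by (cases "n \<ge> 0") (auto simp: S_def ord_ge_def intro!: sum.neutral[symmetric])
  qed (rule assms)
  then show ?thesis by (auto simp: summable_on_def)
qed

lemma summable_nat_flsI:
  fixes f :: "nat \<Rightarrow> 'a::ab_group_add fls"
  assumes "\<And>n. ord_ge (int n) (f n)"
  shows "f summable_on UNIV"
proof (rule summable_on_flsI)
  show "ord_ge 0 (f n)" for n using assms[of n] by (rule ord_ge_mono) simp
  fix N :: nat
  have "{n \<in> UNIV. \<not> ord_ge (int N) (f n)} \<subseteq> {..<N}"
    using ord_ge_mono[OF assms, of "int N"] by (auto simp: not_le) (metis linorder_not_less of_nat_le_iff)
  then show "finite {n \<in> UNIV. \<not> ord_ge (int N) (f n)}" by (rule finite_subset) simp
qed

lemma infsum_nat_split: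
  fixes f :: "nat \<Rightarrow> 'a::ab_group_add fls"
  assumes "f summable_on UNIV"
  shows "infsum f UNIV = f 0 + infsum (\<lambda>n. f (Suc n)) UNIV"
proof -
  have U: "insert 0 (range Suc) = (UNIV :: nat set)"
    by (rule UNIV_nat_eq[symmetric])
  have s: "f summable_on range Suc"
    using summable_on_cofin_subset[OF assms, of "{0}"] U
    by (metis Diff_insert_absorb finite.emptyI finite.insertI image_iff nat.distinct(1))
  have "infsum f UNIV = f 0 + infsum f (range Suc)"
    using infsum_insert[OF s, of 0] unfolding U by simp
  also have "infsum f (range Suc) = infsum (\<lambda>n. f (Suc n)) UNIV"
    by (subst infsum_reindex) (auto simp: o_def)
  finally show ?thesis .
qed

section \<open>Admissible arguments, units and Pochhammer symbols\<close>

text \<open>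
  The arguments that iteration of \<open>x \<mapsto> x q\<^sup>d\<close>, starting from \<open>a\<close>, can reach. No power \<open>a q\<^sup>m\<close>
  equals \<open>1\<close>, which keeps all Pochhammer symbols invertible, including those starting with \<open>1 - a\<close>.
\<close>

definition adm :: "series set" where
  "adm = range (\<lambda>m. av * qv ^ m)"

lemma adm_av: "av \<in> adm"
  unfolding adm_def by (rule image_eqI[of _ _ 0]) auto

lemma adm_mult_qv: "x \<in> adm \<Longrightarrow> x * qv ^ m \<in> adm"
  by (auto simp: adm_def mult.assoc simp flip: power_add)

lemma adm_mult_qv_power: "x \<in> adm \<Longrightarrow> x * (qv ^ d) ^ m \<in> adm"
  unfolding power_mult[symmetric] by (rule adm_mult_qv)

lemma qv_nonzero [simp]: "qv \<noteq> 0"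
  by (simp add: qv_def)

lemma qv_power_nth: "fls_nth (qv ^ m) n = (if n = int m then 1 else 0)"
  by (auto simp: qv_def fls_X_power_conv_shift_1)

lemma ord_ge_qv_power: "N \<le> int m \<Longrightarrow> ord_ge N (qv ^ m)"
  by (auto simp: ord_ge_def qv_power_nth)

lemma ord_ge_qv: "ord_ge 0 qv"
  using ord_ge_qv_power[of 0 1] by simp

lemma adm_nth:
  assumes "x \<in> adm"
  obtains m where "\<And>n. fls_nth x n = (if n = int m then fls_X else 0)"
proof -
  from assms obtain m where "x = av * qv ^ m" by (auto simp: adm_def)
  then have "fls_nth x n = (if n = int m then fls_X else 0)" for n
    by (simp add: av_def qv_power_nth)
  then show ?thesis by (rule that)
qed

lemma ord_ge_adm: "x \<in> adm \<Longrightarrow> ord_ge 0 x"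
  by (erule adm_nth) (auto simp: ord_ge_def)

text \<open>
  Series of order exactly \<open>0\<close>. They form a group, so dividing by them never changes orders; all
  denominators that occur are of this kind.
\<close>

definition unit_series :: "series \<Rightarrow> bool" where
  "unit_series z \<longleftrightarrow> z \<noteq> 0 \<and> fls_subdegree z = 0"

lemma unit_series_nonzero: "unit_series z \<Longrightarrow> z \<noteq> 0"
  by (simp add: unit_series_def)

lemma unit_series_ord_ge: "unit_series z \<Longrightarrow> ord_ge 0 z"
  by (simp add: unit_series_def ord_ge_subdegree)

lemma unit_series_1: "unit_series 1"
  by (simp add: unit_series_def)

lemma unit_series_mult: "unit_series y \<Longrightarrow> unit_series z \<Longrightarrow> unit_series (y * z)"
  by (simp add: unit_series_def)

lemma unit_series_inverse: "unit_series z \<Longrightarrow> unit_series (1 / z)"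
  by (simp add: unit_series_def fls_inverse_subdegree divide_inverse)

lemma unit_series_prod: "(\<And>i. i \<in> A \<Longrightarrow> unit_series (f i)) \<Longrightarrow> unit_series (\<Prod>i\<in>A. f i)"
  by (induction A rule: infinite_finite_induct) (auto intro: unit_series_1 unit_series_mult)

lemma unit_seriesI: "ord_ge 0 z \<Longrightarrow> fls_nth z 0 \<noteq> 0 \<Longrightarrow> unit_series z"
  by (auto simp: unit_series_def ord_ge_def intro!: fls_subdegree_eqI)

lemma ord_ge_divide: "ord_ge N y \<Longrightarrow> unit_series z \<Longrightarrow> ord_ge N (y / z)"
  using ord_ge_mult_right[of N y "1 / z"] unit_series_ord_ge[OF unit_series_inverse[of z]] by simp

lemma unit_one_minus_adm:
  assumes "x \<in> adm" shows "unit_series (1 - x)"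
proof (rule unit_seriesI)
  show "ord_ge 0 (1 - x)" using assms by (intro ord_ge_diff ord_ge_1 ord_ge_adm)
  from assms obtain m where "\<And>n. fls_nth x n = (if n = int m then fls_X else 0)"
    by (rule adm_nth) blast
  moreover have "(1 :: rat fls) - fls_X \<noteq> 0"
  proof
    assume "(1 :: rat fls) - fls_X = 0"
    then have "fls_nth ((1 :: rat fls) - fls_X) 0 = fls_nth 0 0" by simp
    then show False by simp
  qed
  ultimately show "fls_nth (1 - x) 0 \<noteq> 0" by (auto split: if_splits)
qed

lemma unit_one_minus_qv_power:
  assumes "m > 0" shows "unit_series (1 - qv ^ m)"
proof (rule unit_seriesI)
  show "ord_ge 0 (1 - qv ^ m)" by (intro ord_ge_diff ord_ge_1 ord_ge_qv_power) auto
qed (use assms in \<open>simp add: qv_power_nth\<close>)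

lemma qpoch_0 [simp]: "qpoch x p 0 = 1"
  by (simp add: qpoch_def)

lemma qpoch_Suc: "qpoch x p (Suc n) = qpoch x p n * (1 - x * p ^ n)"
  by (simp add: qpoch_def)

lemma qpoch_add: "qpoch x p (m + n) = qpoch x p m * qpoch (x * p ^ m) p n"
  by (induction n) (simp_all add: qpoch_Suc power_add mult_ac)

lemma qpoch_Suc_left: "qpoch x p (Suc n) = (1 - x) * qpoch (x * p) p n"
  using qpoch_add[of x p 1 n] by (simp add: qpoch_Suc)

lemma unit_qpoch_adm: "x \<in> adm \<Longrightarrow> unit_series (qpoch x (qv ^ d) n)"
  unfolding qpoch_def by (intro unit_series_prod unit_one_minus_adm adm_mult_qv_power)

lemma unit_qpoch_adm_qv: "x \<in> adm \<Longrightarrow> unit_series (qpoch x qv n)"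
  using unit_qpoch_adm[of x 1 n] by simp

lemma unit_qpoch_qv:
  assumes "d > 0" shows "unit_series (qpoch (qv ^ d) (qv ^ d) n)"
  unfolding qpoch_def
proof (rule unit_series_prod)
  fix j
  have "qv ^ d * (qv ^ d) ^ j = qv ^ (d * Suc j)" by (simp add: power_add power_mult)
  then show "unit_series (1 - qv ^ d * (qv ^ d) ^ j)"
    using assms by (metis unit_one_minus_qv_power mult_pos_pos zero_less_Suc)
qed

lemma unit_qpoch_qv1: "unit_series (qpoch qv qv n)"
  using unit_qpoch_qv[of 1 n] by simp

lemma ord_ge_power_pos:
  fixes x :: series
  assumes "ord_ge N x" "ord_ge 0 x" "m > 0" shows "ord_ge N (x ^ m)"
proof -
  obtain j where "m = Suc j" using \<open>m > 0\<close> by (auto simp: gr0_conv_Suc)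
  then show ?thesis using assms by (auto intro: ord_ge_mult_right ord_ge_power_0)
qed

lemma ord_ge_term:
  assumes "x \<in> adm" "ord_ge 0 u" "n \<le> e"
  shows "ord_ge (int n) (x ^ m * qv ^ e * u)"
proof -
  have "ord_ge 0 (x ^ m)" using assms by (intro ord_ge_power_0 ord_ge_adm)
  moreover have "ord_ge (int n) (qv ^ e)" using assms by (intro ord_ge_qv_power) simp
  ultimately show ?thesis using assms by (intro ord_ge_mult_right ord_ge_mult_left)
qed

lemma ord_ge_term_pos:
  assumes "x \<in> adm" "ord_ge 0 u" "ord_ge N x" "m > 0"
  shows "ord_ge N (x ^ m * qv ^ e * u)"
proof -
  have "ord_ge N (x ^ m)" using assms by (intro ord_ge_power_pos ord_ge_adm)
  moreover have "ord_ge 0 (qv ^ e)" by (intro ord_ge_qv_power) simp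
  ultimately show ?thesis using assms by (intro ord_ge_mult_right)
qed

lemma infsum_shift:
  fixes f :: "nat \<Rightarrow> series"
  assumes "\<And>n. ord_ge (int n) (f n)" "f 0 = 0"
  shows "infsum f UNIV = infsum (\<lambda>n. f (Suc n)) UNIV"
  using infsum_nat_split[OF summable_nat_flsI[OF assms(1)]] assms(2) by simp

text \<open>
  Used to check the normalisation in the system: only the initial summand contributes the \<open>1\<close>.
\<close>

lemma infsum_near_1:
  fixes f :: "nat \<Rightarrow> series"
  assumes "\<And>n. ord_ge (int n) (f n)" "ord_ge N (f 0 - 1)" "\<And>n. ord_ge N (f (Suc n))"
  shows "ord_ge N (infsum f UNIV - 1)"
proof -
  have "infsum f UNIV - 1 = (f 0 - 1) + infsum (\<lambda>n. f (Suc n)) UNIV"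
    using infsum_nat_split[OF summable_nat_flsI[OF assms(1)]] by simp
  moreover have "ord_ge N ((f 0 - 1) + infsum (\<lambda>n. f (Suc n)) UNIV)"
    using assms(2,3) by (intro ord_ge_add ord_ge_infsum)
  ultimately show ?thesis by (simp only:)
qed

section \<open>The system of \<open>q\<close>-difference equations\<close>

definition gordon_factor :: "nat \<Rightarrow> series \<Rightarrow> series" where
  "gordon_factor d x = 1 / qpoch (x * qv) qv (d - 1)"

text \<open>
  The system described at the beginning, with \<open>f i x\<close> in the role of \<open>J\<^sub>i(x)\<close>. The last clause is the
  normalisation: it holds for every lower bound \<open>N\<close> of the order of \<open>x\<close>, so \<open>f i x\<close> tends to \<open>1\<close>
  along \<open>x, x q\<^sup>d, x q\<^bsup>2d\<^esup>, \<dots>\<close>. For \<open>d = 1\<close> these are the equations that Gordon's partition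
  theorem is usually derived from.
\<close>

definition gordon_system :: "nat \<Rightarrow> nat \<Rightarrow> (nat \<Rightarrow> series \<Rightarrow> series) \<Rightarrow> bool" where
  "gordon_system d k f \<longleftrightarrow> (\<forall>x\<in>adm. f 0 x = 0 \<and>
     (\<forall>i\<in>{1..k}. f i x = f (i - 1) x +
        (x * qv ^ d) ^ (i - 1) * gordon_factor d x * f (Suc k - i) (x * qv ^ d)) \<and>
     (\<forall>i\<in>{1..k}. \<forall>N. ord_ge N x \<longrightarrow> ord_ge N (f i x - 1)))"

lemma unit_gordon_factor: "x \<in> adm \<Longrightarrow> unit_series (gordon_factor d x)"
  unfolding gordon_factor_def
  using adm_mult_qv[of x 1] by (intro unit_series_inverse unit_qpoch_adm_qv) simp

lemma gordon_systemD:
  assumes "gordon_system d k f" "x \<in> adm"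
  shows "f 0 x = 0"
    and "1 \<le> i \<Longrightarrow> i \<le> k \<Longrightarrow> f i x = f (i - 1) x +
        (x * qv ^ d) ^ (i - 1) * gordon_factor d x * f (Suc k - i) (x * qv ^ d)"
    and "1 \<le> i \<Longrightarrow> i \<le> k \<Longrightarrow> ord_ge N x \<Longrightarrow> ord_ge N (f i x - 1)"
  using assms by (auto simp: gordon_system_def)

lemma gordon_system_ord_ge:
  assumes "gordon_system d k f" "x \<in> adm" "i \<le> k"
  shows "ord_ge 0 (f i x)"
proof (cases "i = 0")
  case False
  then have "ord_ge 0 (f i x - 1)"
    using assms by (intro gordon_systemD(3)[OF assms(1,2)] ord_ge_adm) auto
  then have "ord_ge 0 ((f i x - 1) + 1)" by (intro ord_ge_add ord_ge_1)
  then show ?thesis by simp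
qed (use gordon_systemD(1)[OF assms(1,2)] in simp)

text \<open>
  The equations express the difference of two solutions at \<open>x\<close> by differences at \<open>x q\<^sup>d\<close> with
  coefficients of nonnegative order, so a lower bound for the order at \<open>x q\<^sup>d\<close> is inherited at \<open>x\<close>.
  The normalisation supplies such bounds, arbitrarily large, far along the orbit. The induction counts
  how far the order of \<open>x\<close> is below the required bound.
\<close>

theorem gordon_system_unique:
  assumes f: "gordon_system d k f" and g: "gordon_system d k g" and "d > 0"
    and x: "x \<in> adm" and i: "i \<le> k"
  shows "f i x = g i x"
proof -
  have claim: "ord_ge N (f i x - g i x)" if "x \<in> adm" "i \<le> k" "ord_ge (N - int m) x" for N m x i
    using that
  proof (induction m arbitrary: x i)
    case 0
    show ?case
    proof (cases "i = 0")
      case False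
      then have "ord_ge N ((f i x - 1) - (g i x - 1))"
        using 0 by (intro ord_ge_diff gordon_systemD(3)[OF f] gordon_systemD(3)[OF g]) auto
      then show ?thesis by simp
    qed (use 0 gordon_systemD(1)[OF f] gordon_systemD(1)[OF g] in simp)
  next
    case (Suc m)
    have adm': "x * qv ^ d \<in> adm" using Suc.prems by (intro adm_mult_qv)
    have "ord_ge (N - int (Suc m) + int d) (x * qv ^ d)"
      using Suc.prems by (intro ord_ge_mult ord_ge_qv_power) auto
    then have "ord_ge (N - int m) (x * qv ^ d)"
      by (rule ord_ge_mono) (use \<open>d > 0\<close> in simp)
    then have IH: "ord_ge N (f j (x * qv ^ d) - g j (x * qv ^ d))" if "j \<le> k" for j
      using Suc.IH[OF adm' that] by simp
    from \<open>i \<le> k\<close> show ?case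
    proof (induction i)
      case 0
      then show ?case using \<open>x \<in> adm\<close> gordon_systemD(1)[OF f] gordon_systemD(1)[OF g] by simp
    next
      case (Suc i)
      let ?c = "(x * qv ^ d) ^ i * gordon_factor d x"
      have c: "ord_ge 0 ?c"
        using \<open>x \<in> adm\<close> adm' by (intro ord_ge_mult_left ord_ge_power_0[OF ord_ge_adm]
          unit_series_ord_ge[OF unit_gordon_factor])
      have "f (Suc i) x - g (Suc i) x = (f i x - g i x) +
          ?c * (f (k - i) (x * qv ^ d) - g (k - i) (x * qv ^ d))"
        using gordon_systemD(2)[OF f \<open>x \<in> adm\<close>, of "Suc i"]
          gordon_systemD(2)[OF g \<open>x \<in> adm\<close>, of "Suc i"] Suc.prems
        by (simp add: algebra_simps)
      also have "ord_ge N \<dots>"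
        using Suc.prems Suc.IH by (intro ord_ge_add ord_ge_mult_left c IH) auto
      finally show ?case .
    qed
  qed
  have "f i x - g i x = 0"
  proof (rule ord_ge_all_imp_0)
    fix N show "ord_ge (int N) (f i x - g i x)"
      using claim[OF x i, of "int N" N] ord_ge_adm[OF x] by simp
  qed
  then show ?thesis by simp
qed

text \<open>
  Each application of the recurrence gains an order, so the order of \<open>D x\<close> exceeds every bound.
\<close>

lemma vanish_by_iteration:
  fixes D :: "series \<Rightarrow> series"
  assumes rec: "\<And>x. x \<in> adm \<Longrightarrow> D x = t x * D (x * qv ^ m)"
    and t: "\<And>x. x \<in> adm \<Longrightarrow> ord_ge 1 (t x)"
    and D: "\<And>x. x \<in> adm \<Longrightarrow> ord_ge 0 (D x)" and x: "x \<in> adm"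
  shows "D x = 0"
proof -
  have "ord_ge (int N) (D x)" if "x \<in> adm" for N x
    using that
  proof (induction N arbitrary: x)
    case (Suc N)
    have "ord_ge (1 + int N) (t x * D (x * qv ^ m))"
      using Suc by (intro ord_ge_mult t Suc.IH adm_mult_qv) auto
    then show ?case using rec[OF Suc.prems] by simp
  qed (use D in simp)
  then show ?thesis using x by (intro ord_ge_all_imp_0)
qed

section \<open>The infinite product\<close>

lemma unit_series_add:
  assumes "unit_series z" "ord_ge 1 h" shows "unit_series (z + h)"
proof (rule unit_seriesI)
  show "ord_ge 0 (z + h)"
    using assms by (intro ord_ge_add unit_series_ord_ge ord_ge_mono[of 1 h 0]) auto
  have "fls_nth z 0 \<noteq> 0" using assms(1) nth_fls_subdegree_nonzero[of z] by (simp add: unit_series_def)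
  then show "fls_nth (z + h) 0 \<noteq> 0" using assms(2) by (simp add: ord_ge_def)
qed

text \<open>
  The product telescopes, \<open>(x)\<^sub>n\<^sub>+\<^sub>1 - (x)\<^sub>n = - x q\<^sup>n (x)\<^sub>n\<close>, which makes its limit a sum; the order
  estimates for the limit are then those for a sum.
\<close>

lemma qpoch_limit:
  assumes x: "x \<in> adm"
  defines "L \<equiv> 1 + infsum (\<lambda>n. - (x * qv ^ n * qpoch x qv n)) UNIV"
  shows "(\<lambda>n. qpoch x qv n) \<longlonglongrightarrow> L"
    and "ord_ge N x \<Longrightarrow> ord_ge N (L - 1)"
    and "unit_series L"
proof -
  define g where "g = (\<lambda>n. - (x * qv ^ n * qpoch x qv n))"
  have u: "ord_ge 0 (qpoch x qv n)" for n
    using x by (intro unit_series_ord_ge unit_qpoch_adm_qv)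
  have g: "ord_ge (int n) (g n)" for n
    unfolding g_def using ord_ge_term[OF x u, of n n 1 n] by (intro ord_ge_uminus) simp
  have summ: "g summable_on UNIV" by (rule summable_nat_flsI) (rule g)
  have part: "qpoch x qv n = 1 + sum g {..<n}" for n
    by (induction n) (simp_all add: qpoch_Suc g_def algebra_simps)
  have "g sums (infsum g UNIV)"
    using summ by (intro has_sum_imp_sums) simp
  then have "(\<lambda>n. 1 + sum g {..<n}) \<longlonglongrightarrow> 1 + infsum g UNIV"
    unfolding sums_def by (intro tendsto_add tendsto_const)
  then show lim: "(\<lambda>n. qpoch x qv n) \<longlonglongrightarrow> L"
    unfolding L_def part[symmetric] g_def[symmetric] .
  show "ord_ge N (L - 1)" if "ord_ge N x" for N
  proof -
    have "ord_ge N (g n)" for n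
      unfolding g_def using ord_ge_term_pos[OF x u that, of 1 n n] by (intro ord_ge_uminus) simp
    then show ?thesis unfolding L_def g_def[symmetric] using ord_ge_infsum[of UNIV N g] by simp
  qed
  have "L = (1 - x) + infsum (\<lambda>n. g (Suc n)) UNIV"
    using infsum_nat_split[OF summ] by (simp add: L_def g_def[symmetric]) (simp add: g_def)
  moreover have "ord_ge 1 (infsum (\<lambda>n. g (Suc n)) UNIV)"
    by (intro ord_ge_infsum ord_ge_mono[OF g]) simp
  moreover have "unit_series (1 - x)" by (rule unit_one_minus_adm[OF x])
  ultimately show "unit_series L" by (simp add: unit_series_add)
qed

text \<open>
  Convergence of an infinite product includes that the limit of the partial products is nonzero, which
  is where the invertibility of the limit enters.
\<close>

lemma qpoch_inf_eq:
  assumes x: "x \<in> adm"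
  shows "qpoch_inf x qv = 1 + infsum (\<lambda>n. - (x * qv ^ n * qpoch x qv n)) UNIV"
proof -
  have "(\<lambda>n. \<Prod>i\<le>n. 1 - x * qv ^ i) \<longlonglongrightarrow> 1 + infsum (\<lambda>n. - (x * qv ^ n * qpoch x qv n)) UNIV"
    using LIMSEQ_Suc[OF qpoch_limit(1)[OF x]] by (simp add: qpoch_def lessThan_Suc_atMost)
  then have "(\<lambda>j. 1 - x * qv ^ j) has_prod (1 + infsum (\<lambda>n. - (x * qv ^ n * qpoch x qv n)) UNIV)"
    using unit_series_nonzero[OF qpoch_limit(3)[OF x]] by (simp add: has_prod_def raw_has_prod_def)
  then show ?thesis unfolding qpoch_inf_def by (rule has_prod_unique[symmetric])
qed

lemma qpoch_inf_tendsto: "x \<in> adm \<Longrightarrow> (\<lambda>n. qpoch x qv n) \<longlonglongrightarrow> qpoch_inf x qv"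
  using qpoch_limit(1) by (simp add: qpoch_inf_eq)

lemma qpoch_inf_near_1: "x \<in> adm \<Longrightarrow> ord_ge N x \<Longrightarrow> ord_ge N (qpoch_inf x qv - 1)"
  using qpoch_limit(2)[of x N] by (simp add: qpoch_inf_eq)

lemma unit_qpoch_inf: "x \<in> adm \<Longrightarrow> unit_series (qpoch_inf x qv)"
  using qpoch_limit(3) by (simp add: qpoch_inf_eq)

lemma qpoch_inf_split:
  assumes x: "x \<in> adm"
  shows "qpoch_inf x qv = qpoch x qv m * qpoch_inf (x * qv ^ m) qv"
proof (rule LIMSEQ_unique)
  show "(\<lambda>n. qpoch x qv (n + m)) \<longlonglongrightarrow> qpoch_inf x qv"
    using qpoch_inf_tendsto[OF x] by (rule LIMSEQ_ignore_initial_segment)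
  have "(\<lambda>n. qpoch x qv m * qpoch (x * qv ^ m) qv n) \<longlonglongrightarrow> qpoch x qv m * qpoch_inf (x * qv ^ m) qv"
    by (intro tendsto_mult_left qpoch_inf_tendsto adm_mult_qv x)
  then show "(\<lambda>n. qpoch x qv (n + m)) \<longlonglongrightarrow> qpoch x qv m * qpoch_inf (x * qv ^ m) qv"
    by (simp only: add.commute[of _ m] qpoch_add)
qed

section \<open>The product-sum side\<close>

text \<open>
  The exponent of \<open>p\<close> in the \<open>n\<close>-th summand, \<open>(k + 1/2) n\<^sup>2 + (k - i + 1/2) n\<close>, written without
  halves and without a subtraction of functions of \<open>n\<close>.
\<close>

definition Q_exp :: "nat \<Rightarrow> nat \<Rightarrow> nat \<Rightarrow> nat" where
  "Q_exp k i n = (2 * k + 1) * (n choose 2) + (2 * k + 1 - i) * n"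

lemma Q_exp_Suc: "Q_exp (i + c) i (Suc n) = Q_exp (i + c) i n + ((2 * (i + c) + 1) * n + 2 * c + i + 1)"
  by (simp add: Q_exp_def numeral_2_eq_2 algebra_simps)

lemma two_choose_two: "2 * (n choose 2) + n = n * (n::nat)"
  by (induction n) (auto simp: numeral_2_eq_2)

definition Q_weight :: "nat \<Rightarrow> nat \<Rightarrow> nat \<Rightarrow> series \<Rightarrow> nat \<Rightarrow> series" where
  "Q_weight d k i x n = (-1) ^ n * x ^ (k * n) * (qv ^ d) ^ Q_exp k i n *
     (qpoch (x * qv ^ d) (qv ^ d) n / qpoch (qv ^ d) (qv ^ d) n)"

text \<open>
  The summand without the common factor \<open>1/(x q; q)\<^sub>\<infinity>\<close>, at a general argument \<open>x\<close>.
\<close>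

definition Q_term :: "nat \<Rightarrow> nat \<Rightarrow> nat \<Rightarrow> series \<Rightarrow> nat \<Rightarrow> series" where
  "Q_term d k i x n = Q_weight d k i x n * (1 - x ^ i * (qv ^ d) ^ ((2 * n + 1) * i))"

definition Q_fun :: "nat \<Rightarrow> nat \<Rightarrow> nat \<Rightarrow> series \<Rightarrow> series" where
  "Q_fun d k i x = 1 / qpoch_inf (x * qv) qv * (\<Sum>\<^sub>\<infinity>n. Q_term d k i x n)"

lemma Q_weight_eq:
  assumes "i \<le> k"
  shows "Q_weight d k i x n = x ^ (k * n) * qv ^ (d * Q_exp k i n) *
    ((-1) ^ n * (qpoch (x * qv ^ d) (qv ^ d) n / qpoch (qv ^ d) (qv ^ d) n))"
  by (simp add: Q_weight_def power_mult mult_ac)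

lemma ord_ge_minus_one_power: "ord_ge 0 ((-1 :: series) ^ n)"
  by (intro ord_ge_power_0 ord_ge_uminus ord_ge_1)

lemma ord_ge_Q_ratio:
  assumes "x \<in> adm" "d > 0"
  shows "ord_ge 0 ((-1) ^ n * (qpoch (x * qv ^ d) (qv ^ d) n / qpoch (qv ^ d) (qv ^ d) n))"
  using assms by (intro ord_ge_mult_left ord_ge_minus_one_power ord_ge_divide unit_qpoch_qv
      unit_series_ord_ge[OF unit_qpoch_adm] adm_mult_qv)

lemma ord_ge_Q_weight:
  assumes "x \<in> adm" "d > 0" "i \<le> k"
  shows "ord_ge (int n) (Q_weight d k i x n)"
proof -
  have "1 * n \<le> (2 * k + 1 - i) * n" using assms(3) by (intro mult_right_mono) auto
  then have "n \<le> Q_exp k i n" unfolding Q_exp_def by linarith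
  also have "\<dots> \<le> d * Q_exp k i n" using assms(2) by simp
  finally show ?thesis
    unfolding Q_weight_eq[OF assms(3)] using assms by (intro ord_ge_term ord_ge_Q_ratio)
qed

lemma ord_ge_monomial: "x \<in> adm \<Longrightarrow> ord_ge 0 (x ^ m * (qv ^ d) ^ l)"
  using ord_ge_term[of x 1 0 "d * l" m] by (simp add: ord_ge_1 power_mult)

lemma ord_ge_Q_factor: "x \<in> adm \<Longrightarrow> ord_ge 0 (1 - x ^ i * (qv ^ d) ^ ((2 * n + 1) * i))"
  by (intro ord_ge_diff ord_ge_1 ord_ge_monomial)

lemma ord_ge_Q_term:
  assumes "x \<in> adm" "d > 0" "i \<le> k"
  shows "ord_ge (int n) (Q_term d k i x n)"
  unfolding Q_term_def using assms
  by (intro ord_ge_mult_right ord_ge_Q_weight ord_ge_Q_factor)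

lemma Q_weight_pred:
  assumes "Suc i \<le> k"
  shows "Q_weight d k i x n = Q_weight d k (Suc i) x n * (qv ^ d) ^ n"
proof -
  from assms obtain c where k: "k = Suc i + c" using le_Suc_ex by blast
  have "Q_exp k i n = Q_exp k (Suc i) n + n" by (simp add: Q_exp_def k algebra_simps)
  then show ?thesis by (simp add: Q_weight_def power_add mult_ac)
qed

text \<open>
  The shift by one summation step: the factor \<open>1 - p\<^bsup>n+1\<^esup>\<close> is cancelled by the denominator.
\<close>

lemma Q_weight_Suc:
  assumes k: "k = i + c" and d: "d > 0"
  shows "Q_weight d k i x (Suc n) * (1 - (qv ^ d) ^ Suc n) =
    - (Q_weight d k i x n * x ^ k * (qv ^ d) ^ ((2 * k + 1) * n + 2 * c + i + 1) *
       (1 - x * (qv ^ d) ^ Suc n))"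
proof -
  let ?p = "qv ^ d"
  have nz: "1 - ?p ^ Suc n \<noteq> 0"
    using unit_one_minus_qv_power[of "d * Suc n"] d unfolding power_mult
    by (intro unit_series_nonzero) simp
  have "qpoch (x * ?p) ?p (Suc n) / qpoch ?p ?p (Suc n) * (1 - ?p ^ Suc n) =
        qpoch (x * ?p) ?p n / qpoch ?p ?p n * (1 - x * ?p ^ Suc n)"
    using nz by (simp add: qpoch_Suc mult.assoc)
  note 1 = this
  have 2: "(-1) ^ Suc n * x ^ (k * Suc n) * ?p ^ Q_exp k i (Suc n) =
        - ((-1) ^ n * x ^ (k * n) * ?p ^ Q_exp k i n * (x ^ k * ?p ^ ((2 * k + 1) * n + 2 * c + i + 1)))"
    unfolding k Q_exp_Suc by (simp add: power_add mult_ac)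
  have 3: "Q_weight d k i x (Suc n) * (1 - ?p ^ Suc n) =
      ((-1) ^ Suc n * x ^ (k * Suc n) * ?p ^ Q_exp k i (Suc n)) *
      (qpoch (x * ?p) ?p (Suc n) / qpoch ?p ?p (Suc n) * (1 - ?p ^ Suc n))"
    unfolding Q_weight_def by (simp only: mult.assoc)
  show ?thesis unfolding 3 unfolding 1 2 Q_weight_def by (simp only: mult_ac mult_minus_left mult_minus_right)
qed

text \<open>
  The replacement of \<open>x\<close> by \<open>x p\<close> only lengthens the numerator \<open>(x p; p)\<^sub>n\<close> by one factor, once the
  missing first factor \<open>1 - x p\<close> is supplied.
\<close>

lemma Q_weight_shift:
  assumes k: "k = i + c" and i: "i > 0"
  shows "(1 - x * qv ^ d) * Q_weight d k (Suc k - i) (x * qv ^ d) n =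
    Q_weight d k i x n * (qv ^ d) ^ ((2 * i - 1) * n) * (1 - x * (qv ^ d) ^ Suc n)"
proof -
  let ?p = "qv ^ d"
  have "(1 - x * ?p) * qpoch (x * ?p * ?p) ?p n = qpoch (x * ?p) ?p (Suc n)"
    by (simp only: qpoch_Suc_left)
  also have "\<dots> = qpoch (x * ?p) ?p n * (1 - x * ?p ^ Suc n)" by (simp add: qpoch_Suc mult_ac)
  finally have 1: "(1 - x * ?p) * qpoch (x * ?p * ?p) ?p n = qpoch (x * ?p) ?p n * (1 - x * ?p ^ Suc n)" .
  obtain j where j: "i = Suc j" using i by (auto simp: gr0_conv_Suc)
  have e: "k * n + Q_exp k (Suc k - i) n = Q_exp k i n + (2 * i - 1) * n"
    by (simp add: Q_exp_def k j algebra_simps)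
  have 2: "(x * ?p) ^ (k * n) * ?p ^ Q_exp k (Suc k - i) n = x ^ (k * n) * ?p ^ Q_exp k i n * ?p ^ ((2 * i - 1) * n)"
    unfolding power_mult_distrib mult.assoc power_add[symmetric] e ..
  have "(1 - x * ?p) * Q_weight d k (Suc k - i) (x * ?p) n =
     (-1) ^ n * ((x * ?p) ^ (k * n) * ?p ^ Q_exp k (Suc k - i) n) *
     (((1 - x * ?p) * qpoch (x * ?p * ?p) ?p n) / qpoch ?p ?p n)"
    by (simp add: Q_weight_def mult_ac)
  then show ?thesis unfolding 1 2 by (simp add: Q_weight_def mult_ac)
qed

text \<open>
  Since \<open>u\<^sub>i\<^sub>-\<^sub>1(n) = u\<^sub>i(n) p\<^sup>n\<close> for the weights \<open>u\<^sub>i\<close>, the difference of the summands for \<open>i\<close> and \<open>i - 1\<close>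
  contains one piece with the factor \<open>1 - p\<^sup>n\<close> and one with the factor \<open>1 - x p\<^bsup>n+1\<^esup>\<close>. After a shift
  both carry the latter factor, and together they form the summand for \<open>k + 1 - i\<close> at \<open>x p\<close>.
\<close>

lemma Q_sum_rec:
  assumes x: "x \<in> adm" and d: "d > 0" and i: "1 \<le> i" "i \<le> k"
  shows "(\<Sum>\<^sub>\<infinity>n. Q_term d k i x n) = (\<Sum>\<^sub>\<infinity>n. Q_term d k (i - 1) x n) +
     (x * qv ^ d) ^ (i - 1) * (1 - x * qv ^ d) * (\<Sum>\<^sub>\<infinity>n. Q_term d k (Suc k - i) (x * qv ^ d) n)"
proof -
  let ?p = "qv ^ d"
  obtain c where k: "k = i + c" using i(2) le_Suc_ex by blast
  obtain j where j: "i = Suc j" using i(1) by (auto simp: gr0_conv_Suc Suc_le_eq)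
  \<comment> \<open>The two pieces of the difference of neighbouring summands; \<open>a\<close> vanishes at \<open>0\<close> and is the one
    that gets shifted.\<close>
  define a where "a = (\<lambda>n. Q_weight d k i x n * (1 - ?p ^ n))"
  define b where "b = (\<lambda>n. Q_weight d k i x n * x ^ j * ?p ^ ((2 * i - 1) * n + j) * (1 - x * ?p ^ Suc n))"
  have w: "ord_ge (int n) (Q_weight d k i x n)" for n using x d i by (intro ord_ge_Q_weight)
  have a: "ord_ge (int n) (a n)" for n
    unfolding a_def by (intro ord_ge_mult_right w ord_ge_diff ord_ge_1 ord_ge_power_0 ord_ge_qv_power) auto
  have b: "ord_ge (int n) (b n)" for n
    unfolding b_def mult.assoc
    using ord_ge_monomial[OF x, of 1 d "Suc n"]
    by (intro ord_ge_mult_right w ord_ge_mult_left ord_ge_diff ord_ge_1 ord_ge_power_0 ord_ge_adm x ord_ge_qv_power)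
       auto
  have diff: "Q_term d k i x n = Q_term d k (i - 1) x n + (a n + b n)" for n
  proof -
    have e: "(2 * n + 1) * i = (2 * i - 1) * n + j + Suc n" "(2 * n + 1) * j + n = (2 * i - 1) * n + j"
      by (simp_all add: j algebra_simps)
    have "Q_term d k i x n = Q_weight d k i x n - Q_weight d k i x n * x ^ j * x * (?p ^ ((2 * i - 1) * n + j) * ?p ^ Suc n)"
      unfolding Q_term_def e(1) power_add by (simp add: j algebra_simps)
    moreover have "Q_term d k (i - 1) x n = Q_weight d k i x n * ?p ^ n - Q_weight d k i x n * x ^ j * ?p ^ ((2 * i - 1) * n + j)"
      unfolding e(2)[symmetric] power_add using i(2) by (simp add: Q_term_def j Q_weight_pred algebra_simps)
    ultimately show ?thesis unfolding a_def b_def by (simp add: algebra_simps)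
  qed
  have shift: "(x * ?p) ^ (i - 1) * (1 - x * ?p) * Q_term d k (Suc k - i) (x * ?p) n = b n + a (Suc n)" for n
  proof -
    have "j + (2 * i - 1) * n + (Suc k - i + (2 * n + 1) * (Suc k - i)) = (2 * k + 1) * n + 2 * c + i + 1"
      by (simp add: k j algebra_simps)
    then have e: "?p ^ j * ?p ^ ((2 * i - 1) * n) * (?p ^ (Suc k - i) * ?p ^ ((2 * n + 1) * (Suc k - i))) =
       ?p ^ ((2 * k + 1) * n + 2 * c + i + 1)"
      by (simp only: power_add[symmetric])
    have xk: "x ^ j * x ^ (Suc k - i) = x ^ k"
      by (simp add: power_add[symmetric] k j)
    have gen: "(xj * pj) * (W * e * u) * (1 - (xk * pk) * r) =
        W * xj * (e * pj) * u - W * (xj * xk) * (pj * e * (pk * r)) * u"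
      for xj pj W e u xk pk r :: series by (simp add: algebra_simps)
    have "(x * ?p) ^ (i - 1) * (1 - x * ?p) * Q_term d k (Suc k - i) (x * ?p) n =
      (x * ?p) ^ j * ((1 - x * ?p) * Q_weight d k (Suc k - i) (x * ?p) n) *
        (1 - (x * ?p) ^ (Suc k - i) * ?p ^ ((2 * n + 1) * (Suc k - i)))"
      by (simp add: Q_term_def j mult_ac)
    also have "\<dots> = b n - Q_weight d k i x n * (x ^ j * x ^ (Suc k - i)) *
        (?p ^ j * ?p ^ ((2 * i - 1) * n) * (?p ^ (Suc k - i) * ?p ^ ((2 * n + 1) * (Suc k - i)))) * (1 - x * ?p ^ Suc n)"
      unfolding Q_weight_shift[OF k i(1)[unfolded One_nat_def Suc_le_eq]] b_def power_mult_distrib power_add[of ?p "(2 * i - 1) * n" j]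
      by (rule gen)
    also have "\<dots> = b n + a (Suc n)"
      unfolding e xk a_def Q_weight_Suc[OF k d] by (simp add: mult_ac)
    finally show ?thesis .
  qed
  have Sa: "a summable_on UNIV" and Sb: "b summable_on UNIV"
    by (rule summable_nat_flsI, rule a b)+
  have Sa': "(\<lambda>n. a (Suc n)) summable_on UNIV"
    by (rule summable_nat_flsI) (rule ord_ge_mono[OF a], simp)
  have S1: "Q_term d k (i - 1) x summable_on UNIV"
    by (rule summable_nat_flsI) (use x d i in \<open>intro ord_ge_Q_term; simp\<close>)
  have "infsum (Q_term d k i x) UNIV = infsum (\<lambda>n. Q_term d k (i - 1) x n + (a n + b n)) UNIV"
    using diff by (intro infsum_cong) simp
  also have "\<dots> = infsum (Q_term d k (i - 1) x) UNIV + (infsum a UNIV + infsum b UNIV)"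
    using S1 Sa Sb by (simp add: infsum_add summable_on_add)
  also have "infsum a UNIV = infsum (\<lambda>n. a (Suc n)) UNIV"
    by (rule infsum_shift[OF a]) (simp add: a_def)
  also have "\<dots> + infsum b UNIV = infsum (\<lambda>n. b n + a (Suc n)) UNIV"
    using Sa' Sb by (simp add: infsum_add add.commute)
  also have "\<dots> = infsum (\<lambda>n. (x * ?p) ^ (i - 1) * (1 - x * ?p) * Q_term d k (Suc k - i) (x * ?p) n) UNIV"
    using shift by (intro infsum_cong) simp
  also have "\<dots> = (x * ?p) ^ (i - 1) * (1 - x * ?p) * infsum (Q_term d k (Suc k - i) (x * ?p)) UNIV"
    by (intro infsum_cmult_right summable_nat_flsI ord_ge_Q_term adm_mult_qv x d) (use i in auto)
  finally show ?thesis .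
qed

text \<open>
  Passing from \<open>x\<close> to \<open>x p\<close> removes \<open>(x q; q)\<^sub>d\<close> from the infinite product. Its last factor
  \<open>1 - x p\<close> is the one in the recurrence for the sums, and the others are the denominator in the
  system.
\<close>

lemma Q_gordon_system:
  assumes d: "d > 0"
  shows "gordon_system d k (Q_fun d k)"
  unfolding gordon_system_def
proof (intro ballI conjI allI impI)
  fix x assume x: "x \<in> adm"
  show "Q_fun d k 0 x = 0" by (simp add: Q_fun_def Q_term_def)
  let ?p = "qv ^ d"
  have xq: "x * qv \<in> adm" using adm_mult_qv[OF x, of 1] by simp
  fix i assume i: "i \<in> {1..k}"
  have "qpoch_inf (x * qv) qv = qpoch (x * qv) qv d * qpoch_inf (x * ?p * qv) qv"
    using qpoch_inf_split[OF xq, of d] by (simp add: mult_ac)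
  also have "qpoch (x * qv) qv d = qpoch (x * qv) qv (d - 1) * (1 - x * ?p)"
    using d qpoch_Suc[of "x * qv" qv "d - 1"] by (cases d) (simp_all add: mult_ac)
  finally have split: "qpoch_inf (x * qv) qv = qpoch (x * qv) qv (d - 1) * (1 - x * ?p) * qpoch_inf (x * ?p * qv) qv" .
  have nz: "1 - x * ?p \<noteq> 0" by (intro unit_series_nonzero unit_one_minus_adm adm_mult_qv x)
  have cancel: "t \<noteq> 0 \<Longrightarrow> 1 / (A * t * L) * t = 1 / A * (1 / L)" for A t L :: series
    by simp
  have fac: "1 / qpoch_inf (x * qv) qv * (1 - x * ?p) = gordon_factor d x * (1 / qpoch_inf (x * ?p * qv) qv)"
    unfolding split gordon_factor_def using cancel[OF nz] by blast
  have swap: "1 / qpoch_inf (x * qv) qv * (A * (1 - x * ?p) * s) =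
     A * gordon_factor d x * (1 / qpoch_inf (x * ?p * qv) qv * s)" for A s
  proof -
    have "1 / qpoch_inf (x * qv) qv * (A * (1 - x * ?p) * s) =
        A * (1 / qpoch_inf (x * qv) qv * (1 - x * ?p)) * s" by (simp only: mult_ac)
    then show ?thesis unfolding fac by (simp only: mult_ac)
  qed
  show "Q_fun d k i x = Q_fun d k (i - 1) x +
      (x * ?p) ^ (i - 1) * gordon_factor d x * Q_fun d k (Suc k - i) (x * ?p)"
    unfolding Q_fun_def using Q_sum_rec[OF x d, of i k] i swap by (simp only: distrib_left atLeastAtMost_iff)
  fix N assume N: "ord_ge N x"
  let ?L = "qpoch_inf (x * qv) qv" and ?S = "\<Sum>\<^sub>\<infinity>n. Q_term d k i x n"
  have L: "unit_series ?L" by (rule unit_qpoch_inf[OF xq])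
  have "ord_ge N (x * qv)" by (intro ord_ge_mult_right N ord_ge_qv)
  then have L1: "ord_ge N (?L - 1)" by (intro qpoch_inf_near_1 xq)
  have S: "ord_ge N (?S - 1)"
  proof (rule infsum_near_1)
    show "ord_ge (int n) (Q_term d k i x n)" for n using x d i by (intro ord_ge_Q_term) auto
    have "Q_term d k i x 0 - 1 = - (x ^ i * qv ^ (d * i) * 1)"
      by (simp add: Q_term_def Q_weight_def Q_exp_def power_mult numeral_2_eq_2)
    then show "ord_ge N (Q_term d k i x 0 - 1)"
      using ord_ge_term_pos[OF x ord_ge_1 N, of i "d * i"] i by (auto intro: ord_ge_uminus)
    have ik: "i \<le> k" "0 < k" using i by auto
    show "ord_ge N (Q_term d k i x (Suc n))" for n
      unfolding Q_term_def Q_weight_eq[OF ik(1)]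
      by (intro ord_ge_mult_right ord_ge_term_pos ord_ge_Q_ratio ord_ge_Q_factor x d N) (use ik in simp)
  qed
  have "Q_fun d k i x - 1 = ((?S - 1) - (?L - 1)) / ?L"
    using unit_series_nonzero[OF L] by (simp add: Q_fun_def field_simps)
  then show "ord_ge N (Q_fun d k i x - 1)"
    using S L1 L by (simp only: ord_ge_divide ord_ge_diff)
qed

lemma Q_series_eq:
  assumes "i \<le> k"
  shows "Q_series d k i = Q_fun d k i av"
proof -
  have "(-1) ^ n * av ^ (k * n) *
        qv ^ (((2 * d * k + d) * n\<^sup>2 + (2 * (k - i) + 1) * d * n) div 2) *
        (1 - av ^ i * qv ^ ((2 * n + 1) * d * i)) * qpoch (av * qv ^ d) (qv ^ d) n /
        qpoch (qv ^ d) (qv ^ d) n = Q_term d k i av n" for n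
  proof -
    obtain c where k: "k = i + c" using assms le_Suc_ex by blast
    have "(2 * d * k + d) * n\<^sup>2 + (2 * (k - i) + 1) * d * n =
        d * (2 * k + 1) * (2 * (n choose 2) + n) + (2 * c + 1) * d * n"
      unfolding two_choose_two by (simp add: k power2_eq_square algebra_simps)
    also have "\<dots> = 2 * (d * Q_exp k i n)"
      by (simp add: Q_exp_def k algebra_simps)
    finally have e: "((2 * d * k + d) * n\<^sup>2 + (2 * (k - i) + 1) * d * n) div 2 = d * Q_exp k i n"
      by simp
    have e2: "(2 * n + 1) * d * i = d * ((2 * n + 1) * i)" by (simp add: algebra_simps)
    show ?thesis unfolding e e2 power_mult[of qv d] Q_term_def Q_weight_def
      by (simp only: times_divide_eq_right times_divide_eq_left mult_ac)
  qed
  then show ?thesis unfolding Q_series_def Q_fun_def by simp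
qed

section \<open>The partition side\<close>

text \<open>
  Orders are integers; the simplifier would push the coercion into the sum of the parts and hide
  the number that is being partitioned.
\<close>

declare of_nat_sum_mset [simp del]

definition part_weight :: "series \<Rightarrow> nat multiset \<Rightarrow> series" where
  "part_weight x M = x ^ size M * qv ^ sum_mset M"

text \<open>
  Partitions of arbitrary size and length subject to the conditions on multiples of \<open>d\<close>.
\<close>

definition B_set :: "nat \<Rightarrow> nat \<Rightarrow> nat \<Rightarrow> nat multiset set" where
  "B_set d k i = {M. 0 \<notin># M \<and> count M d \<le> i - 1 \<and>
     (\<forall>j\<ge>1. count M (d * j) + count M (d * j + d) \<le> k - 1)}"

text \<open>
  The case \<open>i = 0\<close> stands for \<open>d\<close> occurring at most \<open>-1\<close> times. It is set apart because the truncated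
  \<open>i - 1\<close> in the definition of the set would not give the empty set.
\<close>

definition B_fun :: "nat \<Rightarrow> nat \<Rightarrow> nat \<Rightarrow> series \<Rightarrow> series" where
  "B_fun d k i x = (if i = 0 then 0 else infsum (part_weight x) (B_set d k i))"

text \<open>
  The partitions that are counted for \<open>i\<close> but not for \<open>i - 1\<close>. The bound \<open>t\<close> on the parts allows the
  parts below \<open>d\<close> to be removed one value at a time.
\<close>

definition B_exact :: "nat \<Rightarrow> nat \<Rightarrow> nat \<Rightarrow> nat \<Rightarrow> nat multiset set" where
  "B_exact d k i t = {M \<in> B_set d k i. count M d = i - 1 \<and> (\<forall>p\<in>#M. t < p)}"

lemma size_le_sum_mset: "0 \<notin># M \<Longrightarrow> size M \<le> sum_mset M" for M :: "nat multiset"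
  by (induction M) auto

lemma member_le_sum_mset: "p \<in># M \<Longrightarrow> p \<le> sum_mset M" for M :: "nat multiset"
  by (auto dest!: multi_member_split)

lemma finite_bounded_partitions: "finite {M :: nat multiset. 0 \<notin># M \<and> sum_mset M \<le> N}"
proof (rule finite_subset)
  show "{M. 0 \<notin># M \<and> sum_mset M \<le> N} \<subseteq> (\<Union>m\<le>N. multisets_of_size {..N} m)"
    using size_le_sum_mset member_le_sum_mset
    by (auto simp: multisets_of_size_def) (meson atMost_iff le_trans)+
qed (auto intro: finite_multisets_of_size)

lemma ord_ge_part_weight: "x \<in> adm \<Longrightarrow> ord_ge (int (sum_mset M)) (part_weight x M)"
  unfolding part_weight_def using ord_ge_term[of x 1 "sum_mset M" "sum_mset M" "size M"]
  by (simp add: ord_ge_1)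

lemma part_weight_summable:
  assumes x: "x \<in> adm" and A: "\<And>M. M \<in> A \<Longrightarrow> 0 \<notin># M"
  shows "part_weight x summable_on A"
proof (rule summable_on_flsI)
  show "ord_ge 0 (part_weight x M)" for M
    by (rule ord_ge_mono[OF ord_ge_part_weight[OF x]]) (rule of_nat_0_le_iff)
  fix N :: nat
  have "sum_mset M \<le> N" if "\<not> ord_ge (int N) (part_weight x M)" for M
    using that ord_ge_mono[OF ord_ge_part_weight[OF x], of "int N" M] by linarith
  then show "finite {M \<in> A. \<not> ord_ge (int N) (part_weight x M)}"
    using A by (intro finite_subset[OF _ finite_bounded_partitions[of N]]) auto
qed

lemma part_weight_add_mset: "part_weight x (add_mset p M) = x * qv ^ p * part_weight x M"
  by (simp add: part_weight_def power_add mult_ac)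

lemma B_set_no_zero: "M \<in> B_set d k i \<Longrightarrow> 0 \<notin># M"
  by (simp add: B_set_def)

lemma B_exact_no_zero: "M \<in> B_exact d k i t \<Longrightarrow> 0 \<notin># M"
  by (auto simp: B_exact_def B_set_no_zero)

lemma B_fun_step:
  assumes x: "x \<in> adm" and i: "1 \<le> i"
  shows "B_fun d k i x = B_fun d k (i - 1) x + infsum (part_weight x) (B_exact d k i 0)"
proof (cases "i = 1")
  case True
  have "B_exact d k 1 0 = B_set d k 1"
    by (auto simp: B_exact_def B_set_def intro: gr0I)
  then show ?thesis using True by (simp add: B_fun_def)
next
  case False
  have "B_set d k i = B_set d k (i - 1) \<union> B_exact d k i 0"
    using i False by (auto simp: B_exact_def B_set_def intro: gr0I)
  moreover have "B_set d k (i - 1) \<inter> B_exact d k i 0 = {}"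
    using i False by (auto simp: B_exact_def B_set_def)
  ultimately have "infsum (part_weight x) (B_set d k i) =
      infsum (part_weight x) (B_set d k (i - 1)) + infsum (part_weight x) (B_exact d k i 0)"
    using x B_set_no_zero B_exact_no_zero
    by (metis infsum_Un_disjoint part_weight_summable)
  then show ?thesis using i False by (simp add: B_fun_def)
qed

lemma not_dvd_between: "0 < t \<Longrightarrow> t < d \<Longrightarrow> t \<noteq> d * (j::nat)"
  by (cases j) auto

text \<open>
  A part \<open>t + 1 < d\<close> is not a multiple of \<open>d\<close> and may be added or removed freely.
\<close>

lemma B_exact_remove_part:
  assumes t: "Suc t < d"
  shows "B_exact d k i t = B_exact d k i (Suc t) \<union> add_mset (Suc t) ` B_exact d k i t"
    and "B_exact d k i (Suc t) \<inter> add_mset (Suc t) ` B_exact d k i t = {}"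
proof -
  have ne: "Suc t \<noteq> d * j" "Suc t \<noteq> d * j + d" for j
    using not_dvd_between[of "Suc t" d j] t by auto
  have add: "add_mset (Suc t) M \<in> B_exact d k i t \<longleftrightarrow> M \<in> B_exact d k i t" for M
    using t ne by (auto simp: B_exact_def B_set_def)
  have ex: "M \<in> add_mset (Suc t) ` B_exact d k i t" if "M \<in> B_exact d k i t" "M \<notin> B_exact d k i (Suc t)" for M
  proof -
    have "Suc t \<in># M" using that by (auto simp: B_exact_def) (metis Suc_lessI)
    then obtain M' where "M = add_mset (Suc t) M'" by (auto dest: multi_member_split)
    then show ?thesis using that(1) add by blast
  qed
  have "B_exact d k i (Suc t) \<subseteq> B_exact d k i t" by (auto simp: B_exact_def)
  then show "B_exact d k i t = B_exact d k i (Suc t) \<union> add_mset (Suc t) ` B_exact d k i t"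
    using add ex by blast
  show "B_exact d k i (Suc t) \<inter> add_mset (Suc t) ` B_exact d k i t = {}"
    by (auto simp: B_exact_def)
qed

text \<open>
  Either \<open>t + 1\<close> does not occur or one copy of it can be taken away, so the weighted count for the
  bound \<open>t\<close> exceeds the one for \<open>t + 1\<close> by \<open>x q\<^bsup>t+1\<^esup>\<close> times itself.
\<close>

lemma B_exact_remove_small:
  assumes x: "x \<in> adm" and t: "t < d"
  shows "infsum (part_weight x) (B_exact d k i 0) * qpoch (x * qv) qv t = infsum (part_weight x) (B_exact d k i t)"
  using t
proof (induction t)
  case (Suc t)
  let ?S = "\<lambda>t. infsum (part_weight x) (B_exact d k i t)"
  have summ: "part_weight x summable_on B_exact d k i s" for s
    using x B_exact_no_zero by (rule part_weight_summable)
  have sum_img: "part_weight x summable_on add_mset (Suc t) ` B_exact d k i t"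
    by (rule part_weight_summable[OF x]) (auto dest: B_exact_no_zero)
  have "?S t = ?S (Suc t) + infsum (part_weight x) (add_mset (Suc t) ` B_exact d k i t)"
    by (subst B_exact_remove_part(1)[OF Suc.prems])
       (intro infsum_Un_disjoint summ sum_img B_exact_remove_part(2) Suc.prems)
  also have "infsum (part_weight x) (add_mset (Suc t) ` B_exact d k i t) =
      infsum (\<lambda>M. x * qv ^ Suc t * part_weight x M) (B_exact d k i t)"
    by (subst infsum_reindex) (auto simp: o_def part_weight_add_mset inj_on_def)
  also have "\<dots> = x * qv ^ Suc t * ?S t"
    by (intro infsum_cmult_right summ)
  finally have eq: "?S t = ?S (Suc t) + x * qv ^ Suc t * ?S t" .
  have solve: "s = r + y * s \<Longrightarrow> s * (1 - y) = r" for s r y :: series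
    by (simp add: algebra_simps)
  have "?S 0 * qpoch (x * qv) qv (Suc t) = ?S t * (1 - x * qv ^ Suc t)"
    using Suc by (simp add: qpoch_Suc mult.assoc[symmetric] del: mult_Suc)
  also have "\<dots> = ?S (Suc t)" by (rule solve[OF eq])
  finally show ?case .
qed simp

text \<open>
  Rebuilds a partition with parts at least \<open>d\<close> from the number \<open>c\<close> of its parts \<open>d\<close> and its other
  parts, each diminished by \<open>d\<close>.
\<close>

definition shift_up :: "nat \<Rightarrow> nat \<Rightarrow> nat multiset \<Rightarrow> nat multiset" where
  "shift_up d c M = replicate_mset c d + image_mset (\<lambda>p. p + d) M"

lemma count_image_shift: "count (image_mset (\<lambda>p. p + d) M) (p + d) = count M p" for d :: nat
  by (induction M) auto

lemma count_shift_up: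
  assumes "0 \<notin># M"
  shows "count (shift_up d c M) d = c"
    and "p > 0 \<Longrightarrow> count (shift_up d c M) (p + d) = count M p"
  using count_image_shift[of d M 0] count_image_shift[of d M p] assms
  by (auto simp: shift_up_def not_in_iff)

text \<open>
  The condition for \<open>j = 1\<close> bounds the sum of \<open>i - 1\<close> and the number of parts \<open>2d\<close>, and \<open>2d\<close>
  corresponds to the part \<open>d\<close> after the shift. The conditions for \<open>j \<ge> 2\<close> are those for \<open>j - 1\<close> after
  the shift.
\<close>

lemma shift_up_B_set_iff:
  assumes d: "d > 0" and i: "1 \<le> i" "i \<le> k" and M: "0 \<notin># M"
  shows "shift_up d (i - 1) M \<in> B_exact d k i (d - 1) \<longleftrightarrow> M \<in> B_set d k (Suc k - i)"
proof -
  let ?M = "shift_up d (i - 1) M"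
  have parts: "\<forall>p\<in>#?M. d - 1 < p" using d by (auto simp: shift_up_def)
  then have z: "0 \<notin># ?M" by auto
  have c: "count ?M d = i - 1" by (rule count_shift_up(1)[OF M])
  have c': "count ?M (d * j + d) = count M (d * j)" if "j \<ge> 1" for j
    using that d by (intro count_shift_up(2) M) auto
  have "(\<forall>j\<ge>1. count ?M (d * j) + count ?M (d * j + d) \<le> k - 1) \<longleftrightarrow>
      count ?M d + count ?M (d + d) \<le> k - 1 \<and>
      (\<forall>j\<ge>1. count ?M (d * j + d) + count ?M (d * Suc j + d) \<le> k - 1)"
    (is "?L \<longleftrightarrow> ?R")
  proof
    assume L: ?L
    show ?R using L[rule_format, of 1] L[rule_format, of "Suc j" for j] by (auto simp: add.commute)
  next
    assume R: ?R
    show ?L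
    proof (intro allI impI)
      fix j :: nat assume "j \<ge> 1"
      then show "count ?M (d * j) + count ?M (d * j + d) \<le> k - 1"
        using R by (cases "j = 1"; cases j) (auto simp: add.commute)
    qed
  qed
  also have "\<dots> \<longleftrightarrow> count M d \<le> k - i \<and> (\<forall>j\<ge>1. count M (d * j) + count M (d * j + d) \<le> k - 1)"
    using c c' c'[of 1] c'[of "Suc j" for j] i by (auto simp: add.commute)
  finally show ?thesis
    using parts z c M i by (auto simp: B_exact_def B_set_def)
qed

lemma B_exact_image:
  assumes d: "d > 0" and i: "1 \<le> i" "i \<le> k"
  shows "B_exact d k i (d - 1) = shift_up d (i - 1) ` B_set d k (Suc k - i)"
proof (intro equalityI subsetI)
  fix M assume M: "M \<in> B_exact d k i (d - 1)"
  define M' where "M' = image_mset (\<lambda>p. p - d) (filter_mset (\<lambda>p. d < p) M)"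
  have "image_mset (\<lambda>p. p + d) M' = image_mset (\<lambda>p. p) (filter_mset (\<lambda>p. d < p) M)"
    unfolding M'_def image_mset.compositionality by (intro image_mset_cong) auto
  moreover have "M = filter_mset (\<lambda>p. d < p) M + filter_mset (\<lambda>p. \<not> d < p) M"
    by (rule multiset_partition)
  moreover have "filter_mset (\<lambda>p. \<not> d < p) M = filter_mset (\<lambda>p. p = d) M"
    using M d by (intro filter_mset_cong) (auto simp: B_exact_def)
  moreover have "filter_mset (\<lambda>p. p = d) M = replicate_mset (i - 1) d"
    using M by (auto simp: B_exact_def filter_eq_replicate_mset)
  ultimately have eq: "M = shift_up d (i - 1) M'" by (simp add: shift_up_def add.commute)
  have "0 \<notin># M'" by (auto simp: M'_def)
  then show "M \<in> shift_up d (i - 1) ` B_set d k (Suc k - i)"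
    using M shift_up_B_set_iff[OF d i] unfolding eq by blast
next
  fix M assume "M \<in> shift_up d (i - 1) ` B_set d k (Suc k - i)"
  then show "M \<in> B_exact d k i (d - 1)"
    using shift_up_B_set_iff[OF d i] B_set_no_zero by blast
qed

lemma sum_mset_image_add: "sum_mset (image_mset (\<lambda>p. p + d) M) = sum_mset M + d * size M" for d :: nat
  by (induction M) auto

lemma part_weight_shift_up:
  "part_weight x (shift_up d c M) = (x * qv ^ d) ^ c * part_weight (x * qv ^ d) M"
  by (simp add: part_weight_def shift_up_def sum_mset_image_add power_add power_mult_distrib
      power_mult sum_mset_replicate_mset mult_ac) (simp add: power_mult[symmetric] mult.commute)

lemma inj_shift_up: "inj (shift_up d c)"
proof (rule injI)
  fix M N assume "shift_up d c M = shift_up d c N"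
  then have "image_mset (\<lambda>p. p + d) M = image_mset (\<lambda>p. p + d) N" by (simp add: shift_up_def)
  then have "image_mset (\<lambda>p. p - d) (image_mset (\<lambda>p. p + d) M) =
      image_mset (\<lambda>p. p - d) (image_mset (\<lambda>p. p + d) N)" by simp
  then show "M = N" by (simp add: image_mset.compositionality o_def)
qed

text \<open>
  Removing the parts below \<open>d\<close> costs the factor \<open>1/(x q; q)\<^bsub>d-1\<^esub>\<close>, the parts equal to \<open>d\<close> contribute
  \<open>(x q\<^sup>d)\<^bsup>i-1\<^esup>\<close>, and subtracting \<open>d\<close> from every other part replaces \<open>x\<close> by \<open>x q\<^sup>d\<close>.
\<close>

lemma B_gordon_system:
  assumes d: "d > 0"
  shows "gordon_system d k (B_fun d k)"
  unfolding gordon_system_def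
proof (intro ballI conjI allI impI)
  fix x assume x: "x \<in> adm"
  show "B_fun d k 0 x = 0" by (simp add: B_fun_def)
  fix i assume "i \<in> {1..k}"
  then have i: "1 \<le> i" "i \<le> k" by auto
  let ?p = "qv ^ d" and ?q = "qpoch (x * qv) qv (d - 1)"
  have xp: "x * ?p \<in> adm" by (rule adm_mult_qv[OF x])
  have nz: "?q \<noteq> 0" using adm_mult_qv[OF x, of 1] by (intro unit_series_nonzero unit_qpoch_adm_qv) simp
  have "infsum (part_weight x) (B_exact d k i 0) * ?q = infsum (part_weight x) (B_exact d k i (d - 1))"
    using x d by (intro B_exact_remove_small) auto
  also have "\<dots> = infsum (\<lambda>M. (x * ?p) ^ (i - 1) * part_weight (x * ?p) M) (B_set d k (Suc k - i))"
    unfolding B_exact_image[OF d i]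
    by (subst infsum_reindex) (auto simp: o_def part_weight_shift_up intro: inj_on_subset[OF inj_shift_up])
  also have "\<dots> = (x * ?p) ^ (i - 1) * B_fun d k (Suc k - i) (x * ?p)"
    using i B_set_no_zero by (subst infsum_cmult_right) (auto intro: part_weight_summable xp simp: B_fun_def)
  finally have "infsum (part_weight x) (B_exact d k i 0) =
      (x * ?p) ^ (i - 1) * gordon_factor d x * B_fun d k (Suc k - i) (x * ?p)"
    using nz by (simp add: gordon_factor_def field_simps)
  then show "B_fun d k i x = B_fun d k (i - 1) x +
      (x * ?p) ^ (i - 1) * gordon_factor d x * B_fun d k (Suc k - i) (x * ?p)"
    using B_fun_step[OF x i(1), of d k] by simp
  fix N assume N: "ord_ge N x"
  have e: "{#} \<in> B_set d k i" by (simp add: B_set_def)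
  \<comment> \<open>The empty partition contributes the constant \<open>1\<close>; every other weight is divisible by \<open>x\<close>.\<close>
  have "infsum (part_weight x) (insert {#} (B_set d k i - {{#}})) =
      part_weight x {#} + infsum (part_weight x) (B_set d k i - {{#}})"
    by (rule infsum_insert) (use B_set_no_zero in \<open>auto intro!: part_weight_summable x\<close>)
  then have "B_fun d k i x - 1 = infsum (part_weight x) (B_set d k i - {{#}})"
    using e i by (simp add: insert_absorb B_fun_def part_weight_def)
  also have "ord_ge N \<dots>"
  proof (rule ord_ge_infsum)
    fix M assume "M \<in> B_set d k i - {{#}}"
    then have "size M > 0" by (auto simp: nonempty_has_size)
    then show "ord_ge N (part_weight x M)"
      using ord_ge_term_pos[OF x ord_ge_1 N, of "size M" "sum_mset M"] by (simp add: part_weight_def)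
  qed
  finally show "ord_ge N (B_fun d k i x - 1)" .
qed

lemma part_weight_av_nth:
  "fls_nth (part_weight av M) n = (if n = int (sum_mset M) then fls_X ^ size M else 0)"
  by (simp add: part_weight_def av_def fls_const_power[symmetric] qv_power_nth)

text \<open>
  The coefficients of the double power series count partitions by size and length, which is the sum of
  the weights at \<open>x = a\<close> rearranged by size.
\<close>

lemma B_series_eq:
  assumes i: "1 \<le> i"
  shows "B_series d k i = B_fun d k i av"
proof -
  have low: "\<not> ord_ge (n + 1) (part_weight av M) \<longleftrightarrow> int (sum_mset M) \<le> n" for n M
  proof -
    have "(\<forall>m<n + 1. (if m = s then c else 0) = 0) \<longleftrightarrow> \<not> s \<le> n" if "c \<noteq> 0"
      for s :: int and c :: "rat fls" using that by auto
    then show ?thesis unfolding ord_ge_def part_weight_av_nth by simp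
  qed
  have low': "sum_mset M \<le> N" if "\<not> ord_ge (int N) (part_weight av M)" for N M
  proof -
    have "\<not> ord_ge (int N - 1 + 1) (part_weight av M)" using that by simp
    then show ?thesis unfolding low by linarith
  qed
  have "(part_weight av has_sum B_series d k i) (B_set d k i)"
  proof (rule has_sum_flsI)
    fix N :: nat
    show "finite {M \<in> B_set d k i. \<not> ord_ge (int N) (part_weight av M)}"
      by (rule finite_subset[OF _ finite_bounded_partitions[of N]]) (use low' B_set_no_zero in blast)
  next
    fix n :: int
    have sum0: "(\<Sum>M | M \<in> B_set d k i \<and> \<not> ord_ge (n + 1) (part_weight av M). fls_nth (part_weight av M) n)
        = (\<Sum>M | M \<in> B_set d k i \<and> int (sum_mset M) = n. fls_X ^ size M)"
    proof (rule sum.mono_neutral_cong_right)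
      show "finite {M \<in> B_set d k i. \<not> ord_ge (n + 1) (part_weight av M)}"
        unfolding low
        by (rule finite_subset[OF _ finite_bounded_partitions[of "nat n"]])
           (auto simp: le_nat_iff dest: B_set_no_zero)
      show "{M. M \<in> B_set d k i \<and> int (sum_mset M) = n} \<subseteq>
          {M. M \<in> B_set d k i \<and> \<not> ord_ge (n + 1) (part_weight av M)}"
        unfolding low by auto
    qed (simp_all only: part_weight_av_nth, auto)
    show "fls_nth (B_series d k i) n =
        (\<Sum>M | M \<in> B_set d k i \<and> \<not> ord_ge (n + 1) (part_weight av M). fls_nth (part_weight av M) n)"
    proof (cases "n \<ge> 0")
      case False
      then show ?thesis unfolding sum0 by (auto simp: B_series_def intro!: sum.neutral)
    next
      case True
      then obtain s where s: "n = int s" using nonneg_int_cases by blast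
      let ?A = "{M \<in> B_set d k i. sum_mset M = s}"
      have fin: "finite ?A"
        using B_set_no_zero by (intro finite_subset[OF _ finite_bounded_partitions[of s]]) auto
      have "fps_to_fls (Abs_fps (\<lambda>m. of_nat (b_count d k i m s))) = (\<Sum>M\<in>?A. fls_X ^ size M :: rat fls)"
      proof (rule fls_eqI)
        fix m :: int
        have nth: "fls_nth (\<Sum>M\<in>?A. fls_X ^ size M :: rat fls) m = (\<Sum>M\<in>?A. if m = int (size M) then 1 else 0)"
          unfolding fls_nth_sum by (intro sum.cong) (auto simp: fls_X_power_conv_shift_1)
        show "fls_nth (fps_to_fls (Abs_fps (\<lambda>m. of_nat (b_count d k i m s)))) m =
            fls_nth (\<Sum>M\<in>?A. fls_X ^ size M :: rat fls) m"
        proof (cases "m \<ge> 0")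
          case False
          then show ?thesis unfolding nth by (auto intro!: sum.neutral[symmetric])
        next
          case True
          then obtain r where r: "m = int r" using nonneg_int_cases by blast
          have "partitions_B d k i r s = {M \<in> ?A. m = int (size M)}"
            by (auto simp: partitions_B_def B_set_def r)
          then have "of_nat (b_count d k i r s) = (\<Sum>M\<in>?A. if m = int (size M) then 1 else (0::rat))"
            unfolding b_count_def using fin by (simp add: sum.If_cases Int_def)
          then show ?thesis unfolding nth by (simp add: r)
        qed
      qed
      then show ?thesis unfolding sum0 by (simp add: B_series_def s)
    qed
  qed
  then show ?thesis using i by (simp add: B_fun_def infsumI)
qed

theorem B_eq_Q:
  assumes "1 \<le> d" "1 \<le> i" "i \<le> k"
  shows "B_series d k i = Q_series d k i"
  using gordon_system_unique[OF B_gordon_system Q_gordon_system _ adm_av, of d i k] assms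
  by (simp add: B_series_eq Q_series_eq)

section \<open>Raising and lowering the parameter \<open>k\<close>\<close>

text \<open>
  The factor that \<open>n\<close> consecutive steps \<open>x \<mapsto> x q\<^sup>d\<close> of the system accumulate. Carrying it along makes
  the transforms below act on the solutions themselves, for any \<open>d\<close>.
\<close>

definition gordon_factors :: "nat \<Rightarrow> series \<Rightarrow> nat \<Rightarrow> series" where
  "gordon_factors d x n = (\<Prod>l<n. gordon_factor d (x * (qv ^ d) ^ l))"

lemma gordon_factors_0 [simp]: "gordon_factors d x 0 = 1"
  by (simp add: gordon_factors_def)

lemma gordon_factors_Suc: "gordon_factors d x (Suc n) = gordon_factors d x n * gordon_factor d (x * (qv ^ d) ^ n)"
  by (simp add: gordon_factors_def)

lemma gordon_factors_Suc_left: "gordon_factors d x (Suc n) = gordon_factor d x * gordon_factors d (x * qv ^ d) n"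
  by (induction n) (simp_all add: gordon_factors_Suc mult_ac)

lemma unit_gordon_factors: "x \<in> adm \<Longrightarrow> unit_series (gordon_factors d x n)"
  unfolding gordon_factors_def by (intro unit_series_prod unit_gordon_factor adm_mult_qv_power)

definition raise_weight :: "nat \<Rightarrow> nat \<Rightarrow> series \<Rightarrow> nat \<Rightarrow> series" where
  "raise_weight d k x r = x ^ (k * r) * (qv ^ d) ^ (k * r * r) *
     (gordon_factors d x (2 * r) / qpoch (qv ^ d) (qv ^ d) r)"

text \<open>
  For \<open>d = 1\<close> this is the recursion behind the multiple sums of Andrews and Gordon for the moduli
  \<open>2k + 1\<close>, with the smallest summation index split off. The index \<open>i = k + 1\<close> reuses \<open>f k\<close>, in
  accordance with \<open>f (k + 1) - f k\<close> being a multiple of \<open>f 0 = 0\<close>.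
\<close>

definition raise :: "nat \<Rightarrow> nat \<Rightarrow> (nat \<Rightarrow> series \<Rightarrow> series) \<Rightarrow> nat \<Rightarrow> series \<Rightarrow> series" where
  "raise d k f i x = (\<Sum>\<^sub>\<infinity>r. raise_weight d k x r *
     (qv ^ d) ^ ((Suc k - i) * r) * f (min i k) (x * (qv ^ d) ^ (2 * r)))"

text \<open>
  The signs and the powers of \<open>p\<close> are those of the inverse \<open>q\<close>-binomial kernel: formally, lowering
  inverts raising.
\<close>

definition lower_weight :: "nat \<Rightarrow> nat \<Rightarrow> series \<Rightarrow> nat \<Rightarrow> series" where
  "lower_weight d k x r = (-1) ^ r * (qv ^ d) ^ (r choose 2) * raise_weight d k x r"

definition lower :: "nat \<Rightarrow> nat \<Rightarrow> (nat \<Rightarrow> series \<Rightarrow> series) \<Rightarrow> nat \<Rightarrow> series \<Rightarrow> series" where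
  "lower d k f i x = (\<Sum>\<^sub>\<infinity>r. lower_weight d k x r *
     (qv ^ d) ^ ((Suc k - i) * r) * f i (x * (qv ^ d) ^ (2 * r)))"

lemma one_minus_power_nonzero: "d > 0 \<Longrightarrow> 1 - (qv ^ d) ^ Suc n \<noteq> 0"
  using unit_one_minus_qv_power[of "d * Suc n"] unfolding power_mult
  by (intro unit_series_nonzero) simp

lemma raise_weight_0 [simp]: "raise_weight d k x 0 = 1"
  by (simp add: raise_weight_def)

lemma lower_weight_0 [simp]: "lower_weight d k x 0 = 1"
  by (simp add: lower_weight_def numeral_2_eq_2)

lemma raise_weight_Suc:
  assumes d: "d > 0"
  shows "raise_weight d k x (Suc r) * (1 - (qv ^ d) ^ Suc r) = raise_weight d k x r *
    x ^ k * (qv ^ d) ^ (k * (2 * r + 1)) * gordon_factor d (x * (qv ^ d) ^ (2 * r)) *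
    gordon_factor d (x * (qv ^ d) ^ (2 * r + 1))"
proof -
  have G: "gordon_factors d x (2 * Suc r) = gordon_factors d x (2 * r) *
      gordon_factor d (x * (qv ^ d) ^ (2 * r)) * gordon_factor d (x * (qv ^ d) ^ (2 * r + 1))"
    by (simp add: gordon_factors_Suc)
  have Q: "qpoch (qv ^ d) (qv ^ d) (Suc r) = qpoch (qv ^ d) (qv ^ d) r * (1 - (qv ^ d) ^ Suc r)"
    by (simp add: qpoch_Suc)
  have e: "x ^ (k * Suc r) * (qv ^ d) ^ (k * Suc r * Suc r) =
      x ^ (k * r) * (qv ^ d) ^ (k * r * r) * x ^ k * (qv ^ d) ^ (k * (2 * r + 1))"
  proof -
    have "k * Suc r = k * r + k" "k * Suc r * Suc r = k * r * r + k * (2 * r + 1)"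
      by (simp_all add: algebra_simps)
    then show ?thesis by (simp only: power_add mult_ac)
  qed
  have gen: "u \<noteq> 0 \<Longrightarrow> XP * (g * g1 * g2 / (q * u)) * u = XP * (g / q) * (g1 * g2)"
    for XP g g1 g2 q u :: series by simp
  show ?thesis
    unfolding raise_weight_def G Q gen[OF one_minus_power_nonzero[OF d]] e by (simp only: mult_ac)
qed

lemma raise_weight_shift:
  "gordon_factor d x * raise_weight d k (x * qv ^ d) r =
    raise_weight d k x r * (qv ^ d) ^ (k * r) * gordon_factor d (x * (qv ^ d) ^ (2 * r))"
proof -
  have "gordon_factor d x * gordon_factors d (x * qv ^ d) (2 * r) =
      gordon_factors d x (2 * r) * gordon_factor d (x * (qv ^ d) ^ (2 * r))"
    by (simp only: gordon_factors_Suc[symmetric] gordon_factors_Suc_left[symmetric])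
  then have key: "gordon_factor d x * (gordon_factors d (x * qv ^ d) (2 * r) / t) =
      gordon_factors d x (2 * r) / t * gordon_factor d (x * (qv ^ d) ^ (2 * r))" for t
    by simp
  have "gordon_factor d x * raise_weight d k (x * qv ^ d) r = x ^ (k * r) * (qv ^ d) ^ (k * r) *
      (qv ^ d) ^ (k * r * r) *
      (gordon_factor d x * (gordon_factors d (x * qv ^ d) (2 * r) / qpoch (qv ^ d) (qv ^ d) r))"
    unfolding raise_weight_def power_mult_distrib by (simp only: mult_ac)
  then show ?thesis unfolding key by (simp only: raise_weight_def mult_ac)
qed

lemma lower_weight_Suc:
  assumes d: "d > 0"
  shows "lower_weight d k x (Suc r) * (1 - (qv ^ d) ^ Suc r) = - (lower_weight d k x r *
    x ^ k * (qv ^ d) ^ (k * (2 * r + 1) + r) * gordon_factor d (x * (qv ^ d) ^ (2 * r)) *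
    gordon_factor d (x * (qv ^ d) ^ (2 * r + 1)))"
proof -
  have "lower_weight d k x (Suc r) * (1 - (qv ^ d) ^ Suc r) =
      (-1) ^ Suc r * (qv ^ d) ^ (Suc r choose 2) * (raise_weight d k x (Suc r) * (1 - (qv ^ d) ^ Suc r))"
    by (simp only: lower_weight_def mult.assoc)
  moreover have "Suc r choose 2 = r + (r choose 2)" by (simp add: numeral_2_eq_2)
  ultimately show ?thesis
    unfolding raise_weight_Suc[OF d] by (simp only: lower_weight_def power_add power_Suc mult_ac mult_minus_left mult_minus_right mult_1_left)
qed

lemma lower_weight_shift:
  "gordon_factor d x * lower_weight d k (x * qv ^ d) r =
    lower_weight d k x r * (qv ^ d) ^ (k * r) * gordon_factor d (x * (qv ^ d) ^ (2 * r))"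
proof -
  have "gordon_factor d x * lower_weight d k (x * qv ^ d) r =
      (-1) ^ r * (qv ^ d) ^ (r choose 2) * (gordon_factor d x * raise_weight d k (x * qv ^ d) r)"
    by (simp only: lower_weight_def mult_ac)
  then show ?thesis unfolding raise_weight_shift by (simp only: lower_weight_def mult_ac)
qed

lemma ord_ge_weights:
  assumes x: "x \<in> adm" and d: "d > 0" and k: "k > 0"
  shows "ord_ge (int r) (raise_weight d k x r)"
    and "ord_ge (int r) (lower_weight d k x r)"
    and "ord_ge N x \<Longrightarrow> r > 0 \<Longrightarrow> ord_ge N (raise_weight d k x r)"
    and "ord_ge N x \<Longrightarrow> r > 0 \<Longrightarrow> ord_ge N (lower_weight d k x r)"
proof -
  have u: "ord_ge 0 (gordon_factors d x (2 * r) / qpoch (qv ^ d) (qv ^ d) r)"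
    by (intro ord_ge_divide unit_series_ord_ge[OF unit_gordon_factors] unit_qpoch_qv x d)
  have e: "r \<le> d * (k * r * r)" using d k by (cases "r = 0") auto
  have w: "raise_weight d k x r = x ^ (k * r) * qv ^ (d * (k * r * r)) *
      (gordon_factors d x (2 * r) / qpoch (qv ^ d) (qv ^ d) r)"
    by (simp only: raise_weight_def power_mult)
  have s: "ord_ge 0 ((-1) ^ r * (qv ^ d) ^ (r choose 2))"
    by (intro ord_ge_mult_right ord_ge_power_0 ord_ge_minus_one_power ord_ge_qv)
  show 1: "ord_ge (int r) (raise_weight d k x r)" unfolding w by (intro ord_ge_term x u e)
  show "ord_ge (int r) (lower_weight d k x r)"
    unfolding lower_weight_def by (intro ord_ge_mult_left[OF s] 1)
  show 2: "ord_ge N (raise_weight d k x r)" if "ord_ge N x" "r > 0"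
    unfolding w by (intro ord_ge_term_pos x u that) (use k that in simp)
  show "ord_ge N (lower_weight d k x r)" if "ord_ge N x" "r > 0"
    unfolding lower_weight_def by (intro ord_ge_mult_left[OF s] 2 that)
qed

text \<open>
  The form in which the factors \<open>1 - p\<^sup>r\<close> are exploited in both transforms: the part that carries
  such a factor is moved by one step, the other part stays.
\<close>

lemma infsum_add_shift:
  fixes a b :: "nat \<Rightarrow> series"
  assumes a: "\<And>n. ord_ge (int n) (a n)" and b: "\<And>n. ord_ge (int n) (b n)" and a0: "a 0 = 0"
  shows "infsum (\<lambda>n. a n + b n) UNIV = infsum (\<lambda>n. a (Suc n) + b n) UNIV"
proof -
  have S: "a summable_on UNIV" "b summable_on UNIV" "(\<lambda>n. a (Suc n)) summable_on UNIV"
    using a b ord_ge_mono[OF a] by (auto intro!: summable_nat_flsI)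
  then show ?thesis using infsum_shift[OF a a0] by (simp add: infsum_add)
qed

text \<open>
  The equations of the system in a form that also covers \<open>i = k + 1\<close>, where \<open>f c\<close> is \<open>f 0 = 0\<close>.
\<close>

lemma gordon_system_min:
  assumes f: "gordon_system d k f" and z: "z \<in> adm" and k: "k = j + c"
  shows "f (min (Suc j) k) z = f j z + (z * qv ^ d) ^ j * gordon_factor d z * f c (z * qv ^ d)"
proof (cases c)
  case 0
  then show ?thesis using k gordon_systemD(1)[OF f adm_mult_qv[OF z, of d]] by simp
next
  case (Suc c')
  then show ?thesis using k gordon_systemD(2)[OF f z, of "Suc j"] by simp
qed

text \<open>
  With \<open>i = j + 1\<close> and \<open>k = j + c\<close>, both sides are sums over \<open>r\<close> of values of \<open>f\<close> at \<open>x p\<^bsup>2r+1\<^esup>\<close> and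
  \<open>x p\<^bsup>2r+2\<^esup>\<close>: the left one after a shift, the right one after the system is applied once more.
\<close>

lemma raise_gordon_system:
  assumes f: "gordon_system d k f" and d: "d > 0" and k: "k > 0"
  shows "gordon_system d (Suc k) (raise d k f)"
  unfolding gordon_system_def
proof (intro ballI conjI allI impI)
  fix x assume x: "x \<in> adm"
  let ?p = "qv ^ d" and ?W = "raise_weight d k x" and ?c = "gordon_factor d"
  let ?y = "\<lambda>r. x * ?p ^ (2 * r)"
  have y: "x * ?p ^ m \<in> adm" for m by (rule adm_mult_qv_power[OF x])
  show "raise d k f 0 x = 0" using gordon_systemD(1)[OF f y] by (simp add: raise_def)
  have fx: "ord_ge 0 (f i (x * ?p ^ m))" if "i \<le> k" for i m
    by (rule gordon_system_ord_ge[OF f y that])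
  have ox: "ord_ge 0 x" by (rule ord_ge_adm[OF x])
  have oc: "ord_ge 0 (?c (x * ?p ^ m))" for m by (intro unit_series_ord_ge unit_gordon_factor y)
  fix i assume i: "i \<in> {1..Suc k}"
  then obtain j where j: "i = Suc j" by (cases i) auto
  with i obtain c where c: "k = j + c" by (auto simp: le_iff_add)
  \<comment> \<open>Write \<open>J\<^sub>i - p\<^sup>r J\<^sub>i\<^sub>-\<^sub>1\<close> as \<open>(J\<^sub>i - J\<^sub>i\<^sub>-\<^sub>1) + (1 - p\<^sup>r) J\<^sub>i\<^sub>-\<^sub>1\<close>: the first bracket is turned into \<open>b\<close>
    by the given system, and the second gives \<open>a\<close>, whose factor \<open>1 - p\<^sup>r\<close> cancels after the shift
    \<open>r \<mapsto> r + 1\<close>.\<close>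
  define a where "a = (\<lambda>r. ?W r * ?p ^ (c * r) * (1 - ?p ^ r) * f j (?y r))"
  define b where "b = (\<lambda>r. ?W r * ?p ^ (c * r) * (?y r * ?p) ^ j * ?c (?y r) * f c (?y r * ?p))"
  note ords = ord_ge_mult_right ord_ge_diff ord_ge_1 ord_ge_power_0 ord_ge_qv ox oc fx
    ord_ge_weights(1)[OF x d k]
  have fy: "ord_ge 0 (f c (?y r * ?p))" for r
    using fx[of c "Suc (2 * r)"] c by (simp add: mult_ac)
  have a: "ord_ge (int r) (a r)" for r
    unfolding a_def using c by (intro ords) auto
  have b: "ord_ge (int r) (b r)" for r
    unfolding b_def by (intro ords fy)
  have t: "ord_ge (int r) (?W r * ?p ^ m * f i' (?y r))" if "i' \<le> k" for r m i'
    using that by (intro ords) auto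
  have S1: "(\<lambda>r. ?W r * ?p ^ ((Suc k - j) * r) * f (min j k) (?y r)) summable_on UNIV"
    by (intro summable_nat_flsI t) simp
  have S2: "(\<lambda>r. a r + b r) summable_on UNIV"
    by (intro summable_nat_flsI ord_ge_add a b)
  have diff: "?W r * ?p ^ ((Suc k - i) * r) * f (min i k) (?y r) =
      ?W r * ?p ^ ((Suc k - j) * r) * f (min j k) (?y r) + (a r + b r)" for r
  proof -
    have e: "Suc k - i = c" "(Suc k - j) * r = c * r + r" "min j k = j"
      using c j by (auto simp: algebra_simps)
    have gen: "W * C * (F + Y * g * G) = W * (C * R) * F + (W * C * (1 - R) * F + W * C * Y * g * G)"
      for W C F Y g G R :: series by (simp add: algebra_simps)
    show ?thesis
      unfolding e a_def b_def power_add unfolding j gordon_system_min[OF f y c] by (rule gen)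
  qed
  have shift: "(x * ?p) ^ j * ?c x * (raise_weight d k (x * ?p) r * ?p ^ ((Suc k - Suc c) * r) *
      f (min (Suc c) k) (x * ?p * ?p ^ (2 * r))) = a (Suc r) + b r" for r
  proof -
    have kc: "Suc k - Suc c = j" and ck: "k = c + j" using c by auto
    have z: "x * ?p * ?p ^ (2 * r) = ?y r * ?p" "?y r * ?p * ?p = ?y (Suc r)"
       "x * ?p ^ (2 * r + 1) = ?y r * ?p"
      by (simp_all add: mult_ac)
    have zadm: "?y r * ?p \<in> adm" by (intro adm_mult_qv y)
    have m: "f (min (Suc c) k) (?y r * ?p) = f c (?y r * ?p) + ?y (Suc r) ^ c * ?c (?y r * ?p) * f j (?y (Suc r))"
      using gordon_system_min[OF f zadm ck] unfolding z(2) .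
    have aS: "a (Suc r) = ?W r * x ^ k * ?p ^ (k * (2 * r + 1)) * ?c (?y r) * ?c (?y r * ?p) * ?p ^ (c * Suc r) * f j (?y (Suc r))"
    proof -
      have "a (Suc r) = ?W (Suc r) * (1 - ?p ^ Suc r) * ?p ^ (c * Suc r) * f j (?y (Suc r))"
        unfolding a_def by (simp only: mult_ac)
      then show ?thesis unfolding raise_weight_Suc[OF d] z(3) .
    qed
    have e1: "(x * ?p) ^ j * ?p ^ (k * r) * ?p ^ (j * r) = ?p ^ (c * r) * (?y r * ?p) ^ j"
    proof -
      have "j + k * r + j * r = c * r + (2 * r * j + j)" unfolding c by (simp add: algebra_simps)
      then have "?p ^ j * ?p ^ (k * r) * ?p ^ (j * r) = ?p ^ (c * r) * (?p ^ (2 * r * j) * ?p ^ j)"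
        by (simp only: power_add[symmetric])
      then have "x ^ j * (?p ^ j * ?p ^ (k * r) * ?p ^ (j * r)) = x ^ j * (?p ^ (c * r) * (?p ^ (2 * r * j) * ?p ^ j))"
        by (simp only:)
      then show ?thesis
        unfolding power_mult_distrib power_mult[of ?p "2 * r" j] by (simp only: mult_ac)
    qed
    have "j + k * r + j * r + 2 * Suc r * c = k * (2 * r + 1) + c * Suc r"
      unfolding c by (simp add: algebra_simps)
    then have e: "?p ^ j * ?p ^ (k * r) * ?p ^ (j * r) * ?p ^ (2 * Suc r * c) = ?p ^ (k * (2 * r + 1)) * ?p ^ (c * Suc r)"
      by (simp only: power_add[symmetric])
    have "(x * ?p) ^ j * ?p ^ (k * r) * ?p ^ (j * r) * ?y (Suc r) ^ c =
        x ^ k * (?p ^ j * ?p ^ (k * r) * ?p ^ (j * r) * ?p ^ (2 * Suc r * c))"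
      unfolding c power_add[of x j c] power_mult[of ?p "2 * Suc r" c] power_mult_distrib by (simp only: mult_ac)
    then have e2: "(x * ?p) ^ j * ?p ^ (k * r) * ?p ^ (j * r) * ?y (Suc r) ^ c = x ^ k * ?p ^ (k * (2 * r + 1)) * ?p ^ (c * Suc r)"
      unfolding e by (simp only: mult.assoc)
    have "(x * ?p) ^ j * ?c x * (raise_weight d k (x * ?p) r * ?p ^ (j * r) * f (min (Suc c) k) (?y r * ?p)) =
       (x * ?p) ^ j * (?c x * raise_weight d k (x * ?p) r) * ?p ^ (j * r) * f (min (Suc c) k) (?y r * ?p)"
      by (simp only: mult_ac)
    also have "\<dots> = ?W r * ((x * ?p) ^ j * ?p ^ (k * r) * ?p ^ (j * r)) * ?c (?y r) * f c (?y r * ?p) +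
       ?W r * ((x * ?p) ^ j * ?p ^ (k * r) * ?p ^ (j * r) * ?y (Suc r) ^ c) * ?c (?y r) * ?c (?y r * ?p) * f j (?y (Suc r))"
      unfolding raise_weight_shift m distrib_left by (simp only: mult_ac)
    also have "\<dots> = a (Suc r) + b r"
      unfolding e2 unfolding e1 aS b_def by (simp only: mult_ac add_ac)
    finally show ?thesis unfolding kc z(1) .
  qed
  have t': "ord_ge (int r) (raise_weight d k (x * ?p) r * ?p ^ m * f i' (x * ?p * ?p ^ (2 * r)))" if "i' \<le> k" for r m i'
    using that adm_mult_qv[OF x, of d]
    by (intro ord_ge_mult_right ord_ge_weights(1) d k ord_ge_power_0 ord_ge_qv gordon_system_ord_ge[OF f] adm_mult_qv_power) auto
  have "raise d k f i x = raise d k f j x + infsum (\<lambda>r. a r + b r) UNIV"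
    unfolding raise_def diff by (rule infsum_add[OF S1 S2])
  also have "infsum (\<lambda>r. a r + b r) UNIV = infsum (\<lambda>r. a (Suc r) + b r) UNIV"
    by (rule infsum_add_shift[OF a b]) (simp add: a_def)
  also have "\<dots> = (x * ?p) ^ j * ?c x * raise d k f (Suc c) (x * ?p)"
    unfolding raise_def shift[symmetric]
    by (intro infsum_cmult_right summable_nat_flsI t') simp
  finally show "raise d k f i x = raise d k f (i - 1) x +
      (x * ?p) ^ (i - 1) * ?c x * raise d k f (Suc (Suc k) - i) (x * ?p)"
    using c by (simp add: j Suc_diff_le)
  fix N assume N: "ord_ge N x"
  show "ord_ge N (raise d k f i x - 1)"
    unfolding raise_def
  proof (rule infsum_near_1)
    show "ord_ge (int r) (?W r * ?p ^ ((Suc k - i) * r) * f (min i k) (?y r))" for r by (rule t) simp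
    show "ord_ge N (?W 0 * ?p ^ ((Suc k - i) * 0) * f (min i k) (?y 0) - 1)"
      using gordon_systemD(3)[OF f x _ _ N, of "min i k"] i k by simp
    show "ord_ge N (?W (Suc r) * ?p ^ ((Suc k - i) * Suc r) * f (min i k) (?y (Suc r)))" for r
      by (intro ord_ge_mult_right ord_ge_weights(3) x d k N ord_ge_power_0 ord_ge_qv fx) auto
  qed
qed


text \<open>
  Here the two sides cannot be compared term by term. Their difference \<open>S(x)\<close>, however, turns out to
  satisfy \<open>S(x) = t(x) S(x p\<^sup>2)\<close> with \<open>t(x)\<close> of positive order, and therefore vanishes.
\<close>

lemma lower_defect:
  fixes f :: "nat \<Rightarrow> series \<Rightarrow> series"
  assumes f: "gordon_system d (Suc k) f" and d: "d > 0" and k: "k = j + c" "k > 0" and x: "x \<in> adm"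
  shows "lower d k f (Suc j) x = lower d k f j x +
     (x * qv ^ d) ^ j * gordon_factor d x * lower d k f c (x * qv ^ d)"
proof -
  let ?p = "qv ^ d" and ?W = "lower_weight d k" and ?c = "gordon_factor d"
  \<comment> \<open>The summand of the defect, the difference of the two sides.\<close>
  define D where "D = (\<lambda>x r. ?W x r * ?p ^ (c * r) *
      (f (Suc j) (x * ?p ^ (2 * r)) - ?p ^ r * f j (x * ?p ^ (2 * r))) -
      (x * ?p) ^ j * ?c x * (?W (x * ?p) r * ?p ^ (Suc j * r) * f c (x * ?p * ?p ^ (2 * r))))"
  have wt: "ord_ge (int r) (?W x r)" if "x \<in> adm" for x r
    by (rule ord_ge_weights(2)[OF that d k(2)])
  have fo: "ord_ge 0 (f i x)" if "x \<in> adm" "i \<le> Suc k" for i x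
    by (rule gordon_system_ord_ge[OF f that])
  have co: "ord_ge 0 (?c x)" if "x \<in> adm" for x
    by (intro unit_series_ord_ge unit_gordon_factor that)
  have pw: "ord_ge 0 (?p ^ m)" for m by (intro ord_ge_power_0 ord_ge_qv)
  have D_ord: "ord_ge (int r) (D x r)" if x: "x \<in> adm" for x r
  proof -
    have xp: "x * ?p \<in> adm" by (rule adm_mult_qv[OF x])
    have "ord_ge (int r) ((x * ?p) ^ j * ?c x * (?W (x * ?p) r * ?p ^ (Suc j * r) * f c (x * ?p * ?p ^ (2 * r))))"
      using k(1) by (intro ord_ge_mult_left[of "(x * ?p) ^ j * ?c x"] ord_ge_mult_right[OF ord_ge_mult_right[OF wt[OF xp]]]
          ord_ge_mult_right[OF ord_ge_power_0[OF ord_ge_adm[OF xp]]] co x pw fo adm_mult_qv_power xp) auto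
    moreover have "ord_ge (int r) (?W x r * ?p ^ (c * r) *
        (f (Suc j) (x * ?p ^ (2 * r)) - ?p ^ r * f j (x * ?p ^ (2 * r))))"
      using k(1) by (intro ord_ge_mult_right[OF ord_ge_mult_right[OF wt[OF x]]] ord_ge_diff
          ord_ge_mult_left[OF pw] pw fo adm_mult_qv_power x) auto
    ultimately show ?thesis unfolding D_def by (intro ord_ge_diff)
  qed
  define S where "S = (\<lambda>x. infsum (D x) UNIV)"
  define t where "t = (\<lambda>x. x ^ k * ?p ^ (k + c) * ?c x * ?c (x * ?p))"
  have rec: "S x = t x * S (x * qv ^ (2 * d))" if x: "x \<in> adm" for x
  proof -
    let ?y = "\<lambda>r. x * ?p ^ (2 * r)"
    have y: "?y r \<in> adm" for r by (rule adm_mult_qv_power[OF x])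
    have z: "x * ?p * ?p ^ (2 * r) = ?y r * ?p" "?y r * ?p * ?p = ?y (Suc r)"
       "x * ?p ^ (2 * r + 1) = ?y r * ?p" for r
      by (simp_all add: mult_ac)
    have zadm: "?y r * ?p \<in> adm" for r by (intro adm_mult_qv y)
    \<comment> \<open>Two applications of the given system split the defect into \<open>A + B + C\<close>, where \<open>A\<close> and \<open>B\<close>
      carry the factor \<open>1 - p\<^sup>r\<close> and are shifted.\<close>
    define A where "A = (\<lambda>r. ?W x r * ?p ^ (c * r) * (1 - ?p ^ r) * f j (?y r))"
    define B where "B = (\<lambda>r. ?W x r * ?p ^ (c * r) * (?y r * ?p) ^ j * ?c (?y r) * (1 - ?p ^ r) * f c (?y r * ?p))"
    define C where "C = (\<lambda>r. ?W x r * ?p ^ (c * r) * (?y r * ?p) ^ j * ?c (?y r) *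
        ?y (Suc r) ^ c * ?c (?y r * ?p) * f (Suc j) (?y (Suc r)))"
    note ords = ord_ge_mult_right wt[OF x] pw ord_ge_diff[OF ord_ge_1 pw]
      fo[OF y] fo[OF zadm] co[OF y] co[OF zadm] ord_ge_power_0[OF ord_ge_adm[OF y]]
      ord_ge_power_0[OF ord_ge_adm[OF zadm]]
    have A: "ord_ge (int r) (A r)" for r unfolding A_def using k(1) by (intro ords) auto
    have B: "ord_ge (int r) (B r)" for r unfolding B_def using k(1) by (intro ords) auto
    have C: "ord_ge (int r) (C r)" for r unfolding C_def using k(1) by (intro ords) auto
    have f1: "f (Suc j) (?y r) = f j (?y r) + (?y r * ?p) ^ j * ?c (?y r) * f (Suc c) (?y r * ?p)" for r
      using gordon_systemD(2)[OF f y, of "Suc j" r] k(1) by (simp add: Suc_diff_le)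
    have f2: "f (Suc c) (?y r * ?p) = f c (?y r * ?p) + ?y (Suc r) ^ c * ?c (?y r * ?p) * f (Suc j) (?y (Suc r))" for r
      using gordon_systemD(2)[OF f zadm, of "Suc c" r] k(1) unfolding z(2) by (simp add: Suc_diff_le)
    have second: "(x * ?p) ^ j * ?c x * (?W (x * ?p) r * ?p ^ (Suc j * r) * f c (?y r * ?p)) =
        ?W x r * ?p ^ (c * r) * (?y r * ?p) ^ j * ?c (?y r) * ?p ^ r * f c (?y r * ?p)" for r
    proof -
      have "j + k * r + Suc j * r = c * r + (2 * r * j + j) + r"
        unfolding k(1) by (simp add: algebra_simps)
      then have e: "?p ^ j * ?p ^ (k * r) * ?p ^ (Suc j * r) = ?p ^ (c * r) * (?p ^ (2 * r * j) * ?p ^ j) * ?p ^ r"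
        by (simp only: power_add[symmetric])
      have "(x * ?p) ^ j * ?c x * (?W (x * ?p) r * ?p ^ (Suc j * r) * f c (?y r * ?p)) =
        (x * ?p) ^ j * (?c x * ?W (x * ?p) r) * ?p ^ (Suc j * r) * f c (?y r * ?p)"
        by (simp only: mult_ac)
      also have "\<dots> = ?W x r * x ^ j * (?p ^ j * ?p ^ (k * r) * ?p ^ (Suc j * r)) * ?c (?y r) * f c (?y r * ?p)"
        unfolding lower_weight_shift power_mult_distrib by (simp only: mult_ac)
      also have "\<dots> = ?W x r * ?p ^ (c * r) * (?y r * ?p) ^ j * ?c (?y r) * ?p ^ r * f c (?y r * ?p)"
        unfolding e power_mult_distrib power_mult[of ?p "2 * r" j] by (simp only: mult_ac)
      finally show ?thesis .
    qed
    have split: "D x r = (A r + B r) + C r" for r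
    proof -
      have gen: "W * (F + Y * g * (G + Z * h * H) - R * F) - W * Y * g * R * G =
        (W * (1 - R) * F + W * Y * g * (1 - R) * G) + W * Y * g * Z * h * H"
        for W F Y g G Z h H R :: series by (simp add: algebra_simps)
      show ?thesis unfolding D_def z(1) second f1[of r] f2[of r] A_def B_def C_def by (rule gen)
    qed
    have shift: "t x * D (x * ?p ^ 2) r = (A (Suc r) + B (Suc r)) + C r" for r
    proof -
      have z2: "x * ?p ^ 2 * ?p ^ (2 * r) = ?y (Suc r)" "x * ?p ^ 2 = x * ?p * ?p"
        "x * ?p ^ 2 * ?p * ?p ^ (2 * r) = ?y (Suc r) * ?p"
        by (simp_all add: mult_ac power2_eq_square)
      have aS: "?W x (Suc r) * (1 - ?p ^ Suc r) =
          - (?W x r * x ^ k * ?p ^ (k * (2 * r + 1) + r) * ?c (?y r) * ?c (?y r * ?p))"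
        using lower_weight_Suc[OF d, of k x r] unfolding z(3) .
      have W2: "?c x * ?c (x * ?p) * ?W (x * ?p ^ 2) r =
          ?W x r * ?p ^ (2 * k * r) * ?c (?y r) * ?c (?y r * ?p)"
      proof -
        have "?c x * ?c (x * ?p) * ?W (x * ?p ^ 2) r = ?c x * (?c (x * ?p) * ?W (x * ?p * ?p) r)"
          unfolding z2(2) by (simp only: mult.assoc)
        also have "\<dots> = (?c x * ?W (x * ?p) r) * ?p ^ (k * r) * ?c (?y r * ?p)"
          unfolding lower_weight_shift[of d "x * ?p" k r] z(1) by (simp only: mult_ac)
        also have "\<dots> = ?W x r * (?p ^ (k * r) * ?p ^ (k * r)) * ?c (?y r) * ?c (?y r * ?p)"
          unfolding lower_weight_shift by (simp only: mult_ac)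
        also have "?p ^ (k * r) * ?p ^ (k * r) = ?p ^ (2 * k * r)"
          by (simp only: power_add[symmetric] mult_2 distrib_right)
        finally show ?thesis .
      qed
      have W3: "?c (x * ?p ^ 2) * ?W (x * ?p ^ 2 * ?p) r = ?W (x * ?p ^ 2) r * ?p ^ (k * r) * ?c (?y (Suc r))"
        using lower_weight_shift[of d "x * ?p ^ 2" k r] unfolding z2(1) .
      let ?V = "?W x r * ?c (?y r) * ?c (?y r * ?p) * x ^ k"
      let ?F = "f (Suc j) (?y (Suc r))" and ?G = "f j (?y (Suc r))" and ?H = "f c (?y (Suc r) * ?p)"
      have "t x * D (x * ?p ^ 2) r = x ^ k * ?p ^ (k + c) * (?c x * ?c (x * ?p) * ?W (x * ?p ^ 2) r) * ?p ^ (c * r) * (?F - ?p ^ r * ?G) -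
          x ^ k * ?p ^ (k + c) * (x * ?p ^ 2 * ?p) ^ j * (?c x * ?c (x * ?p) * (?c (x * ?p ^ 2) * ?W (x * ?p ^ 2 * ?p) r)) * ?p ^ (Suc j * r) * ?H"
        unfolding t_def D_def z2(1,3) right_diff_distrib by (simp only: mult_ac)
      also have "?c x * ?c (x * ?p) * (?c (x * ?p ^ 2) * ?W (x * ?p ^ 2 * ?p) r) =
          (?c x * ?c (x * ?p) * ?W (x * ?p ^ 2) r) * ?p ^ (k * r) * ?c (?y (Suc r))"
        unfolding W3 by (simp only: mult_ac)
      also have "x ^ k * ?p ^ (k + c) * (?c x * ?c (x * ?p) * ?W (x * ?p ^ 2) r) * ?p ^ (c * r) * (?F - ?p ^ r * ?G) -
          x ^ k * ?p ^ (k + c) * (x * ?p ^ 2 * ?p) ^ j * ((?c x * ?c (x * ?p) * ?W (x * ?p ^ 2) r) * ?p ^ (k * r) * ?c (?y (Suc r))) * ?p ^ (Suc j * r) * ?H =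
          ?V * (?p ^ (k + c) * ?p ^ (2 * k * r) * ?p ^ (c * r)) * ?F -
          ?V * (?p ^ (k + c) * ?p ^ (2 * k * r) * ?p ^ (c * r) * ?p ^ r) * ?G -
          ?V * (?p ^ (k + c) * ?p ^ (2 * k * r) * ?p ^ (k * r) * ?p ^ (Suc j * r) * (?p ^ (2 * j) * ?p ^ j)) * x ^ j * ?c (?y (Suc r)) * ?H"
        unfolding W2 power_mult_distrib power_mult[of ?p 2 j] right_diff_distrib by (simp only: mult_ac)
      also have "?p ^ (k + c) * ?p ^ (2 * k * r) * ?p ^ (c * r) = ?p ^ (c * r) * (?p ^ (2 * r * j) * ?p ^ j) * ?p ^ (2 * Suc r * c)"
      proof -
        have "k + c + 2 * k * r + c * r = c * r + (2 * r * j + j) + 2 * Suc r * c"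
          unfolding k(1) by (simp add: algebra_simps)
        then show ?thesis by (simp only: power_add[symmetric])
      qed
      also have "?V * (?p ^ (c * r) * (?p ^ (2 * r * j) * ?p ^ j) * ?p ^ (2 * Suc r * c)) * ?F = C r"
        unfolding C_def power_mult_distrib power_mult[of ?p "2 * r" j] power_mult[of ?p "2 * Suc r" c]
        unfolding k(1) power_add[of x j c] by (simp only: mult_ac)
      also have "?p ^ (c * r) * (?p ^ (2 * r * j) * ?p ^ j) * ?p ^ (2 * Suc r * c) * ?p ^ r = ?p ^ (k * (2 * r + 1) + r) * ?p ^ (c * Suc r)"
      proof -
        have "c * r + (2 * r * j + j) + 2 * Suc r * c + r = k * (2 * r + 1) + r + c * Suc r"
          unfolding k(1) by (simp add: algebra_simps)
        then show ?thesis by (simp only: power_add[symmetric])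
      qed
      also have "?p ^ (k + c) * ?p ^ (2 * k * r) * ?p ^ (k * r) * ?p ^ (Suc j * r) * (?p ^ (2 * j) * ?p ^ j) =
          ?p ^ (k * (2 * r + 1) + r) * ?p ^ (c * Suc r) * (?p ^ (2 * Suc r * j) * ?p ^ j)"
      proof -
        have "k + c + 2 * k * r + k * r + Suc j * r + (2 * j + j) = k * (2 * r + 1) + r + c * Suc r + (2 * Suc r * j + j)"
          unfolding k(1) by (simp add: algebra_simps)
        then show ?thesis by (simp only: power_add[symmetric])
      qed
      also have "C r - ?V * (?p ^ (k * (2 * r + 1) + r) * ?p ^ (c * Suc r)) * ?G -
          ?V * (?p ^ (k * (2 * r + 1) + r) * ?p ^ (c * Suc r) * (?p ^ (2 * Suc r * j) * ?p ^ j)) * x ^ j * ?c (?y (Suc r)) * ?H =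
          (A (Suc r) + B (Suc r)) + C r"
      proof -
        have "A (Suc r) = (?W x (Suc r) * (1 - ?p ^ Suc r)) * ?p ^ (c * Suc r) * ?G"
          unfolding A_def by (simp only: mult_ac)
        moreover have "B (Suc r) = (?W x (Suc r) * (1 - ?p ^ Suc r)) * ?p ^ (c * Suc r) * (?p ^ (2 * Suc r * j) * ?p ^ j) * x ^ j * ?c (?y (Suc r)) * ?H"
          unfolding B_def power_mult_distrib power_mult[of ?p "2 * Suc r" j] by (simp only: mult_ac)
        ultimately show ?thesis unfolding aS by (simp only: mult_ac mult_minus_left mult_minus_right diff_conv_add_uminus add_ac)
      qed
      finally show ?thesis .
    qed
    have AB: "ord_ge (int r) (A r + B r)" for r by (intro ord_ge_add A B)
    have "S x = infsum (\<lambda>r. (A r + B r) + C r) UNIV" unfolding S_def split ..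
    also have "\<dots> = infsum (\<lambda>r. (A (Suc r) + B (Suc r)) + C r) UNIV"
      by (rule infsum_add_shift[OF AB C]) (simp add: A_def B_def)
    also have "\<dots> = t x * S (x * ?p ^ 2)"
      unfolding S_def shift[symmetric]
      by (intro infsum_cmult_right summable_nat_flsI D_ord adm_mult_qv_power x)
    finally show ?thesis by (simp add: power_mult[symmetric] mult.commute)
  qed
  have "ord_ge 1 (t x)" if x: "x \<in> adm" for x
  proof -
    have "ord_ge (int 1) (x ^ k * qv ^ (d * (k + c)) * (?c x * ?c (x * ?p)))"
      by (intro ord_ge_term x ord_ge_mult_left co adm_mult_qv) (use d k in auto)
    then show ?thesis by (simp add: t_def power_mult mult.assoc)
  qed
  moreover have "ord_ge 0 (S x)" if x: "x \<in> adm" for x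
    unfolding S_def by (intro ord_ge_infsum ord_ge_mono[OF D_ord[OF x]]) simp
  ultimately have zero: "S x = 0"
    using rec x by (intro vanish_by_iteration[of S t "2 * d" x]) auto
  have xp: "x * ?p \<in> adm" by (rule adm_mult_qv[OF x])
  have T: "ord_ge (int r) (?W x r * ?p ^ m * f i (x * ?p ^ (2 * r)))" if "x \<in> adm" "i \<le> Suc k" for x r m i
    by (intro ord_ge_mult_right wt pw fo adm_mult_qv_power that)
  have L: "(\<lambda>r. ?W x r * ?p ^ (m * r) * f i (x * ?p ^ (2 * r))) summable_on UNIV" if "x \<in> adm" "i \<le> Suc k" for x m i
    by (intro summable_nat_flsI T that)
  let ?u = "\<lambda>r. ?W x r * ?p ^ ((Suc k - j) * r) * f j (x * ?p ^ (2 * r))"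
  let ?v = "\<lambda>r. (x * ?p) ^ j * ?c x * (?W (x * ?p) r * ?p ^ ((Suc k - c) * r) * f c (x * ?p * ?p ^ (2 * r)))"
  have jc: "j \<le> Suc k" "c \<le> Suc k" using k by auto
  have u: "?u summable_on UNIV" by (intro L x jc)
  have v: "?v summable_on UNIV" by (intro summable_on_cmult_right L xp jc)
  have e: "Suc k - Suc j = c" "(Suc k - j) * r = c * r + r" "Suc k - c = Suc j" for r
    using k by (auto simp: algebra_simps)
  have "?W x r * ?p ^ ((Suc k - Suc j) * r) * f (Suc j) (x * ?p ^ (2 * r)) = (?u r + ?v r) + D x r" for r
    unfolding D_def e power_add by (simp add: algebra_simps)
  then have "lower d k f (Suc j) x = infsum (\<lambda>r. (?u r + ?v r) + D x r) UNIV"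
    unfolding lower_def by (intro infsum_cong)
  also have "\<dots> = (infsum ?u UNIV + infsum ?v UNIV) + S x"
    unfolding S_def infsum_add[OF u v, symmetric]
    by (rule infsum_add[OF summable_on_add[OF u v] summable_nat_flsI[OF D_ord[OF x]]])
  also have "infsum ?v UNIV = (x * ?p) ^ j * ?c x * lower d k f c (x * ?p)"
    unfolding lower_def by (intro infsum_cmult_right L xp jc)
  finally show ?thesis unfolding zero lower_def[symmetric] by simp
qed

text \<open>
  The defect vanishes also for \<open>i = k + 1\<close>, where the last term contains \<open>f 0 = 0\<close>. This is the
  second claim: the two largest indices give the same sum.
\<close>

lemma lower_gordon_system:
  assumes f: "gordon_system d (Suc k) f" and d: "d > 0" and k: "k > 0"
  shows "gordon_system d k (lower d k f)"
    and "x \<in> adm \<Longrightarrow> lower d k f (Suc k) x = lower d k f k x"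
proof -
  have zero: "lower d k f 0 x = 0" if "x \<in> adm" for x
    using gordon_systemD(1)[OF f adm_mult_qv_power[OF that]] by (simp add: lower_def)
  show "lower d k f (Suc k) x = lower d k f k x" if "x \<in> adm"
    using lower_defect[OF f d _ k that, of k 0] zero[OF adm_mult_qv[OF that, of d]] by simp
  show "gordon_system d k (lower d k f)"
    unfolding gordon_system_def
  proof (intro ballI conjI allI impI)
    fix x assume x: "x \<in> adm"
    show "lower d k f 0 x = 0" by (rule zero[OF x])
    fix i assume i: "i \<in> {1..k}"
    then obtain j where j: "i = Suc j" by (cases i) auto
    with i obtain c where c: "k = j + c" by (auto simp: le_iff_add)
    show "lower d k f i x = lower d k f (i - 1) x +
        (x * qv ^ d) ^ (i - 1) * gordon_factor d x * lower d k f (Suc k - i) (x * qv ^ d)"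
      using lower_defect[OF f d c k x] c j by simp
    fix N assume N: "ord_ge N x"
    have fo: "ord_ge 0 (f i (x * (qv ^ d) ^ m))" for m
      using i by (intro gordon_system_ord_ge[OF f] adm_mult_qv_power x) auto
    show "ord_ge N (lower d k f i x - 1)"
      unfolding lower_def
    proof (rule infsum_near_1)
      show "ord_ge (int r) (lower_weight d k x r * (qv ^ d) ^ ((Suc k - i) * r) * f i (x * (qv ^ d) ^ (2 * r)))" for r
        by (intro ord_ge_mult_right ord_ge_weights(2) x d k ord_ge_power_0 ord_ge_qv fo)
      show "ord_ge N (lower_weight d k x 0 * (qv ^ d) ^ ((Suc k - i) * 0) * f i (x * (qv ^ d) ^ (2 * 0)) - 1)"
        using gordon_systemD(3)[OF f x _ _ N, of i] i by simp
      show "ord_ge N (lower_weight d k x (Suc r) * (qv ^ d) ^ ((Suc k - i) * Suc r) * f i (x * (qv ^ d) ^ (2 * Suc r)))" for r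
        by (intro ord_ge_mult_right ord_ge_weights(4) x d k N ord_ge_power_0 ord_ge_qv fo) simp
    qed
  qed
qed

section \<open>Contiguous relations for the single sums\<close>

lemma infsum_diff_cmult:
  fixes f g :: "nat \<Rightarrow> series"
  assumes f: "\<And>n. ord_ge (int n) (f n)" and g: "\<And>n. ord_ge (int n) (g n)"
  shows "infsum (\<lambda>n. f n - c * g n) UNIV = infsum f UNIV - c * infsum g UNIV"
proof -
  have F: "f summable_on UNIV" and G: "g summable_on UNIV"
    using f g by (auto intro!: summable_nat_flsI)
  have "infsum (\<lambda>n. f n + (- c) * g n) UNIV = infsum f UNIV + (- c) * infsum g UNIV"
    unfolding infsum_cmult_right[OF G, symmetric]
    by (intro infsum_add F summable_on_cmult_right G)
  then show ?thesis by simp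
qed

text \<open>
  The shape of the contiguous relations that come from the factor \<open>1 - q\<^sup>n\<close> of \<open>(q; q)\<^sub>n\<close>.
\<close>

lemma infsum_shift_relation:
  fixes f g h :: "nat \<Rightarrow> series"
  assumes f: "\<And>n. ord_ge (int n) (f n)" and g: "\<And>n. ord_ge (int n) (g n)" and h: "\<And>n. ord_ge (int n) (h n)"
    and z: "f 0 = g 0" and eq: "\<And>n. f (Suc n) - g (Suc n) = c * h n"
  shows "infsum f UNIV - infsum g UNIV = c * infsum h UNIV"
proof -
  have F: "f summable_on UNIV" and G: "g summable_on UNIV" and H: "h summable_on UNIV"
    using f g h by (auto intro!: summable_nat_flsI)
  have "infsum f UNIV - infsum g UNIV = infsum (\<lambda>n. f n - 1 * g n) UNIV"
    using infsum_diff_cmult[OF f g, of 1] by simp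
  also have "\<dots> = infsum (\<lambda>n. f (Suc n) - 1 * g (Suc n)) UNIV"
    using z by (intro infsum_shift) (auto intro!: ord_ge_diff f g)
  also have "\<dots> = c * infsum h UNIV"
    using eq infsum_cmult_right[OF H, of c] by simp
  finally show ?thesis .
qed

lemma qpoch_near_1:
  assumes "ord_ge N y" "ord_ge 0 y" "ord_ge 0 p"
  shows "ord_ge N (qpoch y p n - 1)"
proof (induction n)
  case (Suc n)
  have "ord_ge 0 (qpoch y p n)"
    unfolding qpoch_def using assms
    by (intro ord_ge_prod ord_ge_diff ord_ge_1 ord_ge_mult_right ord_ge_power_0)
  then have "ord_ge N (qpoch y p n * (y * p ^ n))"
    using assms by (intro ord_ge_mult_left ord_ge_mult_right ord_ge_power_0)
  then have "ord_ge N ((qpoch y p n - 1) - qpoch y p n * (y * p ^ n))"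
    by (rule ord_ge_diff[OF Suc])
  then show ?case by (simp add: qpoch_Suc algebra_simps)
qed simp

lemma inverse_near_1:
  assumes "unit_series z" "ord_ge N (z - 1)"
  shows "ord_ge N (1 / z - 1)"
proof -
  have "1 / z - 1 = - (z - 1) / z" using unit_series_nonzero[OF assms(1)] by (simp add: field_simps)
  then show ?thesis using assms by (simp only: ord_ge_divide ord_ge_uminus)
qed

lemma square_ge_self: "n \<le> n * n + (m::nat)"
  by (cases n) auto

lemma ord_ge_qpoch_inverse:
  assumes "x \<in> adm" shows "ord_ge 0 (1 / (qpoch x (qv ^ d) m * qpoch qv qv n))"
  by (intro unit_series_ord_ge unit_series_inverse unit_series_mult unit_qpoch_adm unit_qpoch_qv1 assms)

lemma cancel_one_minus_qv_Suc:
  "1 / (A * qpoch qv qv (Suc n)) * (1 - qv ^ Suc n) = 1 / (A * qpoch qv qv n)"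
proof -
  have "1 - qv ^ Suc n \<noteq> 0" by (intro unit_series_nonzero unit_one_minus_qv_power) simp
  then show ?thesis by (simp add: qpoch_Suc)
qed

subsection \<open>The case \<open>d = 2\<close>\<close>

text \<open>
  With \<open>t = 0\<close> and \<open>t = 1\<close> the sums of this form include those for \<open>k = 3\<close> and \<open>k = 2\<close>, respectively.
  The parameter \<open>c\<close> changes the linear exponent and \<open>e\<close> the length of the denominator.
\<close>

definition S2_term :: "nat \<Rightarrow> nat \<Rightarrow> nat \<Rightarrow> series \<Rightarrow> nat \<Rightarrow> series" where
  "S2_term t c e x n = x ^ n * qv ^ (n * n + t * (n choose 2) + c * n) *
     (1 / (qpoch (x * qv) (qv ^ 2) (n + e) * qpoch qv qv n))"

definition S2 :: "nat \<Rightarrow> nat \<Rightarrow> nat \<Rightarrow> series \<Rightarrow> series" where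
  "S2 t c e x = infsum (S2_term t c e x) UNIV"

lemma adm_mult_qv1: "x \<in> adm \<Longrightarrow> x * qv \<in> adm"
  using adm_mult_qv[of x 1] by simp

lemma ord_ge_S2_term: "x \<in> adm \<Longrightarrow> ord_ge (int n) (S2_term t c e x n)"
  unfolding S2_term_def
  by (intro ord_ge_term ord_ge_qpoch_inverse adm_mult_qv1) (auto simp: add.assoc square_ge_self)

text \<open>
  The last factor of the longer denominator is multiplied back.
\<close>

lemma S2_extend:
  assumes x: "x \<in> adm"
  shows "S2 t c e x = S2 t c (Suc e) x - x * qv ^ (2 * e + 1) * S2 t (c + 2) (Suc e) x"
proof -
  have "S2_term t c e x n = S2_term t c (Suc e) x n - x * qv ^ (2 * e + 1) * S2_term t (c + 2) (Suc e) x n" for n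
  proof -
    let ?u = "1 - x * qv * (qv ^ 2) ^ (n + e)"
    have u: "?u \<noteq> 0" by (intro unit_series_nonzero unit_one_minus_adm adm_mult_qv_power adm_mult_qv1 x)
    have D: "1 / (qpoch (x * qv) (qv ^ 2) (n + Suc e) * qpoch qv qv n) * ?u =
        1 / (qpoch (x * qv) (qv ^ 2) (n + e) * qpoch qv qv n)"
      using u by (simp add: qpoch_Suc)
    have "qv * (qv ^ 2) ^ (n + e) = qv ^ Suc (2 * (n + e))"
      by (simp only: power_mult[symmetric] power_Suc)
    also have "Suc (2 * (n + e)) = (2 * e + 1) + 2 * n" by simp
    finally have e: "qv * (qv ^ 2) ^ (n + e) = qv ^ (2 * e + 1) * qv ^ (2 * n)" by (simp only: power_add)
    have e2: "n * n + t * (n choose 2) + (c + 2) * n = n * n + t * (n choose 2) + c * n + 2 * n"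
      by (simp add: algebra_simps)
    have gen: "X * E * (R * (1 - x * (a * b))) = X * E * R - x * a * (X * (E * b) * R)" for X E R a b :: series
      by (simp add: algebra_simps)
    show ?thesis
      unfolding S2_term_def D[symmetric] e2 power_add[of qv _ "2 * n"] mult.assoc[of x qv] e by (rule gen)
  qed
  then show ?thesis
    unfolding S2_def infsum_diff_cmult[OF ord_ge_S2_term[OF x] ord_ge_S2_term[OF x], symmetric]
    by (intro infsum_cong)
qed

lemma S2_shift:
  assumes x: "x \<in> adm"
  shows "S2 t c e x - S2 t (c + 1) e x = x * qv ^ (c + 1) * S2 t (c + 2 + t) (Suc e) x"
  unfolding S2_def
proof (rule infsum_shift_relation)
  show "S2_term t c e x 0 = S2_term t (c + 1) e x 0" by (simp add: S2_term_def)
  fix n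
  let ?u = "1 - qv ^ Suc n"
  have gen: "X * A * R - X * (A * b) * R = X * A * (R * (1 - b))" for X A R b :: series
    by (simp add: algebra_simps)
  have E: "Suc n * Suc n + t * (Suc n choose 2) + c * Suc n = n * n + t * (n choose 2) + (c + 2 + t) * n + (c + 1)"
    "Suc n * Suc n + t * (Suc n choose 2) + (c + 1) * Suc n = n * n + t * (n choose 2) + (c + 2 + t) * n + (c + 1) + Suc n"
    by (simp_all add: numeral_2_eq_2 algebra_simps)
  have i: "Suc n + e = n + Suc e" by simp
  have "S2_term t c e x (Suc n) - S2_term t (c + 1) e x (Suc n) =
      x ^ Suc n * (qv ^ (n * n + t * (n choose 2) + (c + 2 + t) * n) * qv ^ (c + 1)) *
      (1 / (qpoch (x * qv) (qv ^ 2) (n + Suc e) * qpoch qv qv (Suc n)) * ?u)"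
    unfolding S2_term_def E i power_add[of qv _ "Suc n"] power_add[of qv _ "c + 1"] by (rule gen)
  also have "\<dots> = x * qv ^ (c + 1) * S2_term t (c + 2 + t) (Suc e) x n"
    unfolding cancel_one_minus_qv_Suc S2_term_def by (simp only: power_Suc mult_ac)
  finally show "S2_term t c e x (Suc n) - S2_term t (c + 1) e x (Suc n) =
      x * qv ^ (c + 1) * S2_term t (c + 2 + t) (Suc e) x n" .
qed (intro ord_ge_S2_term x)+

text \<open>
  The family is stable under \<open>x \<mapsto> x q\<^sup>2\<close>, so the equations of the system become linear relations
  between members of the family at one argument.
\<close>

lemma S2_argument:
  assumes x: "x \<in> adm"
  shows "gordon_factor 2 x * S2 t c e (x * qv ^ 2) = S2 t (c + 2) (Suc e) x"
proof -
  have xq: "x * qv ^ 2 \<in> adm" by (rule adm_mult_qv[OF x])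
  have "gordon_factor 2 x * S2_term t c e (x * qv ^ 2) n = S2_term t (c + 2) (Suc e) x n" for n
  proof -
    have Q: "qpoch (x * qv) (qv ^ 2) (n + Suc e) = (1 - x * qv) * qpoch (x * qv ^ 2 * qv) (qv ^ 2) (n + e)"
      unfolding add_Suc_right qpoch_Suc_left by (simp only: mult_ac)
    have g: "gordon_factor 2 x = 1 / (1 - x * qv)" by (simp add: gordon_factor_def qpoch_def)
    have E: "(x * qv ^ 2) ^ n * qv ^ (n * n + t * (n choose 2) + c * n) =
        x ^ n * qv ^ (n * n + t * (n choose 2) + (c + 2) * n)"
    proof -
      have e: "n * n + t * (n choose 2) + (c + 2) * n = 2 * n + (n * n + t * (n choose 2) + c * n)"
        by (simp add: algebra_simps)
      show ?thesis unfolding e power_mult_distrib power_add[of qv "2 * n"] power_mult[of qv 2 n]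
        by (simp only: mult_ac)
    qed
    show ?thesis unfolding S2_term_def Q g E by simp
  qed
  then show ?thesis
    unfolding S2_def by (subst infsum_cmult_right[symmetric])
      (auto intro: summable_nat_flsI ord_ge_S2_term xq)
qed

lemma S2_near_1:
  assumes x: "x \<in> adm" and N: "ord_ge N x"
  shows "ord_ge N (S2 t c e x - 1)"
  unfolding S2_def
proof (rule infsum_near_1)
  show "ord_ge (int n) (S2_term t c e x n)" for n by (rule ord_ge_S2_term[OF x])
  have "ord_ge N (qpoch (x * qv) (qv ^ 2) e - 1)"
    by (intro qpoch_near_1 ord_ge_mult_right N ord_ge_qv ord_ge_power_0 ord_ge_adm adm_mult_qv1 x)
  then show "ord_ge N (S2_term t c e x 0 - 1)"
    using inverse_near_1[OF unit_qpoch_adm[OF adm_mult_qv1[OF x]]]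
    by (simp add: S2_term_def binomial_eq_0)
  show "ord_ge N (S2_term t c e x (Suc n))" for n
    unfolding S2_term_def by (intro ord_ge_term_pos ord_ge_qpoch_inverse adm_mult_qv1 x N) simp
qed

definition F22_fun :: "nat \<Rightarrow> series \<Rightarrow> series" where
  "F22_fun i x = (if i = 0 then 0 else if i = 1 then S2 1 2 1 x else S2 1 0 0 x)"

definition F23_fun :: "nat \<Rightarrow> series \<Rightarrow> series" where
  "F23_fun i x = (if i = 0 then 0 else if i = 1 then S2 0 2 1 x else if i = 2 then S2 0 1 1 x else S2 0 0 0 x)"

lemma F22_gordon_system: "gordon_system 2 2 F22_fun"
  unfolding gordon_system_def
proof (intro ballI conjI allI impI)
  fix x assume x: "x \<in> adm"
  show "F22_fun 0 x = 0" by (simp add: F22_fun_def)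
  let ?S = "\<lambda>c e. S2 1 c e x"
  have ext: "?S c e = ?S c (Suc e) - x * qv ^ (2 * e + 1) * ?S (c + 2) (Suc e)" for c e
    by (rule S2_extend[OF x])
  have sh: "?S c e - ?S (c + 1) e = x * qv ^ (c + 1) * ?S (c + 3) (Suc e)" for c e
    using S2_shift[OF x, of 1 c e] by (simp add: numeral_3_eq_3)
  have a: "?S 2 1 - ?S 3 1 = x * qv ^ 3 * ?S 5 2" using sh[of 2 1] by (simp add: eval_nat_numeral)
  have b: "?S 2 1 = ?S 2 2 - x * qv ^ 3 * ?S 4 2" using ext[of 2 1] by (simp add: eval_nat_numeral)
  have c: "?S 3 1 = ?S 3 2 - x * qv ^ 3 * ?S 5 2" using ext[of 3 1] by (simp add: eval_nat_numeral)
  \<comment> \<open>At this index the exponent of the shift relation equals that of the extension relation, so that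
    two terms cancel.\<close>
  have bal: "?S 2 1 = ?S 3 2" using a c by algebra
  have d: "?S 0 1 - ?S 1 1 = x * qv * ?S 3 2" using sh[of 0 1] by (simp add: eval_nat_numeral)
  have e: "?S 1 1 - ?S 2 1 = x * qv ^ 2 * ?S 4 2" using sh[of 1 1] by (simp add: eval_nat_numeral)
  have f: "?S 0 0 = ?S 0 1 - x * qv * ?S 2 1" using ext[of 0 0] by (simp add: eval_nat_numeral)
  have top: "?S 0 0 = ?S 2 1 + x * qv ^ 2 * ?S 4 2"
    using d e f bal by algebra
  fix i :: nat assume "i \<in> {1..2}"
  then have i: "i = 1 \<or> i = 2" by auto
  have arg: "gordon_factor 2 x * S2 1 c e (x * qv ^ 2) = ?S (c + 2) (Suc e)" for c e
    by (rule S2_argument[OF x])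
  show "F22_fun i x = F22_fun (i - 1) x +
      (x * qv ^ 2) ^ (i - 1) * gordon_factor 2 x * F22_fun (Suc 2 - i) (x * qv ^ 2)"
    using i top arg[of 0 0] arg[of 2 1]
    by (auto simp: F22_fun_def mult.assoc eval_nat_numeral)
  fix N assume N: "ord_ge N x"
  show "ord_ge N (F22_fun i x - 1)"
    using i by (auto simp: F22_fun_def intro!: S2_near_1 x N)
qed

lemma F23_gordon_system: "gordon_system 2 3 F23_fun"
  unfolding gordon_system_def
proof (intro ballI conjI allI impI)
  fix x assume x: "x \<in> adm"
  show "F23_fun 0 x = 0" by (simp add: F23_fun_def)
  let ?S = "\<lambda>c e. S2 0 c e x"
  have ext: "?S c e = ?S c (Suc e) - x * qv ^ (2 * e + 1) * ?S (c + 2) (Suc e)" for c e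
    by (rule S2_extend[OF x])
  have sh: "?S c e - ?S (c + 1) e = x * qv ^ (c + 1) * ?S (c + 2) (Suc e)" for c e
    using S2_shift[OF x, of 0 c e] by simp
  have a: "?S 1 1 - ?S 2 1 = x * qv ^ 2 * ?S 3 2" using sh[of 1 1] by (simp add: eval_nat_numeral)
  have mid: "?S 1 1 = ?S 2 1 + x * qv ^ 2 * ?S 3 2" using a by algebra
  have b: "?S 0 1 - ?S 1 1 = x * qv * ?S 2 2" using sh[of 0 1] by (simp add: eval_nat_numeral)
  have c: "?S 0 0 = ?S 0 1 - x * qv * ?S 2 1" using ext[of 0 0] by (simp add: eval_nat_numeral)
  have d: "?S 2 1 = ?S 2 2 - x * qv ^ 3 * ?S 4 2" using ext[of 2 1] by (simp add: eval_nat_numeral)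
  have top: "?S 0 0 = ?S 1 1 + (x * qv ^ 2) ^ 2 * ?S 4 2" using b c d by algebra
  fix i :: nat assume "i \<in> {1..3}"
  then have i: "i = 1 \<or> i = 2 \<or> i = 3" by auto
  have arg: "gordon_factor 2 x * S2 0 c e (x * qv ^ 2) = ?S (c + 2) (Suc e)" for c e
    by (rule S2_argument[OF x])
  show "F23_fun i x = F23_fun (i - 1) x +
      (x * qv ^ 2) ^ (i - 1) * gordon_factor 2 x * F23_fun (Suc 3 - i) (x * qv ^ 2)"
    using i top mid arg[of 0 0] arg[of 2 1] arg[of 1 1]
    by (auto simp: F23_fun_def mult.assoc eval_nat_numeral)
  fix N assume N: "ord_ge N x"
  show "ord_ge N (F23_fun i x - 1)"
    using i by (auto simp: F23_fun_def intro!: S2_near_1 x N)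
qed

subsection \<open>The case \<open>d = 3\<close>\<close>

text \<open>
  The numerator \<open>(x; q\<^sup>3)\<^sub>n\<close> starts with \<open>1 - x\<close>, as in the sum for \<open>i = 4\<close>. In this form the family is
  stable under the argument shift up to the combination introduced below.
\<close>

definition S3_term :: "nat \<Rightarrow> nat \<Rightarrow> series \<Rightarrow> nat \<Rightarrow> series" where
  "S3_term c e x n = x ^ n * qv ^ (n * n + c * n) *
     (qpoch x (qv ^ 3) n * (1 / (qpoch x qv (2 * n + e) * qpoch qv qv n)))"

definition S3 :: "nat \<Rightarrow> nat \<Rightarrow> series \<Rightarrow> series" where
  "S3 c e x = infsum (S3_term c e x) UNIV"

lemma ord_ge_S3_factor:
  "x \<in> adm \<Longrightarrow> ord_ge 0 (qpoch x (qv ^ 3) n * (1 / (qpoch x qv m * qpoch qv qv n)))"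
  by (intro unit_series_ord_ge unit_series_mult unit_series_inverse unit_qpoch_adm unit_qpoch_adm_qv unit_qpoch_qv1)

lemma ord_ge_S3_term: "x \<in> adm \<Longrightarrow> ord_ge (int n) (S3_term c e x n)"
  unfolding S3_term_def by (intro ord_ge_term ord_ge_S3_factor) (auto simp: square_ge_self)

lemma S3_extend:
  assumes x: "x \<in> adm"
  shows "S3 c e x = S3 c (Suc e) x - x * qv ^ e * S3 (c + 2) (Suc e) x"
proof -
  have "S3_term c e x n = S3_term c (Suc e) x n - x * qv ^ e * S3_term (c + 2) (Suc e) x n" for n
  proof -
    let ?u = "1 - x * qv ^ (2 * n + e)"
    have u: "?u \<noteq> 0" by (intro unit_series_nonzero unit_one_minus_adm adm_mult_qv x)
    have D: "1 / (qpoch x qv (2 * n + Suc e) * qpoch qv qv n) * ?u =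
        1 / (qpoch x qv (2 * n + e) * qpoch qv qv n)"
      using u by (simp add: qpoch_Suc)
    have e2: "n * n + (c + 2) * n = n * n + c * n + 2 * n"
      by (simp add: algebra_simps)
    have gen: "X * E * (P * (R * (1 - x * (b * a)))) = X * E * (P * R) - x * a * (X * (E * b) * (P * R))"
      for X E P R a b :: series by (simp add: algebra_simps)
    show ?thesis
      unfolding S3_term_def D[symmetric] e2 power_add[of qv _ "2 * n"] power_add[of qv "2 * n" e] by (rule gen)
  qed
  then show ?thesis
    unfolding S3_def infsum_diff_cmult[OF ord_ge_S3_term[OF x] ord_ge_S3_term[OF x], symmetric]
    by (intro infsum_cong)
qed

text \<open>
  The same sums with the numerator \<open>(x; q\<^sup>3)\<^bsub>n+1\<^esub>\<close>. After cancellation of \<open>1 - x\<close> they include the sums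
  for \<open>i = 1, 2, 3\<close>.
\<close>

definition S3' :: "nat \<Rightarrow> nat \<Rightarrow> series \<Rightarrow> series" where
  "S3' c e x = S3 c e x - x * S3 (c + 3) e x"

lemma S3'_eq:
  assumes x: "x \<in> adm"
  shows "S3' c e x = (\<Sum>\<^sub>\<infinity>n. S3_term c e x n * (1 - x * (qv ^ 3) ^ n))"
proof -
  have "S3_term c e x n * (1 - x * (qv ^ 3) ^ n) = S3_term c e x n - x * S3_term (c + 3) e x n" for n
  proof -
    have e2: "n * n + (c + 3) * n = n * n + c * n + 3 * n" by (simp add: algebra_simps)
    have gen: "X * E * R * (1 - x * b) = X * E * R - x * (X * (E * b) * R)" for X E R b :: series
      by (simp add: algebra_simps)
    show ?thesis unfolding S3_term_def e2 power_add[of qv _ "3 * n"] power_mult[of qv 3 n] by (rule gen)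
  qed
  then show ?thesis
    unfolding S3'_def S3_def infsum_diff_cmult[OF ord_ge_S3_term[OF x] ord_ge_S3_term[OF x], symmetric]
    by (intro infsum_cong) simp
qed

lemma ord_ge_S3'_term: "x \<in> adm \<Longrightarrow> ord_ge (int n) (S3_term c e x n * (1 - x * (qv ^ 3) ^ n))"
  by (intro ord_ge_mult_right ord_ge_S3_term unit_series_ord_ge unit_one_minus_adm adm_mult_qv_power)

lemma S3_shift:
  assumes x: "x \<in> adm"
  shows "S3 c e x - S3 (c + 1) e x = x * qv ^ (c + 1) * S3' (c + 2) (e + 2) x"
  unfolding S3'_eq[OF x] S3_def
proof (rule infsum_shift_relation)
  show "S3_term c e x 0 = S3_term (c + 1) e x 0" by (simp add: S3_term_def)
  fix n
  let ?u = "1 - qv ^ Suc n"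
  have gen: "X * A * R - X * (A * b) * R = X * A * (R * (1 - b))" for X A R b :: series
    by (simp add: algebra_simps)
  have E: "Suc n * Suc n + c * Suc n = n * n + (c + 2) * n + (c + 1)"
    "Suc n * Suc n + (c + 1) * Suc n = n * n + (c + 2) * n + (c + 1) + Suc n"
    by (simp_all add: algebra_simps)
  have i: "2 * Suc n + e = 2 * n + (e + 2)" by simp
  have "S3_term c e x (Suc n) - S3_term (c + 1) e x (Suc n) =
      x ^ Suc n * (qv ^ (n * n + (c + 2) * n) * qv ^ (c + 1)) * ((qpoch x (qv ^ 3) (Suc n) *
      (1 / (qpoch x qv (2 * n + (e + 2)) * qpoch qv qv (Suc n)))) * ?u)"
    unfolding S3_term_def E i power_add[of qv _ "Suc n"] power_add[of qv _ "c + 1"] by (rule gen)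
  also have "\<dots> = x ^ Suc n * (qv ^ (n * n + (c + 2) * n) * qv ^ (c + 1)) * (qpoch x (qv ^ 3) (Suc n) *
      (1 / (qpoch x qv (2 * n + (e + 2)) * qpoch qv qv (Suc n)) * ?u))"
    by (simp only: mult.assoc)
  also have "\<dots> = x * qv ^ (c + 1) * (S3_term (c + 2) (e + 2) x n * (1 - x * (qv ^ 3) ^ n))"
    unfolding cancel_one_minus_qv_Suc S3_term_def by (simp only: qpoch_Suc[of x "qv ^ 3"] power_Suc mult_ac)
  finally show "S3_term c e x (Suc n) - S3_term (c + 1) e x (Suc n) =
      x * qv ^ (c + 1) * (S3_term (c + 2) (e + 2) x n * (1 - x * (qv ^ 3) ^ n))" .
qed (intro ord_ge_S3_term ord_ge_S3'_term x)+

text \<open>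
  The shift relation holds for the combination because it holds for both of its constituents.
\<close>

lemma S3'_shift:
  assumes x: "x \<in> adm"
  shows "S3' c e x - S3' (c + 1) e x =
    x * qv ^ (c + 1) * (S3' (c + 2) (e + 2) x - x * qv ^ 3 * S3' (c + 5) (e + 2) x)"
proof -
  have "S3' c e x - S3' (c + 1) e x = (S3 c e x - S3 (c + 1) e x) - x * (S3 (c + 3) e x - S3 (c + 3 + 1) e x)"
    by (simp add: S3'_def algebra_simps)
  then show ?thesis unfolding S3_shift[OF x] by (simp add: algebra_simps power_add)
      (simp add: eval_nat_numeral algebra_simps)
qed

lemma gordon_factor_3: "gordon_factor 3 x = 1 / ((1 - x * qv) * (1 - x * qv ^ 2))"
  by (simp add: gordon_factor_def qpoch_def numeral_2_eq_2 mult.assoc)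

lemma S3_argument:
  assumes x: "x \<in> adm"
  shows "gordon_factor 3 x * S3 c e (x * qv ^ 3) = S3' (c + 3) (e + 3) x"
proof -
  have xq: "x * qv ^ 3 \<in> adm" by (rule adm_mult_qv[OF x])
  have nz: "1 - x \<noteq> 0" "qpoch x qv 3 \<noteq> 0"
    by (intro unit_series_nonzero unit_one_minus_adm unit_qpoch_adm_qv x)+
  have "gordon_factor 3 x * S3_term c e (x * qv ^ 3) n = S3_term (c + 3) (e + 3) x n * (1 - x * (qv ^ 3) ^ n)" for n
  proof -
    have i: "2 * n + (e + 3) = 3 + (2 * n + e)" by simp
    have q3: "qpoch x qv 3 = (1 - x) * ((1 - x * qv) * (1 - x * qv ^ 2))"
      by (simp add: qpoch_def eval_nat_numeral mult_ac)
    have P: "qpoch x (qv ^ 3) n * (1 - x * (qv ^ 3) ^ n) = (1 - x) * qpoch (x * qv ^ 3) (qv ^ 3) n"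
      unfolding qpoch_Suc[symmetric] by (rule qpoch_Suc_left)
    have E: "(x * qv ^ 3) ^ n * qv ^ (n * n + c * n) = x ^ n * qv ^ (n * n + (c + 3) * n)"
    proof -
      have e: "n * n + (c + 3) * n = 3 * n + (n * n + c * n)" by (simp add: algebra_simps)
      show ?thesis unfolding e power_mult_distrib power_add[of qv "3 * n"] power_mult[of qv 3 n]
        by (simp only: mult_ac)
    qed
    have D: "(1 - x) * (1 / (qpoch x qv (2 * n + (e + 3)) * qpoch qv qv n)) =
        gordon_factor 3 x * (1 / (qpoch (x * qv ^ 3) qv (2 * n + e) * qpoch qv qv n))"
      unfolding i qpoch_add q3 gordon_factor_3 using nz(1) by simp
    have "S3_term (c + 3) (e + 3) x n * (1 - x * (qv ^ 3) ^ n) = x ^ n * qv ^ (n * n + (c + 3) * n) *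
        ((qpoch x (qv ^ 3) n * (1 - x * (qv ^ 3) ^ n)) * (1 / (qpoch x qv (2 * n + (e + 3)) * qpoch qv qv n)))"
      unfolding S3_term_def by (simp only: mult_ac)
    also have "\<dots> = x ^ n * qv ^ (n * n + (c + 3) * n) * (qpoch (x * qv ^ 3) (qv ^ 3) n *
        ((1 - x) * (1 / (qpoch x qv (2 * n + (e + 3)) * qpoch qv qv n))))"
      unfolding P by (simp only: mult_ac)
    also have "\<dots> = gordon_factor 3 x * S3_term c e (x * qv ^ 3) n"
      unfolding D S3_term_def E by (simp only: mult_ac)
    finally show ?thesis by simp
  qed
  then show ?thesis
    unfolding S3'_eq[OF x] S3_def by (subst infsum_cmult_right[symmetric])
      (auto intro: summable_nat_flsI ord_ge_S3_term xq)
qed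

lemma S3'_argument:
  assumes x: "x \<in> adm"
  shows "gordon_factor 3 x * S3' c e (x * qv ^ 3) = S3' (c + 3) (e + 3) x - x * qv ^ 3 * S3' (c + 6) (e + 3) x"
proof -
  have "gordon_factor 3 x * S3' c e (x * qv ^ 3) = gordon_factor 3 x * S3 c e (x * qv ^ 3) -
      x * qv ^ 3 * (gordon_factor 3 x * S3 (c + 3) e (x * qv ^ 3))"
    by (simp add: S3'_def algebra_simps)
  then show ?thesis unfolding S3_argument[OF x] by (simp add: add.assoc)
qed

lemma S3_near_1:
  assumes x: "x \<in> adm" and N: "ord_ge N x"
  shows "ord_ge N (S3 c e x - 1)"
  unfolding S3_def
proof (rule infsum_near_1)
  show "ord_ge (int n) (S3_term c e x n)" for n by (rule ord_ge_S3_term[OF x])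
  have "ord_ge N (qpoch x qv e - 1)"
    by (intro qpoch_near_1 N ord_ge_qv ord_ge_adm x)
  then show "ord_ge N (S3_term c e x 0 - 1)"
    using inverse_near_1[OF unit_qpoch_adm_qv[OF x]] by (simp add: S3_term_def)
  show "ord_ge N (S3_term c e x (Suc n))" for n
    unfolding S3_term_def by (intro ord_ge_term_pos ord_ge_S3_factor x N) simp
qed

lemma ord_ge_S3: "x \<in> adm \<Longrightarrow> ord_ge 0 (S3 c e x)"
  unfolding S3_def by (intro ord_ge_infsum ord_ge_mono[OF ord_ge_S3_term]) auto

lemma S3'_near_1:
  assumes x: "x \<in> adm" and N: "ord_ge N x"
  shows "ord_ge N (S3' c e x - 1)"
proof -
  have "S3' c e x - 1 = (S3 c e x - 1) - x * S3 (c + 3) e x" by (simp add: S3'_def)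
  moreover have "ord_ge N \<dots>" by (intro ord_ge_diff S3_near_1 ord_ge_mult_right ord_ge_S3 x N)
  ultimately show ?thesis by (simp only:)
qed

definition F34_fun :: "nat \<Rightarrow> series \<Rightarrow> series" where
  "F34_fun i x = (if i = 0 then 0 else if i = 1 then S3' 3 3 x else if i = 2 then S3' 2 3 x
     else if i = 3 then S3' 1 2 x else S3 0 0 x)"

text \<open>
  The right-hand sides contain members with large indices. Read from right to left, the shift relations
  rewrite them as differences of members with smaller indices, after which the extension relations
  bring everything to a common denominator length.
\<close>

lemma S3_relations:
  assumes x: "x \<in> adm"
  defines "U \<equiv> \<lambda>c e. S3' c e x"
  shows "U 2 3 = U 3 3 + x * qv ^ 3 * (U 4 5 - x * qv ^ 3 * U 7 5)"
    and "U 1 2 = U 2 3 + (x * qv ^ 3) ^ 2 * (U 5 6 - x * qv ^ 3 * U 8 6)"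
    and "S3 0 0 x = U 1 2 + (x * qv ^ 3) ^ 3 * (U 6 6 - x * qv ^ 3 * U 9 6)"
proof -
  define V where "V = (\<lambda>c e. S3 c e x)"
  have U: "U c e = V c e - x * V (c + 3) e" for c e
    by (simp add: U_def V_def S3'_def)
  have ext: "V c e = V c (Suc e) - x * qv ^ e * V (c + 2) (Suc e)" for c e
    unfolding V_def by (rule S3_extend[OF x])
  have sh: "V c e - V (c + 1) e = x * qv ^ (c + 1) * U (c + 2) (e + 2)" for c e
    unfolding V_def U_def by (rule S3_shift[OF x])
  have shU: "U c e - U (c + 1) e = x * qv ^ (c + 1) * (U (c + 2) (e + 2) - x * qv ^ 3 * U (c + 5) (e + 2))" for c e
    unfolding U_def by (rule S3'_shift[OF x])
  have q: "U 2 3 - U 3 3 = x * qv ^ 3 * (U 4 5 - x * qv ^ 3 * U 7 5)"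
    using shU[of 2 3] by (simp add: eval_nat_numeral)
  then show "U 2 3 = U 3 3 + x * qv ^ 3 * (U 4 5 - x * qv ^ 3 * U 7 5)"
    by (simp add: diff_eq_eq add.commute)
  have b0: "V 1 2 - V 2 2 = x * qv ^ 2 * U 3 4" using sh[of 1 2] by (simp add: eval_nat_numeral)
  have b1: "V 2 2 - V 3 2 = x * qv ^ 3 * U 4 4" using sh[of 2 2] by (simp add: eval_nat_numeral)
  have b2: "V 3 2 - V 4 2 = x * qv ^ 4 * U 5 4" using sh[of 3 2] by (simp add: eval_nat_numeral)
  show "S3 0 0 x = U 1 2 + (x * qv ^ 3) ^ 3 * (U 6 6 - x * qv ^ 3 * U 9 6)"
  proof -
    have a: "U 4 4 - U 5 4 = x * qv ^ 5 * (U 6 6 - x * qv ^ 3 * U 9 6)" using shU[of 4 4] by (simp add: eval_nat_numeral)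
    have c: "V 0 0 - V 1 0 = x * qv * (V 2 2 - x * V 5 2)" using sh[of 0 0] by (simp add: U eval_nat_numeral)
    have d1: "V 1 0 = V 1 1 - x * V 3 1" using ext[of 1 0] by (simp add: eval_nat_numeral)
    have d2: "V 1 1 = V 1 2 - x * qv * V 3 2" using ext[of 1 1] by (simp add: eval_nat_numeral)
    have d3: "V 3 1 = V 3 2 - x * qv * V 5 2" using ext[of 3 1] by (simp add: eval_nat_numeral)
    have u: "U 1 2 = V 1 2 - x * V 4 2" using U[of 1 2] by (simp add: eval_nat_numeral)
    have "V 0 0 = U 1 2 + (x * qv ^ 3) ^ 3 * (U 6 6 - x * qv ^ 3 * U 9 6)"
      using a b1 b2 c d1 d2 d3 u by algebra
    then show ?thesis by (simp add: V_def)
  qed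
  show "U 1 2 = U 2 3 + (x * qv ^ 3) ^ 2 * (U 5 6 - x * qv ^ 3 * U 8 6)"
  proof -
    have a: "U 3 4 - U 4 4 = x * qv ^ 4 * (U 5 6 - x * qv ^ 3 * U 8 6)" using shU[of 3 4] by (simp add: eval_nat_numeral)
    have c: "V 2 1 - V 3 1 = x * qv ^ 3 * (V 4 3 - x * V 7 3)" using sh[of 2 1] by (simp add: U eval_nat_numeral)
    have d1: "V 2 1 = V 2 2 - x * qv * V 4 2" using ext[of 2 1] by (simp add: eval_nat_numeral)
    have d2: "V 3 1 = V 3 2 - x * qv * V 5 2" using ext[of 3 1] by (simp add: eval_nat_numeral)
    have d3: "V 2 2 = V 2 3 - x * qv ^ 2 * V 4 3" using ext[of 2 2] by (simp add: eval_nat_numeral)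
    have d4: "V 3 2 = V 3 3 - x * qv ^ 2 * V 5 3" using ext[of 3 2] by (simp add: eval_nat_numeral)
    have d5: "V 4 2 = V 4 3 - x * qv ^ 2 * V 6 3" using ext[of 4 2] by (simp add: eval_nat_numeral)
    have d6: "V 5 2 = V 5 3 - x * qv ^ 2 * V 7 3" using ext[of 5 2] by (simp add: eval_nat_numeral)
    have u1: "U 1 2 = V 1 2 - x * V 4 2" using U[of 1 2] by (simp add: eval_nat_numeral)
    have u2: "U 2 3 = V 2 3 - x * V 5 3" using U[of 2 3] by (simp add: eval_nat_numeral)
    \<comment> \<open>One factor \<open>q\<close> has to be added: the shift relations yield the right-hand side only up to it.\<close>
    have r: "qv * ((x * qv ^ 3) ^ 2 * (U 5 6 - x * qv ^ 3 * U 8 6)) = qv * (V 1 2 - V 2 2) - (V 2 2 - V 3 2)"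
      using a b0 b1 by algebra
    have "(V 2 2 - x * qv * V 4 2) - (V 3 2 - x * qv * V 5 2) = x * qv ^ 3 * (V 4 3 - x * V 7 3)"
      using c unfolding d1 d2 .
    then have "(V 2 3 - x * qv ^ 2 * V 4 3 - x * qv * (V 4 3 - x * qv ^ 2 * V 6 3)) -
       (V 3 3 - x * qv ^ 2 * V 5 3 - x * qv * (V 5 3 - x * qv ^ 2 * V 7 3)) = x * qv ^ 3 * (V 4 3 - x * V 7 3)"
      unfolding d3 d4 d5 d6 .
    then have "qv * (V 1 2 - x * (V 4 3 - x * qv ^ 2 * V 6 3)) = qv * (V 2 3 - x * V 5 3) +
        (qv * (V 1 2 - (V 2 3 - x * qv ^ 2 * V 4 3)) - ((V 2 3 - x * qv ^ 2 * V 4 3) - (V 3 3 - x * qv ^ 2 * V 5 3)))"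
      by algebra
    then have "qv * U 1 2 = qv * U 2 3 + (qv * (V 1 2 - V 2 2) - (V 2 2 - V 3 2))"
      unfolding u1 u2 d3 d4 d5 .
    then have "qv * U 1 2 = qv * (U 2 3 + (x * qv ^ 3) ^ 2 * (U 5 6 - x * qv ^ 3 * U 8 6))"
      unfolding r[symmetric] by (simp add: distrib_left)
    then show ?thesis by simp
  qed
qed

lemma F34_gordon_system: "gordon_system 3 4 F34_fun"
  unfolding gordon_system_def
proof (intro ballI conjI allI impI)
  fix x assume x: "x \<in> adm"
  show "F34_fun 0 x = 0" by (simp add: F34_fun_def)
  fix i :: nat assume "i \<in> {1..4}"
  then have i: "i = 1 \<or> i = 2 \<or> i = 3 \<or> i = 4" by auto
  note arg = S3_argument[OF x, of 0 0] S3'_argument[OF x, of 3 3] S3'_argument[OF x, of 2 3] S3'_argument[OF x, of 1 2]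
  show "F34_fun i x = F34_fun (i - 1) x +
      (x * qv ^ 3) ^ (i - 1) * gordon_factor 3 x * F34_fun (Suc 4 - i) (x * qv ^ 3)"
    using i S3_relations[OF x] arg by (auto simp: F34_fun_def mult.assoc)
  fix N assume N: "ord_ge N x"
  show "ord_ge N (F34_fun i x - 1)"
    using i by (auto simp: F34_fun_def intro!: S3_near_1 S3'_near_1 x N)
qed

section \<open>Double sums as weighted sums of single sums\<close>

text \<open>
  The summands vanish below the line \<open>n = s r\<close>, so that on their support the order \<open>n\<close> bounds both
  indices and the family is summable. The substitution \<open>n = m + s r\<close> then uncovers the inner single
  sum.
\<close>

lemma infsum_pairs_by_columns:
  fixes g :: "nat \<Rightarrow> nat \<Rightarrow> series"
  assumes s: "s > 0" and zero: "\<And>n r. n < s * r \<Longrightarrow> g n r = 0"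
    and ord: "\<And>n r. ord_ge (int n) (g n r)"
  shows "(\<Sum>\<^sub>\<infinity>(n, r). g n r) = (\<Sum>\<^sub>\<infinity>r. \<Sum>\<^sub>\<infinity>m. g (m + s * r) r)"
proof -
  let ?G = "\<lambda>(n, r). g n r"
  have "?G summable_on UNIV"
  proof (rule summable_on_flsI)
    show "ord_ge 0 (?G z)" for z by (cases z) (use ord_ge_mono[OF ord] in simp)
    fix N :: nat
    have "z \<in> {..<N} \<times> {..<N}" if z: "\<not> ord_ge (int N) (?G z)" for z
    proof -
      obtain n r where nr: "z = (n, r)" by fastforce
      have "g n r \<noteq> 0" using z nr by auto
      then have "s * r \<le> n" using zero[of n r] by (meson not_le)
      moreover have "1 * r \<le> s * r" using s by (intro mult_le_mono1) simp
      ultimately have "r \<le> n" by linarith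
      moreover have "n < N"
      proof (rule ccontr)
        assume "\<not> n < N"
        then have "ord_ge (int N) (g n r)" by (intro ord_ge_mono[OF ord]) simp
        then show False using z nr by simp
      qed
      ultimately show ?thesis by (simp add: nr)
    qed
    then have "{z \<in> UNIV. \<not> ord_ge (int N) (?G z)} \<subseteq> {..<N} \<times> {..<N}" by blast
    then show "finite {z \<in> UNIV. \<not> ord_ge (int N) (?G z)}" by (rule finite_subset) simp
  qed
  then have G: "(?G has_sum infsum ?G UNIV) UNIV" by simp
  let ?h = "\<lambda>(r, m). (m + s * r, r)"
  have "(?G has_sum infsum ?G UNIV) (range ?h)"
  proof (rule iffD1[OF has_sum_cong_neutral G])
    fix z assume "z \<in> UNIV - range ?h"
    obtain n r where nr: "z = (n, r)" by fastforce
    have "n < s * r"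
    proof (rule ccontr)
      assume "\<not> n < s * r"
      then have "z = ?h (r, n - s * r)" by (simp add: nr)
      then show False using \<open>z \<in> UNIV - range ?h\<close> by blast
    qed
    then show "?G z = 0" by (simp add: nr zero)
  qed auto
  moreover have "inj ?h" by (auto simp: inj_on_def)
  ultimately have "((?G \<circ> ?h) has_sum infsum ?G UNIV) (UNIV \<times> UNIV)"
    by (subst (asm) has_sum_reindex) auto
  then have "((\<lambda>r. \<Sum>\<^sub>\<infinity>m. g (m + s * r) r) has_sum infsum ?G UNIV) UNIV"
  proof (rule has_sum_SigmaD)
    fix r :: nat
    have "(\<lambda>m. g (m + s * r) r) summable_on UNIV"
      by (intro summable_nat_flsI ord_ge_mono[OF ord]) simp
    then show "((\<lambda>m. (?G \<circ> ?h) (r, m)) has_sum (\<Sum>\<^sub>\<infinity>m. g (m + s * r) r)) UNIV"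
      by (simp add: o_def)
  qed
  then show ?thesis by (simp add: infsumI)
qed

lemma recip_qpoch_nat: "recip_qpoch p (int n) = 1 / qpoch p p n"
  by (simp add: recip_qpoch_def)

lemma recip_qpoch_neg: "n < 0 \<Longrightarrow> recip_qpoch p n = 0"
  by (simp add: recip_qpoch_def)

lemma ord_ge_recip_qpoch:
  assumes "d > 0" shows "ord_ge 0 (recip_qpoch (qv ^ d) n)"
  unfolding recip_qpoch_def using assms
  by (auto intro!: unit_series_ord_ge unit_series_inverse unit_qpoch_qv)

lemma ord_ge_recip_qpoch1: "ord_ge 0 (recip_qpoch qv n)"
  using ord_ge_recip_qpoch[of 1 n] by simp

lemma raise_weight_step:
  "raise_weight d (Suc k) x r = x ^ r * (qv ^ d) ^ (r * r) * raise_weight d k x r"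
  by (simp add: raise_weight_def power_add algebra_simps)

text \<open>
  The common shape of the double sums for \<open>d = 2\<close>; they differ in the factor \<open>w r\<close> and in the argument.
\<close>

definition double2_term :: "(nat \<Rightarrow> series) \<Rightarrow> series \<Rightarrow> nat \<Rightarrow> nat \<Rightarrow> series" where
  "double2_term w x n r = w r * (x ^ n * qv ^ (n * n)) * (1 / qpoch (x * qv) (qv ^ 2) n) *
     recip_qpoch qv (int n - 2 * int r) * recip_qpoch (qv ^ 2) (int r)"

text \<open>
  The common shape of the double sums for \<open>d = 3\<close>.
\<close>

definition double3_term :: "(nat \<Rightarrow> series) \<Rightarrow> series \<Rightarrow> nat \<Rightarrow> nat \<Rightarrow> series" where
  "double3_term w x n r = w r * (x ^ n * qv ^ (n * n)) * (qpoch x (qv ^ 3) (n - r) / qpoch x qv (2 * n)) *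
     recip_qpoch qv (int n - 3 * int r) * recip_qpoch (qv ^ 3) (int r)"

lemma gordon_factors_2:
  assumes x: "x \<in> adm"
  shows "gordon_factors 2 x n = 1 / qpoch (x * qv) (qv ^ 2) n"
proof (induction n)
  case (Suc n)
  have "gordon_factor 2 (x * (qv ^ 2) ^ n) = 1 / (1 - x * qv * (qv ^ 2) ^ n)"
    by (simp add: gordon_factor_def qpoch_def mult_ac)
  then show ?case by (simp add: gordon_factors_Suc qpoch_Suc Suc)
qed simp

text \<open>
  For \<open>d = 3\<close> the accumulated factors are the quotients \<open>(x; q\<^sup>3)\<^sub>n / (x; q)\<^bsub>3n\<^esub>\<close>, since every third
  factor of the denominator cancels.
\<close>

lemma gordon_factors_3:
  assumes x: "x \<in> adm"
  shows "gordon_factors 3 x n = qpoch x (qv ^ 3) n / qpoch x qv (3 * n)"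
proof (induction n)
  case (Suc n)
  let ?y = "x * (qv ^ 3) ^ n"
  have nz: "1 - ?y \<noteq> 0"
    by (intro unit_series_nonzero unit_one_minus_adm adm_mult_qv_power x)
  have q: "qv ^ (3 * n) = (qv ^ 3) ^ n" by (rule power_mult)
  have i: "3 * Suc n = Suc (Suc (Suc (3 * n)))" by simp
  have "qpoch x qv (3 * Suc n) = qpoch x qv (3 * n) * (1 - ?y) * ((1 - ?y * qv) * (1 - ?y * qv ^ 2))"
    unfolding i qpoch_Suc power_Suc q power2_eq_square by (simp only: mult_ac)
  moreover have "u \<noteq> 0 \<Longrightarrow> A / B * (1 / C) = A * u / (B * u * C)" for A B C u :: series by simp
  ultimately show ?case
    unfolding gordon_factors_Suc Suc gordon_factor_3 qpoch_Suc[of x "qv ^ 3"] using nz by metis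
qed simp

text \<open>
  For \<open>n = m + 2 r\<close> the square \<open>n\<^sup>2\<close> and the Pochhammer symbol of length \<open>n\<close> split into a part that
  depends on \<open>r\<close> alone and the summand of the single sum at \<open>x q\<^bsup>4r\<^esup>\<close>.
\<close>

lemma double2_by_columns:
  assumes x: "x \<in> adm" and w: "\<And>r. ord_ge 0 (w r)"
  shows "(\<Sum>\<^sub>\<infinity>(n, r). double2_term w x n r) =
    (\<Sum>\<^sub>\<infinity>r. w r * raise_weight 2 2 x r * S2 0 0 0 (x * (qv ^ 2) ^ (2 * r)))" (is "?lhs = ?rhs")
proof -
  have xq: "x * qv \<in> adm" using x by (rule adm_mult_qv1)
  have "?lhs =
      (\<Sum>\<^sub>\<infinity>r. \<Sum>\<^sub>\<infinity>m. double2_term w x (m + 2 * r) r)"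
  proof (rule infsum_pairs_by_columns)
    show "double2_term w x n r = 0" if "n < 2 * r" for n r
      using that by (simp add: double2_term_def recip_qpoch_neg)
    show "ord_ge (int n) (double2_term w x n r)" for n r
    proof -
      have "ord_ge (int n) (x ^ n * qv ^ (n * n))"
        using ord_ge_term[OF x ord_ge_1, of n "n * n" n] square_ge_self[of n 0] by simp
      from ord_ge_mult_left[OF w[of r] this] show ?thesis
        unfolding double2_term_def
        by (intro ord_ge_mult_right[OF ord_ge_mult_right[OF ord_ge_mult_right]] ord_ge_recip_qpoch ord_ge_recip_qpoch1
            unit_series_ord_ge[OF unit_series_inverse[OF unit_qpoch_adm[OF xq]]]) auto
    qed
  qed simp
  also have "\<dots> = ?rhs"
  proof (rule infsum_cong)
    fix r :: nat
    let ?y = "x * (qv ^ 2) ^ (2 * r)"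
    have y: "?y \<in> adm" by (rule adm_mult_qv_power[OF x])
    have "double2_term w x (m + 2 * r) r = w r * raise_weight 2 2 x r * S2_term 0 0 0 ?y m" for m
    proof -
      have i: "int (m + 2 * r) - 2 * int r = int m" by simp
      have Q: "qpoch (x * qv) (qv ^ 2) (m + 2 * r) = qpoch (x * qv) (qv ^ 2) (2 * r) * qpoch (?y * qv) (qv ^ 2) m"
        unfolding add.commute[of m] qpoch_add by (simp only: mult_ac)
      have e: "(m + 2 * r) * (m + 2 * r) = 2 * (2 * r * r) + (2 * (2 * r * m) + m * m)" by (simp add: algebra_simps)
      have e': "m + 2 * r = 2 * r + m" by simp
      have E: "x ^ (m + 2 * r) * qv ^ ((m + 2 * r) * (m + 2 * r)) =
          x ^ (2 * r) * (qv ^ 2) ^ (2 * r * r) * (?y ^ m * qv ^ (m * m))"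
        unfolding e unfolding e' power_add power_mult_distrib power_mult[of qv 2] power_mult[of "qv ^ 2" "2 * r" m]
        by (simp only: mult_ac)
      have gen: "W * E * (1 / (A * B)) * (1 / M) * (1 / R) = W * (X * (1 / A / R)) * (Y * (1 / (B * M)))"
        if "E = X * Y" for W E A B M R X Y :: series using that by (simp add: mult_ac)
      show ?thesis
        unfolding double2_term_def i recip_qpoch_nat Q raise_weight_def S2_term_def gordon_factors_2[OF x]
        by (simp only: mult_0 add_0_right, rule gen, rule E)
    qed
    then have "(\<Sum>\<^sub>\<infinity>m. double2_term w x (m + 2 * r) r) =
        (\<Sum>\<^sub>\<infinity>m. w r * raise_weight 2 2 x r * S2_term 0 0 0 ?y m)"
      by (intro infsum_cong)
    also have "\<dots> = w r * raise_weight 2 2 x r * S2 0 0 0 ?y"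
      unfolding S2_def by (intro infsum_cmult_right summable_nat_flsI ord_ge_S2_term y)
    finally show "(\<Sum>\<^sub>\<infinity>m. double2_term w x (m + 2 * r) r) =
        w r * raise_weight 2 2 x r * S2 0 0 0 ?y" .
  qed
  finally show ?thesis .
qed

text \<open>
  The analogue for \<open>d = 3\<close> with \<open>n = m + 3 r\<close>. The factor \<open>w r\<close> may have negative order here, because
  \<open>n\<^sup>2 - 3 r \<ge> n\<close> whenever \<open>n \<ge> 3 r\<close>; some of the listed sums contain negative powers of \<open>q\<close>.
\<close>

lemma double3_by_columns:
  assumes x: "x \<in> adm" and w: "\<And>r. ord_ge (- int (3 * r)) (w r)"
  shows "(\<Sum>\<^sub>\<infinity>(n, r). double3_term w x n r) =
    (\<Sum>\<^sub>\<infinity>r. w r * raise_weight 3 3 x r * S3 0 0 (x * (qv ^ 3) ^ (2 * r)))" (is "?lhs = ?rhs")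
proof -
  have "?lhs =
      (\<Sum>\<^sub>\<infinity>r. \<Sum>\<^sub>\<infinity>m. double3_term w x (m + 3 * r) r)"
  proof (rule infsum_pairs_by_columns)
    show zero: "double3_term w x n r = 0" if "n < 3 * r" for n r
      using that by (simp add: double3_term_def recip_qpoch_neg)
    show "ord_ge (int n) (double3_term w x n r)" for n r
    proof (cases "n < 3 * r")
      case False
      have "3 * r + n \<le> n * n"
      proof (cases "r = 0")
        case r: False
        then have "3 \<le> n" using False by simp
        then have "3 * n \<le> n * n" by (rule mult_le_mono1)
        then show ?thesis using False by linarith
      qed (simp add: square_ge_self[of n 0, simplified])
      then have "ord_ge (int (3 * r) + int n) (x ^ n * qv ^ (n * n))"
        using ord_ge_term[OF x ord_ge_1, of "3 * r + n" "n * n" n] by simp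
      from ord_ge_mult[OF w[of r] this] have "ord_ge (int n) (w r * (x ^ n * qv ^ (n * n)))" by simp
      then show ?thesis
        unfolding double3_term_def
        by (intro ord_ge_mult_right[OF ord_ge_mult_right[OF ord_ge_mult_right]] ord_ge_recip_qpoch ord_ge_recip_qpoch1 ord_ge_divide
            unit_series_ord_ge[OF unit_qpoch_adm] unit_qpoch_adm_qv x) auto
    qed (simp add: zero)
  qed simp
  also have "\<dots> = ?rhs"
  proof (rule infsum_cong)
    fix r :: nat
    let ?y = "x * (qv ^ 3) ^ (2 * r)"
    have y: "?y \<in> adm" by (rule adm_mult_qv_power[OF x])
    have "double3_term w x (m + 3 * r) r = w r * raise_weight 3 3 x r * S3_term 0 0 ?y m" for m
    proof -
      have i: "int (m + 3 * r) - 3 * int r = int m" "m + 3 * r - r = 2 * r + m"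
        "2 * (m + 3 * r) = 3 * (2 * r) + 2 * m" by simp_all
      have y': "x * qv ^ (3 * (2 * r)) = ?y" by (simp only: power_mult)
      have e: "(m + 3 * r) * (m + 3 * r) = 3 * (3 * r * r) + (3 * (2 * r * m) + m * m)" by (simp add: algebra_simps)
      have e': "m + 3 * r = 3 * r + m" by simp
      have E: "x ^ (m + 3 * r) * qv ^ ((m + 3 * r) * (m + 3 * r)) =
          x ^ (3 * r) * (qv ^ 3) ^ (3 * r * r) * (?y ^ m * qv ^ (m * m))"
        unfolding e unfolding e' power_add power_mult_distrib power_mult[of qv 3] power_mult[of "qv ^ 3" "2 * r" m]
        by (simp only: mult_ac)
      have gen: "W * E * (P * P' / (A * B)) * (1 / M) * (1 / R) = W * (X * (P / A / R)) * (Y * (P' * (1 / (B * M))))"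
        if "E = X * Y" for W E A B M R X Y P P' :: series using that by (simp add: mult_ac)
      show ?thesis
        unfolding double3_term_def i recip_qpoch_nat qpoch_add y' raise_weight_def S3_term_def gordon_factors_3[OF x]
        by (simp only: mult_0 add_0_right qpoch_0 mult_1_right, rule gen, rule E)
    qed
    then have "(\<Sum>\<^sub>\<infinity>m. double3_term w x (m + 3 * r) r) =
        (\<Sum>\<^sub>\<infinity>m. w r * raise_weight 3 3 x r * S3_term 0 0 ?y m)"
      by (intro infsum_cong)
    also have "\<dots> = w r * raise_weight 3 3 x r * S3 0 0 ?y"
      unfolding S3_def by (intro infsum_cmult_right summable_nat_flsI ord_ge_S3_term y)
    finally show "(\<Sum>\<^sub>\<infinity>m. double3_term w x (m + 3 * r) r) =
        w r * raise_weight 3 3 x r * S3 0 0 ?y" .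
  qed
  finally show ?thesis .
qed

section \<open>Identifying the listed sums\<close>

subsection \<open>Single sums\<close>

lemma nat_square: "n\<^sup>2 = n * (n::nat)"
  by (rule power2_eq_square)

lemma S2_eq: "S2 t c e x = (\<Sum>\<^sub>\<infinity>n. x ^ n * qv ^ (n * n + t * (n choose 2) + c * n) /
     (qpoch (x * qv) (qv ^ 2) (n + e) * qpoch qv qv n))"
  by (simp add: S2_def S2_term_def[abs_def])

lemma F221_eq: "F221 = F22_fun 1 av"
proof -
  have "(3 * n\<^sup>2 + 3 * n) div 2 = n * n + 1 * (n choose 2) + 2 * n" for n :: nat
    using two_choose_two[of n] by (simp add: nat_square)
  then show ?thesis by (simp add: F221_def F22_fun_def S2_eq)
qed

lemma F222_eq: "F222 = F22_fun 2 av"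
proof -
  have "(3 * n\<^sup>2 - n) div 2 = n * n + 1 * (n choose 2) + 0 * n" for n :: nat
    using two_choose_two[of n] by (simp add: nat_square)
  then show ?thesis by (simp add: F222_def F22_fun_def S2_eq)
qed

lemma F231_eq: "F231 = F23_fun 1 av"
  unfolding F231_def nat_square by (simp add: F23_fun_def S2_eq)

lemma F232_eq: "F232 = F23_fun 2 av"
  unfolding F232_def nat_square by (simp add: F23_fun_def S2_eq)

lemma F233_eq: "F233 = F23_fun 3 av"
  unfolding F233_def nat_square by (simp add: F23_fun_def S2_eq)

lemma S3'_cancelled:
  assumes x: "x \<in> adm"
  shows "S3' c (Suc e) x = (\<Sum>\<^sub>\<infinity>n. x ^ n * qv ^ (n * n + c * n) *
    qpoch (x * qv ^ 3) (qv ^ 3) n / (qpoch (x * qv) qv (2 * n + e) * qpoch qv qv n))"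
proof -
  have nz: "1 - x \<noteq> 0" by (intro unit_series_nonzero unit_one_minus_adm x)
  have "S3_term c (Suc e) x n * (1 - x * (qv ^ 3) ^ n) = x ^ n * qv ^ (n * n + c * n) *
      qpoch (x * qv ^ 3) (qv ^ 3) n / (qpoch (x * qv) qv (2 * n + e) * qpoch qv qv n)" for n
  proof -
    have P: "qpoch x (qv ^ 3) n * (1 - x * (qv ^ 3) ^ n) = (1 - x) * qpoch (x * qv ^ 3) (qv ^ 3) n"
      unfolding qpoch_Suc[symmetric] by (rule qpoch_Suc_left)
    have D: "qpoch x qv (2 * n + Suc e) = (1 - x) * qpoch (x * qv) qv (2 * n + e)"
      by (simp add: qpoch_Suc_left)
    have gen: "u \<noteq> 0 \<Longrightarrow> p * v = u * p' \<Longrightarrow> E * (p * (1 / (u * A * B))) * v = E * p' / (A * B)"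
      for u p v p' E A B :: series by (simp add: field_simps)
    show ?thesis unfolding S3_term_def D by (rule gen[OF nz P])
  qed
  then show ?thesis unfolding S3'_eq[OF x] by simp
qed

lemma F34_fun_values:
  "F34_fun 1 x = S3' 3 (Suc 2) x" "F34_fun 2 x = S3' 2 (Suc 2) x" "F34_fun 3 x = S3' 1 (Suc 1) x"
  "F34_fun 4 x = S3 0 0 x"
  by (simp_all add: F34_fun_def eval_nat_numeral)

lemma F341_eq: "F341 = F34_fun 1 av"
  unfolding F341_def F34_fun_values S3'_cancelled[OF adm_av] distrib_left by (simp add: mult.commute[of _ 3])

lemma F342_eq: "F342 = F34_fun 2 av"
  unfolding F342_def F34_fun_values S3'_cancelled[OF adm_av] distrib_left by (simp add: mult.commute[of _ 2])

lemma F343_eq: "F343 = F34_fun 3 av"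
  unfolding F343_def F34_fun_values S3'_cancelled[OF adm_av] distrib_left by simp

lemma F344_eq: "F344 = F34_fun 4 av"
  unfolding F344_def F34_fun_values S3_def S3_term_def[abs_def] nat_square by simp

subsection \<open>Double sums for \<open>d = 2\<close>\<close>

lemma F23_top: "F23_fun 3 = S2 0 0 0"
  by (rule ext) (simp add: F23_fun_def)

lemma F34_top: "F34_fun 4 = S3 0 0"
  by (rule ext) (simp add: F34_fun_def)

definition double2_sum :: "(nat \<Rightarrow> series) \<Rightarrow> series \<Rightarrow> series" where
  "double2_sum w x = (\<Sum>\<^sub>\<infinity>(n, r). double2_term w x n r)"

lemma double2_linear:
  assumes x: "x \<in> adm" and c: "ord_ge 0 c" "ord_ge 0 y"
    and w: "\<And>r. ord_ge 0 (w r)" and v: "\<And>r. ord_ge 0 (v r)"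
  shows "double2_sum (\<lambda>r. c * (w r + y * v r)) x = c * (double2_sum w x + y * double2_sum v x)"
proof -
  let ?T = "\<lambda>w r. w r * raise_weight 2 2 x r * S2 0 0 0 (x * (qv ^ 2) ^ (2 * r))"
  have S: "ord_ge 0 (S2 0 0 0 (x * (qv ^ 2) ^ m))" for m
    unfolding S2_def by (intro ord_ge_infsum ord_ge_mono[OF ord_ge_S2_term] adm_mult_qv_power x) simp
  have T: "?T w summable_on UNIV" if "\<And>r. ord_ge 0 (w r)" for w
    by (intro summable_nat_flsI ord_ge_mult_right[OF ord_ge_mult_left] that ord_ge_weights(1) x S) auto
  have cw: "ord_ge 0 (c * (w r + y * v r))" for r
    by (intro ord_ge_mult_left[OF c(1)] ord_ge_add w ord_ge_mult_left[OF c(2)] v)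
  have "double2_sum (\<lambda>r. c * (w r + y * v r)) x = infsum (?T (\<lambda>r. c * (w r + y * v r))) UNIV"
    unfolding double2_sum_def by (rule double2_by_columns[OF x cw])
  also have "\<dots> = infsum (\<lambda>r. c * (?T w r + y * ?T v r)) UNIV"
    by (intro infsum_cong) (simp add: algebra_simps)
  also have "\<dots> = c * (infsum (?T w) UNIV + y * infsum (?T v) UNIV)"
    using T[OF w] T[OF v] by (simp add: infsum_cmult_right infsum_add summable_on_add summable_on_cmult_right)
  finally show ?thesis
    unfolding double2_sum_def double2_by_columns[OF x w] double2_by_columns[OF x v] .
qed

definition J24 :: "nat \<Rightarrow> series \<Rightarrow> series" where
  "J24 = raise 2 3 F23_fun"

lemma J24_system: "gordon_system 2 4 J24"
  using raise_gordon_system[OF F23_gordon_system] by (simp add: J24_def)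

lemma J24_double:
  assumes x: "x \<in> adm"
  shows "J24 4 x = double2_sum (\<lambda>r. x ^ r * (qv ^ 2) ^ (r * r)) x" (is ?top)
    and "J24 3 x = double2_sum (\<lambda>r. x ^ r * (qv ^ 2) ^ (r * r) * (qv ^ 2) ^ r) x" (is ?next)
proof -
  have W: "raise_weight 2 3 x r = x ^ r * (qv ^ 2) ^ (r * r) * raise_weight 2 2 x r" for r
    using raise_weight_step[of 2 2 x r] by simp
  have w: "ord_ge 0 (x ^ r * (qv ^ 2) ^ (r * r))" "ord_ge 0 (x ^ r * (qv ^ 2) ^ (r * r) * (qv ^ 2) ^ r)" for r
    by (intro ord_ge_mult_right ord_ge_power_0 ord_ge_qv ord_ge_adm[OF x])+
  show ?top
    unfolding double2_sum_def double2_by_columns[OF x w(1)] J24_def raise_def W by (simp add: F23_top)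
  show ?next
    unfolding double2_sum_def double2_by_columns[OF x w(2)] J24_def raise_def W by (simp add: F23_top mult_ac)
qed

lemma F244_eq: "F244 = J24 4 av"
  unfolding F244_def J24_double(1)[OF adm_av] double2_sum_def double2_term_def
    nat_square power_add power_mult[of qv 2]
  by (simp only: times_divide_eq_left times_divide_eq_right mult_1_right mult_1_left mult_ac)

lemma F243_eq: "F243 = J24 3 av"
  unfolding F243_def J24_double(2)[OF adm_av] double2_sum_def double2_term_def
    nat_square power_add power_mult[of qv 2]
  by (simp only: times_divide_eq_left times_divide_eq_right mult_1_right mult_1_left mult_ac)

lemma qpoch_drop_2:
  "1 / qpoch (x * qv) (qv ^ 2) (n + 1) = gordon_factor 2 x * (1 / qpoch (x * qv ^ 2 * qv) (qv ^ 2) n)"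
proof -
  have "qpoch (x * qv) (qv ^ 2) (n + 1) = (1 - x * qv) * qpoch (x * qv ^ 2 * qv) (qv ^ 2) n"
    unfolding Suc_eq_plus1[symmetric] qpoch_Suc_left by (simp only: mult_ac)
  then show ?thesis by (simp add: gordon_factor_def qpoch_def)
qed

lemma divide_by_recip: "E / Q = E * t" if "1 / Q = t" for E Q t :: series
  using that by (metis times_divide_eq_right mult_1_right)

text \<open>
  By the first two equations of the system, the functions for \<open>i = 1\<close> and \<open>i = 2\<close> are combinations of
  those for \<open>i = 4\<close> and \<open>i = 3\<close> at the argument \<open>a q\<^sup>2\<close>. The listed sums for these two indices are
  the cases \<open>y = 0\<close> and \<open>y = a q\<^sup>2\<close>.
\<close>

lemma J24_double_shifted:
  fixes y :: series
  assumes y: "ord_ge 0 y"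
  shows "(\<Sum>\<^sub>\<infinity>(n, r)\<in>UNIV.
        av ^ (n + r) * qv ^ (n\<^sup>2 + 2 * n + 2 * r\<^sup>2 + 2 * r) * (1 + y * qv ^ (2 * r)) /
        qpoch (av * qv) (qv\<^sup>2) (n + 1) *
        recip_qpoch qv (int n - 2 * int r) * recip_qpoch (qv ^ 2) (int r)) =
    gordon_factor 2 av * (J24 4 (av * qv ^ 2) + y * J24 3 (av * qv ^ 2))" (is "?lhs = _")
proof -
  let ?x = "av * qv ^ 2" and ?c = "gordon_factor 2 av"
  have x: "?x \<in> adm" by (intro adm_mult_qv adm_av)
  have c: "ord_ge 0 ?c" by (intro unit_series_ord_ge unit_gordon_factor adm_av)
  let ?w = "\<lambda>r. ?x ^ r * (qv ^ 2) ^ (r * r)" and ?v = "\<lambda>r. ?x ^ r * (qv ^ 2) ^ (r * r) * (qv ^ 2) ^ r"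
  have w: "ord_ge 0 (?w r)" "ord_ge 0 (?v r)" for r
    by (intro ord_ge_mult_right ord_ge_power_0[OF ord_ge_adm[OF x]] ord_ge_power_0 ord_ge_qv)+
  have "av ^ (n + r) * qv ^ (n\<^sup>2 + 2 * n + 2 * r\<^sup>2 + 2 * r) * (1 + y * qv ^ (2 * r)) /
        qpoch (av * qv) (qv\<^sup>2) (n + 1) *
        recip_qpoch qv (int n - 2 * int r) * recip_qpoch (qv ^ 2) (int r) =
        double2_term (\<lambda>r. ?c * (?w r + y * ?v r)) ?x n r" for n r
  proof -
    have e: "n\<^sup>2 + 2 * n + 2 * r\<^sup>2 + 2 * r = n * n + 2 * n + 2 * (r * r) + 2 * r" by (simp add: nat_square)
    have gen: "an * ar * (qn * q2n * q2rr * q2r) * (1 + y * q2r) * (c * Q) * R * R' =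
       c * ((ar * q2r) * q2rr + y * ((ar * q2r) * q2rr * q2r)) * ((an * q2n) * qn) * Q * R * R'"
      for an ar qn q2n q2rr q2r c Q R R' :: series by (simp add: algebra_simps)
    show ?thesis
      unfolding double2_term_def e power_add power_mult[of qv 2] power_mult_distrib
        divide_by_recip[OF qpoch_drop_2] by (rule gen)
  qed
  then have "?lhs =
      double2_sum (\<lambda>r. ?c * (?w r + y * ?v r)) ?x"
    unfolding double2_sum_def by (intro infsum_cong) auto
  also have "\<dots> = ?c * (J24 4 ?x + y * J24 3 ?x)"
    unfolding J24_double[OF x] by (rule double2_linear[OF x c y w])
  finally show ?thesis .
qed

lemma F241_eq: "F241 = J24 1 av"
proof -
  have "F241 = gordon_factor 2 av * J24 4 (av * qv ^ 2)"
    using J24_double_shifted[of 0] by (simp add: F241_def)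
  then show ?thesis
    using gordon_systemD(2)[OF J24_system adm_av, of 1] gordon_systemD(1)[OF J24_system adm_av] by simp
qed

lemma F242_eq: "F242 = J24 2 av"
proof -
  have x: "ord_ge 0 (av * qv ^ 2)" by (intro ord_ge_adm adm_mult_qv adm_av)
  have e: "av * qv ^ (2 * r + 2) = av * qv ^ 2 * qv ^ (2 * r)" for r
    by (simp only: power_add mult_ac)
  note J24_double_shifted[OF x]
  then
  have "F242 = gordon_factor 2 av * (J24 4 (av * qv ^ 2) + av * qv ^ 2 * J24 3 (av * qv ^ 2))"
    unfolding F242_def e .
  then show ?thesis
    using gordon_systemD(2)[OF J24_system adm_av, of 1] gordon_systemD(2)[OF J24_system adm_av, of 2]
      gordon_systemD(1)[OF J24_system adm_av] by (simp add: algebra_simps)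
qed

subsection \<open>Double sums for \<open>d = 3\<close>\<close>

definition double3_sum :: "(nat \<Rightarrow> series) \<Rightarrow> series \<Rightarrow> series" where
  "double3_sum w x = (\<Sum>\<^sub>\<infinity>(n, r). double3_term w x n r)"

lemma ord_ge_0_imp: "ord_ge 0 z \<Longrightarrow> ord_ge (- int m) z"
  by (rule ord_ge_mono) auto

lemma double3_linear:
  assumes x: "x \<in> adm" and c: "ord_ge 0 c" "ord_ge 0 y"
    and w: "\<And>r. ord_ge 0 (w r)" and v: "\<And>r. ord_ge 0 (v r)"
  shows "double3_sum (\<lambda>r. c * (w r + y * v r)) x = c * (double3_sum w x + y * double3_sum v x)"
proof -
  let ?T = "\<lambda>w r. w r * raise_weight 3 3 x r * S3 0 0 (x * (qv ^ 3) ^ (2 * r))"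
  have S: "ord_ge 0 (S3 0 0 (x * (qv ^ 3) ^ m))" for m
    by (intro ord_ge_S3 adm_mult_qv_power x)
  have T: "?T w summable_on UNIV" if "\<And>r. ord_ge 0 (w r)" for w
    by (intro summable_nat_flsI ord_ge_mult_right[OF ord_ge_mult_left] that ord_ge_weights(1) x S) auto
  have cw: "ord_ge 0 (c * (w r + y * v r))" for r
    by (intro ord_ge_mult_left[OF c(1)] ord_ge_add w ord_ge_mult_left[OF c(2)] v)
  have "double3_sum (\<lambda>r. c * (w r + y * v r)) x = infsum (?T (\<lambda>r. c * (w r + y * v r))) UNIV"
    unfolding double3_sum_def by (rule double3_by_columns[OF x ord_ge_0_imp[OF cw]])
  also have "\<dots> = infsum (\<lambda>r. c * (?T w r + y * ?T v r)) UNIV"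
    by (intro infsum_cong) (simp add: algebra_simps)
  also have "\<dots> = c * (infsum (?T w) UNIV + y * infsum (?T v) UNIV)"
    using T[OF w] T[OF v] by (simp add: infsum_cmult_right infsum_add summable_on_add summable_on_cmult_right)
  finally show ?thesis
    unfolding double3_sum_def double3_by_columns[OF x ord_ge_0_imp[OF w]] double3_by_columns[OF x ord_ge_0_imp[OF v]] .
qed

definition J35 :: "nat \<Rightarrow> series \<Rightarrow> series" where
  "J35 = raise 3 4 F34_fun"

definition J33 :: "nat \<Rightarrow> series \<Rightarrow> series" where
  "J33 = lower 3 3 F34_fun"

lemma J35_system: "gordon_system 3 5 J35"
  using raise_gordon_system[OF F34_gordon_system] by (simp add: J35_def)

lemma F34_gordon_system_Suc: "gordon_system 3 (Suc 3) F34_fun"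
  using F34_gordon_system by simp

lemma J33_system: "gordon_system 3 3 J33"
  unfolding J33_def by (rule lower_gordon_system(1)[OF F34_gordon_system_Suc]) auto

lemma J33_4: "x \<in> adm \<Longrightarrow> J33 4 x = J33 3 x"
  using lower_gordon_system(2)[OF F34_gordon_system_Suc, of x] by (simp add: J33_def)

lemma raise_weight_3_4: "raise_weight 3 4 x r = x ^ r * (qv ^ 3) ^ (r * r) * raise_weight 3 3 x r"
  using raise_weight_step[of 3 3 x r] by simp

lemma J35_double:
  assumes x: "x \<in> adm"
  shows "J35 5 x = double3_sum (\<lambda>r. x ^ r * (qv ^ 3) ^ (r * r)) x" (is ?top)
    and "J35 4 x = double3_sum (\<lambda>r. x ^ r * (qv ^ 3) ^ (r * r) * (qv ^ 3) ^ r) x" (is ?next)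
proof -
  have w: "ord_ge 0 (x ^ r * (qv ^ 3) ^ (r * r))" "ord_ge 0 (x ^ r * (qv ^ 3) ^ (r * r) * (qv ^ 3) ^ r)" for r
    by (intro ord_ge_mult_right ord_ge_power_0[OF ord_ge_adm[OF x]] ord_ge_power_0 ord_ge_qv)+
  show ?top
    unfolding double3_sum_def double3_by_columns[OF x ord_ge_0_imp[OF w(1)]] J35_def raise_def raise_weight_3_4
    by (simp add: F34_top)
  show ?next
    unfolding double3_sum_def double3_by_columns[OF x ord_ge_0_imp[OF w(2)]] J35_def raise_def raise_weight_3_4
    by (simp add: F34_top mult_ac)
qed

lemma J33_sum: "J33 4 x = (\<Sum>\<^sub>\<infinity>r. lower_weight 3 3 x r * S3 0 0 (x * (qv ^ 3) ^ (2 * r)))"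
  unfolding J33_def lower_def by (simp add: F34_top)

lemma J33_double:
  assumes x: "x \<in> adm"
  shows "J33 3 x = double3_sum (\<lambda>r. (-1) ^ r * (qv ^ 3) ^ (r choose 2)) x"
proof -
  have w: "ord_ge 0 ((-1) ^ r * (qv ^ 3) ^ (r choose 2))" for r
    by (intro ord_ge_mult_right ord_ge_minus_one_power ord_ge_power_0 ord_ge_qv)
  show ?thesis
    unfolding J33_4[OF x, symmetric] J33_sum double3_sum_def double3_by_columns[OF x ord_ge_0_imp[OF w]] lower_weight_def ..
qed

lemma F355_eq: "F355 = J35 5 av"
  unfolding F355_def J35_double(1)[OF adm_av] double3_sum_def double3_term_def
    nat_square power_add power_mult[of qv 3]
  by (simp only: times_divide_eq_left times_divide_eq_right mult_1_right mult_1_left mult_ac)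

lemma F354_eq: "F354 = J35 4 av"
  unfolding F354_def J35_double(2)[OF adm_av] double3_sum_def double3_term_def
    nat_square power_add power_mult[of qv 3]
  by (simp only: times_divide_eq_left times_divide_eq_right mult_1_right mult_1_left mult_ac)

lemma three_choose_two: "3 * r * (r - 1) div 2 = 3 * (r choose 2)" for r :: nat
proof -
  have "3 * r * (r - 1) = 2 * (3 * (r choose 2))"
    using two_choose_two[of r] by (cases r) (auto simp: algebra_simps)
  then show ?thesis by simp
qed

lemma F333_eq: "F333 = J33 3 av"
  unfolding F333_def J33_double[OF adm_av] double3_sum_def double3_term_def
    three_choose_two nat_square power_add power_mult[of qv 3]
  by (simp only: times_divide_eq_left times_divide_eq_right mult_1_right mult_1_left mult_ac)

lemma qpoch_drop_3:
  "1 / qpoch (x * qv) qv (2 * n + 2) = gordon_factor 3 x * (1 / qpoch (x * qv ^ 3) qv (2 * n))"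
proof -
  have "qpoch (x * qv) qv (2 * n + 2) = qpoch (x * qv) qv 2 * qpoch (x * qv * qv ^ 2) qv (2 * n)"
    unfolding add.commute[of _ 2] by (rule qpoch_add)
  also have "x * qv * qv ^ 2 = x * qv ^ 3" by (simp add: eval_nat_numeral mult_ac)
  finally show ?thesis by (simp add: gordon_factor_def)
qed

text \<open>
  As for \<open>d = 2\<close>, with \<open>i = 5\<close> and \<open>i = 4\<close> at the argument \<open>a q\<^sup>3\<close> on the right; the cases
  \<open>y = 0\<close> and \<open>y = a q\<^sup>3\<close> are needed.
\<close>

lemma J35_double_shifted:
  fixes y :: series
  assumes y: "ord_ge 0 y"
  shows "(\<Sum>\<^sub>\<infinity>(n, r)\<in>UNIV.
        av ^ (n + r) * qv ^ (n\<^sup>2 + 3 * r\<^sup>2 + 3 * n + 3 * r) *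
        qpoch (av * qv ^ 3) (qv ^ 3) (n - r) * (1 + y * qv ^ (3 * r)) /
        qpoch (av * qv) qv (2 * n + 2) *
        recip_qpoch qv (int n - 3 * int r) * recip_qpoch (qv ^ 3) (int r)) =
    gordon_factor 3 av * (J35 5 (av * qv ^ 3) + y * J35 4 (av * qv ^ 3))" (is "?lhs = _")
proof -
  let ?x = "av * qv ^ 3" and ?c = "gordon_factor 3 av"
  have x: "?x \<in> adm" by (intro adm_mult_qv adm_av)
  have c: "ord_ge 0 ?c" by (intro unit_series_ord_ge unit_gordon_factor adm_av)
  let ?w = "\<lambda>r. ?x ^ r * (qv ^ 3) ^ (r * r)" and ?v = "\<lambda>r. ?x ^ r * (qv ^ 3) ^ (r * r) * (qv ^ 3) ^ r"
  have w: "ord_ge 0 (?w r)" "ord_ge 0 (?v r)" for r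
    by (intro ord_ge_mult_right ord_ge_power_0[OF ord_ge_adm[OF x]] ord_ge_power_0 ord_ge_qv)+
  have "av ^ (n + r) * qv ^ (n\<^sup>2 + 3 * r\<^sup>2 + 3 * n + 3 * r) *
        qpoch (av * qv ^ 3) (qv ^ 3) (n - r) * (1 + y * qv ^ (3 * r)) /
        qpoch (av * qv) qv (2 * n + 2) *
        recip_qpoch qv (int n - 3 * int r) * recip_qpoch (qv ^ 3) (int r) =
        double3_term (\<lambda>r. ?c * (?w r + y * ?v r)) ?x n r" for n r
  proof -
    have e: "n\<^sup>2 + 3 * r\<^sup>2 + 3 * n + 3 * r = n * n + 3 * n + 3 * (r * r) + 3 * r" by (simp add: nat_square)
    have gen: "an * ar * (qn * q2n * q2rr * q2r) * P * (1 + y * q2r) * (c * (1 / Q)) * R * R' =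
       c * ((ar * q2r) * q2rr + y * ((ar * q2r) * q2rr * q2r)) * ((an * q2n) * qn) * (P / Q) * R * R'"
      for an ar qn q2n q2rr q2r c P Q R R' :: series by (simp add: algebra_simps)
    show ?thesis
      unfolding double3_term_def e divide_by_recip[OF qpoch_drop_3] power_add power_mult[of qv 3]
        power_mult_distrib by (rule gen)
  qed
  then have "?lhs =
      double3_sum (\<lambda>r. ?c * (?w r + y * ?v r)) ?x"
    unfolding double3_sum_def by (intro infsum_cong) auto
  also have "\<dots> = ?c * (J35 5 ?x + y * J35 4 ?x)"
    unfolding J35_double[OF x] by (rule double3_linear[OF x c y w])
  finally show ?thesis .
qed

lemma F351_eq: "F351 = J35 1 av"
proof -
  have "F351 = gordon_factor 3 av * J35 5 (av * qv ^ 3)"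
    using J35_double_shifted[of 0] by (simp add: F351_def)
  then show ?thesis
    using gordon_systemD(2)[OF J35_system adm_av, of 1] gordon_systemD(1)[OF J35_system adm_av] by simp
qed

lemma F352_eq: "F352 = J35 2 av"
proof -
  have x: "ord_ge 0 (av * qv ^ 3)" by (intro ord_ge_adm adm_mult_qv adm_av)
  have e: "av * qv ^ (3 * r + 3) = av * qv ^ 3 * qv ^ (3 * r)" for r
    by (simp only: power_add mult_ac)
  note J35_double_shifted[OF x]
  then have "F352 = gordon_factor 3 av * (J35 5 (av * qv ^ 3) + av * qv ^ 3 * J35 4 (av * qv ^ 3))"
    unfolding F352_def e .
  then show ?thesis
    using gordon_systemD(2)[OF J35_system adm_av, of 1] gordon_systemD(2)[OF J35_system adm_av, of 2]
      gordon_systemD(1)[OF J35_system adm_av] by (simp add: algebra_simps)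
qed

lemma F331_eq: "F331 = J33 1 av"
proof -
  let ?x = "av * qv ^ 3" and ?c = "gordon_factor 3 av"
  have x: "?x \<in> adm" by (intro adm_mult_qv adm_av)
  have c: "ord_ge 0 ?c" by (intro unit_series_ord_ge unit_gordon_factor adm_av)
  let ?w = "\<lambda>r. (-1) ^ r * (qv ^ 3) ^ (r choose 2)"
  have w: "ord_ge 0 (?w r)" for r
    by (intro ord_ge_mult_right ord_ge_minus_one_power ord_ge_power_0 ord_ge_qv)
  have "(-1) ^ r * av ^ n * qv ^ (n\<^sup>2 + 3 * n + 3 * r * (r - 1) div 2) *
        qpoch (av * qv ^ 3) (qv ^ 3) (n - r) / qpoch (av * qv) qv (2 * n + 2) *
        recip_qpoch qv (int n - 3 * int r) * recip_qpoch (qv ^ 3) (int r) =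
        double3_term (\<lambda>r. ?c * (?w r + 0 * ?w r)) ?x n r" for n r
  proof -
    have gen: "s * an * (qn * q2n * q2r) * P * (c * (1 / Q)) * R * R' =
       c * (s * q2r + 0 * (s * q2r)) * ((an * q2n) * qn) * (P / Q) * R * R'"
      for s an qn q2n q2r c P Q R R' :: series by simp
    show ?thesis
      unfolding double3_term_def three_choose_two nat_square divide_by_recip[OF qpoch_drop_3]
        power_add power_mult[of qv 3] power_mult_distrib by (rule gen)
  qed
  then have "F331 = double3_sum (\<lambda>r. ?c * (?w r + 0 * ?w r)) ?x"
    unfolding double3_sum_def F331_def by (intro infsum_cong) auto
  also have "\<dots> = ?c * J33 3 ?x"
    unfolding J33_double[OF x] by (subst double3_linear[OF x c _ w w]) auto
  finally show ?thesis
    using gordon_systemD(2)[OF J33_system adm_av, of 1] gordon_systemD(1)[OF J33_system adm_av] by simp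
qed

lemma one_over_qv_cube: "ord_ge (- int (3 * r)) (1 / (qv ^ 3) ^ r)"
proof -
  have "fls_subdegree ((qv ^ 3) ^ r) = int (3 * r)"
    by (simp add: qv_def fls_subdegree_pow power_mult[symmetric])
  then have "fls_subdegree (1 / (qv ^ 3) ^ r) = - int (3 * r)"
    by (simp add: divide_inverse fls_inverse_subdegree)
  then show ?thesis using ord_ge_self[of "1 / (qv ^ 3) ^ r"] by simp
qed

lemma unit_av: "unit_series av"
  by (simp add: unit_series_def av_def)

text \<open>
  The third solution is a weighted sum of values of the third function for \<open>k = 4\<close>. Two equations of
  that system express this function by the fourth one at \<open>x\<close> and at \<open>x p\<^sup>2\<close>, and the latter term, shifted
  back by one step, accounts for the summands \<open>-1\<close> and \<open>q\<^bsup>3r\<^esup>\<close> in the listed sum. The factor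
  \<open>1/(a q\<^sup>3)\<close> is removed by multiplying both sides by \<open>a q\<^sup>3\<close>.
\<close>

lemma F353_eq: "F353 = J35 3 av"
proof -
  let ?p = "qv ^ 3 :: series" and ?x = av
  let ?y = "\<lambda>r. ?x * ?p ^ (2 * r)" and ?c = "gordon_factor 3"
  let ?W = "raise_weight 3 4 ?x"
  let ?S = "\<lambda>r. S3 0 0 (?y r)"
  have y: "?x * ?p ^ m \<in> adm" for m by (intro adm_mult_qv_power adm_av)
  have p0: "?p \<noteq> 0" and x0: "?x \<noteq> 0" by (simp_all add: av_def)
  have px: "ord_ge 0 (?x ^ l * ?p ^ m)" for l m by (rule ord_ge_monomial[OF adm_av])
  have pp: "ord_ge 0 (?p ^ m)" for m by (intro ord_ge_power_0 ord_ge_qv)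
  let ?f = "\<lambda>r. ?p ^ r + ?x * ?p ^ (2 * r + 1) - 1"
  \<comment> \<open>At \<open>r = 0\<close> the numerator is \<open>x p\<close> and cancels the denominator; for \<open>r > 0\<close> the weak lower bound
    \<open>-3r\<close> for the order absorbs the factor \<open>1/p\<close>.\<close>
  define w where "w = (\<lambda>r. ?x ^ r * ?p ^ (r * r) * ?f r / (?x * ?p))"
  have w: "ord_ge (- int (3 * r)) (w r)" for r
  proof (cases "r = 0")
    case True
    then show ?thesis using p0 x0 by (simp add: w_def ord_ge_1)
  next
    case False
    have "ord_ge 0 (?x ^ r * ?p ^ (r * r) * ?f r / ?x)"
      by (intro ord_ge_divide ord_ge_mult_right[OF px] ord_ge_diff ord_ge_add ord_ge_1 pp unit_av
          ord_ge_adm[OF y])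
    from ord_ge_mult[OF this one_over_qv_cube[of 1]] have "ord_ge (- 3) (w r)"
      by (simp add: w_def)
    then show ?thesis by (rule ord_ge_mono) (use False in simp)
  qed
  have "F353 = double3_sum w ?x"
    unfolding F353_def double3_sum_def
  proof (intro infsum_cong, clarify)
    fix n r :: nat
    have "(int n)\<^sup>2 + 3 * (int r)\<^sup>2 - 3 = int (n * n + 3 * (r * r)) - int 3"
      by (simp add: power2_eq_square)
    then have q: "qv powi ((int n)\<^sup>2 + 3 * (int r)\<^sup>2 - 3) = qv ^ (n * n) * ?p ^ (r * r) / ?p"
      by (simp only: power_int_diff[OF disjI1[OF qv_nonzero]] power_int_of_nat power_add power_mult)
    have "int n + int r - 1 = int (n + r) - int 1" by simp
    then have a: "av powi (int n + int r - 1) = av ^ n * av ^ r / av"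
      using x0 by (simp only: power_int_diff[OF disjI1[OF x0]] power_int_of_nat power_add power_one_right)
    have "6 * r + 3 = 3 * (2 * r + 1)" by simp
    then have f: "qv ^ (3 * r) + av * qv ^ (6 * r + 3) - 1 = ?f r" by (simp only: power_mult)
    have gen: "an * ar / a * (qn * q2 / q) * P * f / Q * R * R' = ar * q2 * f / (a * q) * (an * qn) * (P / Q) * R * R'"
      for an ar a qn q2 q P f Q R R' :: series by simp
    show "av powi (int n + int r - 1) * qv powi ((int n)\<^sup>2 + 3 * (int r)\<^sup>2 - 3) *
        qpoch av (qv ^ 3) (n - r) * (qv ^ (3 * r) + av * qv ^ (6 * r + 3) - 1) / qpoch av qv (2 * n) *
        recip_qpoch qv (int n - 3 * int r) * recip_qpoch (qv ^ 3) (int r) = double3_term w av n r"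
      unfolding double3_term_def q a f w_def by (rule gen)
  qed
  also have "\<dots> = infsum (\<lambda>r. w r * raise_weight 3 3 ?x r * ?S r) UNIV"
    unfolding double3_sum_def by (rule double3_by_columns[OF adm_av w])
  finally have F: "F353 = infsum (\<lambda>r. w r * raise_weight 3 3 ?x r * ?S r) UNIV" .
  define a where "a = (\<lambda>r. - (?W r * (1 - ?p ^ r) * ?S r))"
  define b where "b = (\<lambda>r. ?x * ?p * (?W r * ?p ^ (2 * r) * ?S r))"
  have S: "ord_ge 0 (?S r)" for r by (intro ord_ge_S3 y)
  have W: "ord_ge (int r) (?W r)" for r by (intro ord_ge_weights adm_av) auto
  have a: "ord_ge (int r) (a r)" for r
    unfolding a_def by (intro ord_ge_uminus ord_ge_mult_right[OF ord_ge_mult_right[OF W]] ord_ge_diff ord_ge_1 pp S)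
  have b: "ord_ge (int r) (b r)" for r
    unfolding b_def using px[of 1 1]
    by (intro ord_ge_mult_left[of "?x * ?p"] ord_ge_mult_right[OF ord_ge_mult_right[OF W]] pp S) simp
  have left: "?x * ?p * (w r * raise_weight 3 3 ?x r * ?S r) = a r + b r" for r
  proof -
    have "?x * ?p * w r = ?x ^ r * ?p ^ (r * r) * ?f r" using p0 x0 by (simp add: w_def)
    then have "?x * ?p * (w r * raise_weight 3 3 ?x r * ?S r) = ?W r * ?f r * ?S r"
      unfolding raise_weight_3_4 by (simp only: mult.assoc[symmetric]) (simp only: mult_ac)
    also have "\<dots> = a r + b r" unfolding a_def b_def by (simp add: algebra_simps)
    finally show ?thesis .
  qed
  have right: "?x * ?p * (?W r * ?p ^ (2 * r) * F34_fun 3 (?y r)) = a (Suc r) + b r" for r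
  proof -
    have z: "?y r * ?p * ?p = ?y (Suc r)" "?x * ?p ^ (2 * r + 1) = ?y r * ?p" by (simp_all add: mult_ac)
    have zadm: "?y r * ?p \<in> adm" by (intro adm_mult_qv y)
    have "F34_fun 1 (?y r * ?p) = ?c (?y r * ?p) * ?S (Suc r)"
      using gordon_systemD(2)[OF F34_gordon_system zadm, of 1] gordon_systemD(1)[OF F34_gordon_system zadm]
      unfolding z(1) by (simp add: F34_top)
    then have F3: "F34_fun 3 (?y r) = ?S r - (?y r * ?p) ^ 3 * ?c (?y r) * (?c (?y r * ?p) * ?S (Suc r))"
      using gordon_systemD(2)[OF F34_gordon_system y, of 4 "2 * r"] by (simp add: F34_top)
    have aS: "a (Suc r) = - (?W r * ?x ^ 4 * ?p ^ (4 * (2 * r + 1)) * ?c (?y r) * ?c (?y r * ?p) * ?S (Suc r))"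
      unfolding a_def raise_weight_Suc[OF zero_less_numeral] z(2) ..
    have E: "?x * ?p * ?p ^ (2 * r) * (?y r * ?p) ^ 3 = ?x ^ 4 * ?p ^ (4 * (2 * r + 1))"
    proof -
      have "?x * ?p * ?p ^ (2 * r) * (?y r * ?p) ^ 3 = (?x * (?p ^ (2 * r) * ?p)) ^ 4"
        by (simp add: eval_nat_numeral mult_ac)
      also have "?p ^ (2 * r) * ?p = ?p ^ (2 * r + 1)" by simp
      finally show ?thesis
        unfolding power_mult_distrib power_mult[of ?p "2 * r + 1" 4, symmetric] by (simp only: mult.commute)
    qed
    have gen: "X * P * (W * R * (s - Y * c * (c' * s'))) = - (W * (X * P * R * Y) * c * c' * s') + X * P * (W * R * s)"
      for X P W R s Y c c' s' :: series by (simp add: algebra_simps)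
    show ?thesis unfolding F3 aS b_def mult.assoc[of "?W r" "?x ^ 4"] E[symmetric] by (rule gen)
  qed
  have "?x * ?p * F353 = infsum (\<lambda>r. a r + b r) UNIV"
    unfolding F left[symmetric] by (rule infsum_cmult_right'[symmetric])
  also have "\<dots> = infsum (\<lambda>r. a (Suc r) + b r) UNIV"
    by (rule infsum_add_shift[OF a b]) (simp add: a_def)
  also have "\<dots> = ?x * ?p * J35 3 ?x"
    unfolding right[symmetric] J35_def raise_def infsum_cmult_right' by simp
  finally show ?thesis using p0 x0 by simp
qed

text \<open>
  The summand \<open>a q\<^bsup>3r\<^esup>\<close> of the bracket reproduces the sum for \<open>i = 3\<close>. The remaining \<open>1 - q\<^bsup>3r\<^esup>\<close>
  becomes, after a shift, a multiple of the same sum at \<open>a q\<^sup>6\<close>; by the equations of the system for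
  \<open>i = 3\<close> at \<open>a\<close> and for \<open>i = 1\<close> at \<open>a q\<^sup>3\<close>, this multiple is the difference between the functions
  with \<open>i = 2\<close> and \<open>i = 3\<close>.
\<close>

lemma F332_eq: "F332 = J33 2 av"
proof -
  let ?p = "qv ^ 3 :: series" and ?x = av
  let ?y = "\<lambda>r. ?x * ?p ^ (2 * r)" and ?c = "gordon_factor 3"
  let ?W = "lower_weight 3 3"
  let ?S = "\<lambda>r. S3 0 0 (?y r)"
  have y: "?x * ?p ^ m \<in> adm" for m by (intro adm_mult_qv_power adm_av)
  have p0: "?p \<noteq> 0" and x0: "?x \<noteq> 0" by (simp_all add: av_def)
  have ox: "ord_ge 0 ?x" by (rule ord_ge_adm[OF adm_av])
  have pp: "ord_ge 0 (?p ^ m)" for m by (intro ord_ge_power_0 ord_ge_qv)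
  let ?f = "\<lambda>r. 1 + ?x * ?p ^ r - ?p ^ r"
  define w where "w = (\<lambda>r. (-1) ^ r * ?p ^ (r choose 2) * ?f r / ?x * (1 / ?p ^ r))"
  have w: "ord_ge (- int (3 * r)) (w r)" for r
  proof -
    have "ord_ge 0 ((-1) ^ r * ?p ^ (r choose 2) * ?f r / ?x)"
      by (intro ord_ge_divide ord_ge_mult_right ord_ge_minus_one_power ord_ge_diff ord_ge_add ord_ge_1
          ord_ge_mult_right[OF ox] pp unit_av)
    from ord_ge_mult[OF this one_over_qv_cube[of r]] show ?thesis by (simp add: w_def)
  qed
  have "F332 = double3_sum w ?x"
    unfolding F332_def double3_sum_def
  proof (intro infsum_cong, clarify)
    fix n r :: nat
    have "int (r * r) = int (2 * (r choose 2) + r)" by (simp only: two_choose_two)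
    then have "3 * int r * (int r - 3) = 2 * (3 * int (r choose 2) - 3 * int r)"
      by (simp add: algebra_simps)
    then have "(int n)\<^sup>2 + 3 * int r * (int r - 3) div 2 = int (n * n + 3 * (r choose 2)) - int (3 * r)"
      by (simp add: power2_eq_square)
    then have q: "qv powi ((int n)\<^sup>2 + 3 * int r * (int r - 3) div 2) = qv ^ (n * n) * ?p ^ (r choose 2) / ?p ^ r"
      by (simp only: power_int_diff[OF disjI1[OF qv_nonzero]] power_int_of_nat power_add power_mult)
    have "int n - 1 = int n - int 1" by simp
    then have a: "av powi (int n - 1) = av ^ n / av"
      by (simp only: power_int_diff[OF disjI1[OF x0]] power_int_of_nat power_one_right)
    have gen: "s * (an / a) * (qn * q2 / q) * P * f / Q * R * R' = s * q2 * f / a * (1 / q) * (an * qn) * (P / Q) * R * R'"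
      for s an a qn q2 q P f Q R R' :: series by simp
    show "(-1) ^ r * av powi (int n - 1) * qv powi ((int n)\<^sup>2 + 3 * int r * (int r - 3) div 2) *
        qpoch av (qv ^ 3) (n - r) * (1 + av * qv ^ (3 * r) - qv ^ (3 * r)) / qpoch av qv (2 * n) *
        recip_qpoch qv (int n - 3 * int r) * recip_qpoch (qv ^ 3) (int r) = double3_term w av n r"
      unfolding double3_term_def q a w_def power_mult[of qv 3 r] by (rule gen)
  qed
  also have "\<dots> = infsum (\<lambda>r. w r * raise_weight 3 3 ?x r * ?S r) UNIV"
    unfolding double3_sum_def by (rule double3_by_columns[OF adm_av w])
  finally have F: "F332 = infsum (\<lambda>r. w r * raise_weight 3 3 ?x r * ?S r) UNIV" .
  define a where "a = (\<lambda>r. ?W ?x r * (1 - ?p ^ r) / ?p ^ r * ?S r)"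
  define b where "b = (\<lambda>r. ?x * (?W ?x r * ?S r))"
  define e where "e = (\<lambda>r. ?W (?x * ?p * ?p) r * S3 0 0 (?x * ?p * ?p * ?p ^ (2 * r)))"
  have S: "ord_ge 0 (?S r)" for r by (intro ord_ge_S3 y)
  have W: "ord_ge (int r) (?W ?x r)" for r by (intro ord_ge_weights adm_av) auto
  have z: "?x * ?p * ?p * ?p ^ (2 * r) = ?y (Suc r)" "?x * ?p ^ (2 * r + 1) = ?y r * ?p"
    "?x * ?p * ?p ^ (2 * r) = ?y r * ?p" for r
    by (simp_all add: mult_ac)
  have W2: "?c ?x * ?c (?x * ?p) * ?W (?x * ?p * ?p) r =
      ?W ?x r * (?p ^ (3 * r) * ?p ^ (3 * r)) * ?c (?y r) * ?c (?y r * ?p)" for r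
  proof -
    have "?c ?x * ?c (?x * ?p) * ?W (?x * ?p * ?p) r = ?c ?x * (?c (?x * ?p) * ?W (?x * ?p * ?p) r)"
      by (simp only: mult.assoc)
    also have "\<dots> = (?c ?x * ?W (?x * ?p) r) * ?p ^ (3 * r) * ?c (?y r * ?p)"
      unfolding lower_weight_shift[of 3 "?x * ?p" 3 r] z(3) by (simp only: mult_ac)
    also have "\<dots> = ?W ?x r * (?p ^ (3 * r) * ?p ^ (3 * r)) * ?c (?y r) * ?c (?y r * ?p)"
      unfolding lower_weight_shift by (simp only: mult_ac)
    finally show ?thesis .
  qed
  have aS: "a (Suc r) = - (?x ^ 3 * ?p ^ 2 * ?c ?x * ?c (?x * ?p)) * e r" for r
  proof -
    have "3 * (2 * r + 1) + r = Suc r + (2 + (3 * r + 3 * r))" by simp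
    then have "?p ^ (3 * (2 * r + 1) + r) = ?p ^ Suc r * (?p ^ 2 * (?p ^ (3 * r) * ?p ^ (3 * r)))"
      by (simp only: power_add)
    then have P: "?p ^ (3 * (2 * r + 1) + r) / ?p ^ Suc r = ?p ^ 2 * (?p ^ (3 * r) * ?p ^ (3 * r))"
      using p0 by simp
    have "a (Suc r) = - (?W ?x r * ?x ^ 3 * (?p ^ (3 * (2 * r + 1) + r) / ?p ^ Suc r) * ?c (?y r) * ?c (?y r * ?p)) * ?S (Suc r)"
      unfolding a_def lower_weight_Suc[OF zero_less_numeral] z(2)
      by (simp only: times_divide_eq_left times_divide_eq_right minus_divide_left mult_ac)
    also have "\<dots> = - (?x ^ 3 * ?p ^ 2 * (?W ?x r * (?p ^ (3 * r) * ?p ^ (3 * r)) * ?c (?y r) * ?c (?y r * ?p))) * ?S (Suc r)"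
      unfolding P by (simp only: mult_ac)
    also have "\<dots> = - (?x ^ 3 * ?p ^ 2 * ?c ?x * ?c (?x * ?p)) * e r"
      unfolding W2[symmetric] e_def z(1) by (simp add: mult_ac)
    finally show ?thesis .
  qed
  have a: "ord_ge (int r) (a r)" for r
  proof (cases r)
    case 0
    then show ?thesis by (simp add: a_def)
  next
    case (Suc m)
    have "?x * ?p * ?p \<in> adm" using y[of 2] by (simp add: power2_eq_square mult_ac)
    then have e: "ord_ge (int m) (e m)"
      unfolding e_def by (intro ord_ge_mult_right ord_ge_weights ord_ge_S3 adm_mult_qv_power) auto
    have "ord_ge 1 (?x ^ 3 * ?p ^ 2 * ?c ?x * ?c (?x * ?p))"
    proof -
      have "ord_ge (int 1) (?x ^ 3 * qv ^ 6 * (?c ?x * ?c (?x * ?p)))"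
        using y[of 1] by (intro ord_ge_term adm_av ord_ge_mult_left unit_series_ord_ge unit_gordon_factor) auto
      then show ?thesis by (simp add: power_mult[symmetric] mult.assoc)
    qed
    from ord_ge_mult[OF ord_ge_uminus[OF this] e] show ?thesis
      unfolding Suc aS by simp
  qed
  have b: "ord_ge (int r) (b r)" for r
    unfolding b_def by (intro ord_ge_mult_left[OF ox] ord_ge_mult_right[OF W] S)
  have left: "?x * (w r * raise_weight 3 3 ?x r * ?S r) = a r + b r" for r
  proof -
    have "?x * (w r * raise_weight 3 3 ?x r * ?S r) = ?W ?x r * (?f r / ?p ^ r) * ?S r"
      using x0 unfolding w_def lower_weight_def by simp
    also have "?f r / ?p ^ r = (1 - ?p ^ r) / ?p ^ r + ?x"
      using p0 by (simp add: field_simps)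
    finally show ?thesis unfolding a_def b_def by (simp add: algebra_simps)
  qed
  have "?x * F332 = infsum (\<lambda>r. a r + b r) UNIV"
    unfolding F left[symmetric] by (rule infsum_cmult_right'[symmetric])
  also have "\<dots> = infsum (\<lambda>r. a (Suc r) + b r) UNIV"
    by (rule infsum_add_shift[OF a b]) (simp add: a_def)
  also have "\<dots> = infsum (\<lambda>r. a (Suc r)) UNIV + infsum b UNIV"
    by (intro infsum_add summable_nat_flsI b ord_ge_mono[OF a]) simp
  also have "infsum b UNIV = ?x * J33 4 ?x"
    unfolding b_def J33_sum infsum_cmult_right' ..
  also have "infsum (\<lambda>r. a (Suc r)) UNIV = - (?x ^ 3 * ?p ^ 2 * ?c ?x * ?c (?x * ?p)) * J33 4 (?x * ?p * ?p)"
    unfolding aS e_def J33_sum infsum_cmult_right' ..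
  finally have F': "?x * F332 = - (?x ^ 3 * ?p ^ 2 * ?c ?x * ?c (?x * ?p)) * J33 3 (?x * ?p * ?p) + ?x * J33 3 ?x"
    using J33_4[OF adm_av] J33_4[OF y[of 2]] by (simp add: power2_eq_square mult.assoc)
  have xp: "?x * ?p \<in> adm" using y[of 1] by simp
  have J1: "J33 1 (?x * ?p) = ?c (?x * ?p) * J33 3 (?x * ?p * ?p)"
    using gordon_systemD(2)[OF J33_system xp, of 1] gordon_systemD(1)[OF J33_system xp] by simp
  have "J33 3 ?x = J33 2 ?x + (?x * ?p) ^ 2 * ?c ?x * J33 1 (?x * ?p)"
    using gordon_systemD(2)[OF J33_system adm_av, of 3] by simp
  then have "?x * F332 = ?x * J33 2 ?x"
    unfolding F' J1 by (simp add: eval_nat_numeral algebra_simps)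
  then show ?thesis using x0 by simp
qed

section \<open>The identities\<close>

lemma Q_eq_solution:
  assumes "gordon_system d k f" "d > 0" "i \<le> k"
  shows "Q_series d k i = f i av"
  using gordon_system_unique[OF Q_gordon_system assms(1) _ adm_av] assms by (simp add: Q_series_eq)

theorem corollary4p6:
  shows "(\<forall>d k i :: nat. 1 \<le> d \<and> 1 \<le> k \<and> 1 \<le> i \<and> i \<le> k \<longrightarrow>
            B_series d k i = Q_series d k i) \<and>
         (\<forall>d k i :: nat.
            (d, k) \<in> {(2, 2), (2, 3), (2, 4), (3, 3), (3, 4), (3, 5)} \<and> 1 \<le> i \<and> i \<le> k \<longrightarrow>
            B_series d k i = Q_series d k i \<and> Q_series d k i = F_series d k i)"
proof (intro conjI allI impI)
  fix d k i :: nat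
  assume "1 \<le> d \<and> 1 \<le> k \<and> 1 \<le> i \<and> i \<le> k"
  then show "B_series d k i = Q_series d k i" by (intro B_eq_Q) auto
next
  fix d k i :: nat
  assume A: "(d, k) \<in> {(2, 2), (2, 3), (2, 4), (3, 3), (3, 4), (3, 5)} \<and> 1 \<le> i \<and> i \<le> k"
  then show "B_series d k i = Q_series d k i" by (intro B_eq_Q) auto
  consider "d = 2" "k = 2" | "d = 2" "k = 3" | "d = 2" "k = 4"
    | "d = 3" "k = 3" | "d = 3" "k = 4" | "d = 3" "k = 5" using A by auto
  then show "Q_series d k i = F_series d k i"
  proof cases
    case 1
    then have "i = 1 \<or> i = 2" using A by auto
    then show ?thesis using 1 Q_eq_solution[OF F22_gordon_system]
      by (auto simp: F_series_def F221_eq F222_eq)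
  next
    case 2
    then have "i = 1 \<or> i = 2 \<or> i = 3" using A by auto
    then show ?thesis using 2 Q_eq_solution[OF F23_gordon_system]
      by (auto simp: F_series_def F231_eq F232_eq F233_eq)
  next
    case 3
    then have "i = 1 \<or> i = 2 \<or> i = 3 \<or> i = 4" using A by auto
    then show ?thesis using 3 Q_eq_solution[OF J24_system]
      by (auto simp: F_series_def F241_eq F242_eq F243_eq F244_eq)
  next
    case 4
    then have "i = 1 \<or> i = 2 \<or> i = 3" using A by auto
    then show ?thesis using 4 Q_eq_solution[OF J33_system]
      by (auto simp: F_series_def F331_eq F332_eq F333_eq)
  next
    case 5
    then have "i = 1 \<or> i = 2 \<or> i = 3 \<or> i = 4" using A by auto
    then show ?thesis using 5 Q_eq_solution[OF F34_gordon_system]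
      by (auto simp: F_series_def F341_eq F342_eq F343_eq F344_eq)
  next
    case 6
    then have "i = 1 \<or> i = 2 \<or> i = 3 \<or> i = 4 \<or> i = 5" using A by auto
    then show ?thesis using 6 Q_eq_solution[OF J35_system]
      by (auto simp: F_series_def F351_eq F352_eq F353_eq F354_eq F355_eq)
  qed
qed

end
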